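(* Let $G$ be a connected graph of order $n\ge 4$. Then $rx_4(G)=n-1$ if and only if $G$ is a tree, or a unicyclic graph, or a cactus with cyclomatic number $c(G)=2$, or $G\in\mathcal{G}_1\cup\mathcal{G}_2$.
   Context: All graphs are simple and finite. For a connected graph $G$, an edge-coloring $c:E(G)\to\{1,\dots,q\}$ (adjacent edges may get the same color) is a $k$-rainbow coloring if for every set $S$ of $k$ vertices there is a tree in $G$ containing $S$ whose edges have pairwise distinct colors. The $k$-rainbow index $rx_k(G)$ is the minimum $q$ for which a $k$-rainbow coloring exists. The cyclomatic number of a connected graph with $n$ vertices and $m$ edges is $c(G)=m-n+1$; $G$ is unicyclic if $c(G)=1$. A cactus is a connected graph in which every edge lies on at most one cycle. $\mathcal{G}_1$ is the set of graphs obtained from $K_4$ by identifying each vertex of $K_4$ with an end-vertex of an arbitrary path (the four paths being vertex-disjoint otherwise). $\mathcal{G}_2$ is the set of graphs obtained from $K_4-e$ ($K_4$ minus one edge) by identifying each vertex of $K_4-e$ with the root of an arbitrary tree (the four trees being vertex-disjoint otherwise). *)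

theory Defs
  imports Main "HOL-Library.Disjoint_Sets"
begin

definition all_pairs :: "'a set \<Rightarrow> 'a set set" where
  "all_pairs V = {e. e \<subseteq> V \<and> card e = 2}"

definition simple_graph :: "'a set \<Rightarrow> 'a set set \<Rightarrow> bool" where
  "simple_graph V E \<longleftrightarrow> finite V \<and> E \<subseteq> all_pairs V"

definition connected_graph :: "'a set \<Rightarrow> 'a set set \<Rightarrow> bool" where
  "connected_graph V E \<longleftrightarrow>
     V \<noteq> {} \<and> (\<forall>u\<in>V. \<forall>v\<in>V. (u, v) \<in> {(x, y). {x, y} \<in> E}\<^sup>*)"

definition path_edges :: "'a list \<Rightarrow> 'a set set" where
  "path_edges xs = {{xs ! i, xs ! Suc i} | i. Suc i < length xs}"

text \<open>A cycle is represented by its edge set, not by a vertex list, so that rotating or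
  reversing the traversal does not give a different cycle.\<close>

definition cycle_in :: "'a set set \<Rightarrow> 'a set set \<Rightarrow> bool" where
  "cycle_in E C \<longleftrightarrow>
     C \<subseteq> E \<and> (\<exists>xs. 3 \<le> length xs \<and> distinct xs \<and> C = insert {last xs, hd xs} (path_edges xs))"

definition tree_graph :: "'a set \<Rightarrow> 'a set set \<Rightarrow> bool" where
  "tree_graph V E \<longleftrightarrow> simple_graph V E \<and> connected_graph V E \<and> (\<nexists>C. cycle_in E C)"

definition cyclomatic :: "'a set \<Rightarrow> 'a set set \<Rightarrow> int" where
  "cyclomatic V E = int (card E) - int (card V) + 1"

definition unicyclic :: "'a set \<Rightarrow> 'a set set \<Rightarrow> bool" where
  "unicyclic V E \<longleftrightarrow> connected_graph V E \<and> cyclomatic V E = 1"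

definition cactus :: "'a set \<Rightarrow> 'a set set \<Rightarrow> bool" where
  "cactus V E \<longleftrightarrow> connected_graph V E \<and>
     (\<forall>e\<in>E. \<forall>C D. cycle_in E C \<and> e \<in> C \<and> cycle_in E D \<and> e \<in> D \<longrightarrow> C = D)"

definition rainbow_coloring ::
  "nat \<Rightarrow> 'a set \<Rightarrow> 'a set set \<Rightarrow> nat \<Rightarrow> ('a set \<Rightarrow> nat) \<Rightarrow> bool" where
  "rainbow_coloring k V E q c \<longleftrightarrow>
     c ` E \<subseteq> {1..q} \<and>
     (\<forall>S. S \<subseteq> V \<and> card S = k \<longrightarrow>
        (\<exists>VT ET. VT \<subseteq> V \<and> ET \<subseteq> E \<and> tree_graph VT ET \<and> S \<subseteq> VT \<and> inj_on c ET))"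

text \<open>A rainbow coloring exists whenever the graph is connected (color the edges injectively);
  only then is the following value meaningful.\<close>

definition rainbow_index :: "nat \<Rightarrow> 'a set \<Rightarrow> 'a set set \<Rightarrow> nat" where
  "rainbow_index k V E = (LEAST q. \<exists>c. rainbow_coloring k V E q c)"

text \<open>Identifying each vertex \<open>w\<close> of a core graph \<open>(W, F)\<close> with a vertex of its own graph
  \<open>(A w, B w)\<close> is modelled by labelling the latter so that the identified vertex already is
  \<open>w\<close>. Any other labelling gives an isomorphic graph, and the resulting classes are closed
  under isomorphism.\<close>

definition attachment ::
  "'a set \<Rightarrow> 'a set set \<Rightarrow> ('a \<Rightarrow> 'a set) \<Rightarrow> ('a \<Rightarrow> 'a set set) \<Rightarrow> 'a set \<Rightarrow> 'a set set \<Rightarrow> bool" where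
  "attachment W F A B V E \<longleftrightarrow>
     (\<forall>w\<in>W. w \<in> A w) \<and> disjoint_family_on A W \<and>
     V = (\<Union>w\<in>W. A w) \<and> E = F \<union> (\<Union>w\<in>W. B w)"

text \<open>The path may be trivial, i.e. consist of \<open>w\<close> alone. Since lists can be reversed,
  taking the head to be the given end-vertex is no restriction.\<close>

definition path_graph_from :: "'a \<Rightarrow> 'a set \<Rightarrow> 'a set set \<Rightarrow> bool" where
  "path_graph_from w A B \<longleftrightarrow>
     (\<exists>xs. xs \<noteq> [] \<and> distinct xs \<and> hd xs = w \<and> A = set xs \<and> B = path_edges xs)"

definition K4_with_paths :: "('a set \<times> 'a set set) set" where
  "K4_with_paths = {(V, E). \<exists>W A B. card W = 4 \<and>
     (\<forall>w\<in>W. path_graph_from w (A w) (B w)) \<and>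
     attachment W (all_pairs W) A B V E}"

definition K4_minus_edge_with_trees :: "('a set \<times> 'a set set) set" where
  "K4_minus_edge_with_trees = {(V, E). \<exists>W e A B. card W = 4 \<and> e \<in> all_pairs W \<and>
     (\<forall>w\<in>W. tree_graph (A w) (B w)) \<and>
     attachment W (all_pairs W - {e}) A B V E}"

end

theory Submission
  imports Defs
begin

text \<open>
  Colouring a spanning tree injectively shows that \<open>n - 1\<close> colours always suffice, so the question is
  when \<open>n - 2\<close> colours do. Contracting an edge and giving it a fresh colour shows that the
  bound \<open>rx\<^sub>4 \<le> n - 2\<close> passes from a connected minor to the graph. Hence it is enough to
  colour a few small minors: \<open>K\<^bsub>2,3\<^esub>\<close>, the 5-cycle with a chord, two triangles and a double edge at a
  common vertex, \<open>K\<^sub>4 - e\<close> with a triangle at a vertex, and \<open>K\<^sub>4\<close> with two pendant edges at a vertex.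

  The structural input is that a connected graph is a cactus iff it has no bond with three edges.
  A bond with three edges gives a \<open>K\<^sub>4 - e\<close> minor whose branch sets cover the graph; if none of the small
  minors occurs, each branch set meets the others in a single vertex and is a tree, which yields the
  two exceptional classes. Without such a bond, three independent cycles give the minor made of two
  triangles and a double edge.

  Conversely, given \<open>n - 2\<close> colours, take a set \<open>M\<close> of edges using \<open>j \<le> 2\<close> colours: four vertices in
  different components of \<open>E - M\<close> can only be joined if there are at most \<open>j + 1\<close> components, which
  contradicts a count of edges unless the cyclomatic number is at least two. When it is two, there are
  six edges in three colours leaving five components, none of which separates the graph. Then some
  component has three outgoing edges, a bond that a cactus does not have, and all six edges lie on
  cycles, while \<open>K\<^sub>4 - e\<close> with trees attached has only five such edges. For \<open>K\<^sub>4\<close> with paths attached, a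
  tree containing the four ends spans the graph.
\<close>

subsection \<open>Reachability and connected vertex sets\<close>

text \<open>The number four governs both directions. A graph with cyclomatic number \<open>a\<close>
  has n - 1 + a edges, so under n - 2 colours at least a + 1 edges repeat a colour. Removing a + 1
  repeats together with one partner for each of their \<open>j\<close> colours leaves at least j + 2
  components. Four vertices can meet j + 2 different components only if j is at most 2, which is
  automatic for a at most 1. For a = 2 the case of three colours and five components survives,
  because four vertices always miss one of five components; that is the obstacle. The colourings of
  minors exploit the same gap: five parts joined by six edges in three colours, where whichever part
  is missed, the other four are joined by one edge of each colour. A further part that contracts to
  a cut vertex may belong to every tree, which explains the patterns with six parts, eight edges and
  four colours. For K4 with paths a = 3, so the count says nothing and the ends of the paths have to
  be used.\<close>

definition reach :: "'a set set \<Rightarrow> 'a \<Rightarrow> 'a \<Rightarrow> bool" where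
  "reach E x y \<longleftrightarrow> (x, y) \<in> {(x, y). {x, y} \<in> E}\<^sup>*"

definition induced :: "'a set set \<Rightarrow> 'a set \<Rightarrow> 'a set set" where
  "induced E X = {e \<in> E. e \<subseteq> X}"

text \<open>Branch sets of minors are sets of this kind: walks must stay inside \<open>X\<close>,
  and an empty set is excluded because a part has to become a vertex after contraction.\<close>

definition conn_set :: "'a set set \<Rightarrow> 'a set \<Rightarrow> bool" where
  "conn_set E X \<longleftrightarrow> X \<noteq> {} \<and> (\<forall>u\<in>X. \<forall>v\<in>X. reach (induced E X) u v)"

definition joined :: "'a set set \<Rightarrow> 'a set \<Rightarrow> 'a set \<Rightarrow> bool" where
  "joined E X Y \<longleftrightarrow> (\<exists>x\<in>X. \<exists>y\<in>Y. {x, y} \<in> E)"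

text \<open>The component of \<open>x\<close>. Components are counted as the size of the image of a
  vertex set under \<open>cls E\<close>, so isolated vertices count, and only components that meet
  the given set do.\<close>

definition cls :: "'a set set \<Rightarrow> 'a \<Rightarrow> 'a set" where
  "cls E x = {y. reach E x y}"

lemma connected_graph_reach:
  "connected_graph V E \<longleftrightarrow> V \<noteq> {} \<and> (\<forall>u\<in>V. \<forall>v\<in>V. reach E u v)"
  by (simp add: connected_graph_def reach_def)

lemma conn_set_connected_graph: "conn_set E X \<longleftrightarrow> connected_graph X (induced E X)"
  by (simp add: conn_set_def connected_graph_reach)

lemma reach_refl [simp]: "reach E x x"
  by (simp add: reach_def)

lemma reach_trans [trans]: "reach E x y \<Longrightarrow> reach E y z \<Longrightarrow> reach E x z"
  unfolding reach_def by (rule rtrancl_trans)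

lemma reach_edge: "{x, y} \<in> E \<Longrightarrow> reach E x y"
  unfolding reach_def by (rule r_into_rtrancl) simp

lemma reach_induct [consumes 1, case_names refl step]:
  assumes "reach E x y" "P x"
    "\<And>y z. reach E x y \<Longrightarrow> {y, z} \<in> E \<Longrightarrow> P y \<Longrightarrow> P z"
  shows "P y"
  using assms(1) unfolding reach_def
proof (induction rule: rtrancl_induct)
  case base
  show ?case by (rule assms(2))
next
  case (step y z)
  then show ?case using assms(3)[of y z] by (auto simp: reach_def)
qed

lemma reach_sym: "reach E x y \<Longrightarrow> reach E y x"
proof (induction rule: reach_induct)
  case (step y z)
  then have "reach E z y" by (auto intro: reach_edge simp: insert_commute)
  then show ?case using step.IH by (rule reach_trans)
qed simp

lemma reach_mono: "reach E x y \<Longrightarrow> E \<subseteq> E' \<Longrightarrow> reach E' x y"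
proof (induction rule: reach_induct)
  case (step y z)
  then show ?case by (meson reach_edge reach_trans subsetD)
qed simp

text \<open>Walks survive any vertex map under which the ends of an edge stay connected. The map of
  interest is a retraction of the graph onto one of the trees attached to K4 - e.\<close>

lemma reach_lift:
  assumes "reach E x y" "\<And>x y. {x, y} \<in> E \<Longrightarrow> reach E' (f x) (f y)"
  shows "reach E' (f x) (f y)"
  using assms(1)
proof (induction rule: reach_induct)
  case (step y z)
  then show ?case using assms(2) reach_trans by metis
qed simp

lemma reach_replace:
  assumes "reach E x y" "\<And>x y. {x, y} \<in> E \<Longrightarrow> reach E' x y"
  shows "reach E' x y"
  using reach_lift[of E x y E' id] assms by simp

lemma reach_closed:
  assumes "reach E x y" "x \<in> X" "\<And>u v. {u, v} \<in> E \<Longrightarrow> u \<in> X \<Longrightarrow> v \<in> X"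
  shows "y \<in> X"
  using assms(1,2) by (induction rule: reach_induct) (use assms(3) in auto)

lemma reach_cross:
  assumes "reach E x y" "x \<in> X" "y \<notin> X"
  obtains u v where "{u, v} \<in> E" "u \<in> X" "v \<notin> X"
  using reach_closed[OF assms(1,2)] assms(3) by blast

lemma reach_empty: "reach {} x y \<longleftrightarrow> x = y"
proof
  assume "reach {} x y"
  then show "x = y" by (induction rule: reach_induct) auto
qed simp

lemma reach_Diff_edge:
  assumes "reach E x y" "reach (E - {{u, v}}) u v"
  shows "reach (E - {{u, v}}) x y"
proof (rule reach_replace[OF assms(1)])
  fix a b assume ab: "{a, b} \<in> E"
  show "reach (E - {{u, v}}) a b"
  proof (cases "{a, b} = {u, v}")
    case True
    then have "a = u \<and> b = v \<or> a = v \<and> b = u" by (simp add: doubleton_eq_iff)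
    then show ?thesis using assms(2) reach_sym by metis
  next
    case False
    then show ?thesis using ab by (intro reach_edge) simp
  qed
qed

lemma reach_insert_cases:
  assumes "reach (insert {a, b} R) x y"
  shows "reach R x y \<or> reach R x a \<and> reach R b y \<or> reach R x b \<and> reach R a y"
  using assms
proof (induction rule: reach_induct)
  case (step y z)
  show ?case
  proof (cases "{y, z} = {a, b}")
    case True
    then have "y = a \<and> z = b \<or> y = b \<and> z = a" by (simp add: doubleton_eq_iff)
    then show ?thesis using step.IH by (meson reach_refl reach_trans)
  next
    case False
    then have "reach R y z" using step.hyps by (intro reach_edge) simp
    then show ?thesis using step.IH by (meson reach_trans)
  qed
qed simp

lemma induced_subset: "induced E X \<subseteq> E" and induced_mono: "X \<subseteq> Y \<Longrightarrow> induced E X \<subseteq> induced E Y"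
  by (auto simp: induced_def)

lemma induced_mono2: "E \<subseteq> E' \<Longrightarrow> induced E X \<subseteq> induced E' X"
  by (auto simp: induced_def)

lemma induced_induced: "induced (induced E X) Y = induced E (X \<inter> Y)"
  by (auto simp: induced_def)

lemma simple_graph_induced: "simple_graph V E \<Longrightarrow> X \<subseteq> V \<Longrightarrow> simple_graph X (induced E X)"
  by (auto simp: simple_graph_def all_pairs_def induced_def intro: finite_subset)

lemma induced_UNIV: "simple_graph V E \<Longrightarrow> induced E V = E"
  by (auto simp: induced_def simple_graph_def all_pairs_def)

lemma simple_graph_subset: "simple_graph V E \<Longrightarrow> F \<subseteq> E \<Longrightarrow> simple_graph V F"
  by (auto simp: simple_graph_def)

lemma simple_graph_finite: "simple_graph V E \<Longrightarrow> finite V" "simple_graph V E \<Longrightarrow> finite E"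
  by (auto simp: simple_graph_def all_pairs_def intro: finite_subset[of E "Pow V"])

lemma simple_graph_edge:
  assumes "simple_graph V E" "{x, y} \<in> E"
  shows "x \<in> V" "y \<in> V" "x \<noteq> y"
proof -
  have "{x, y} \<subseteq> V" "card {x, y} = 2"
    using assms unfolding simple_graph_def all_pairs_def by blast+
  then show "x \<in> V" "y \<in> V" "x \<noteq> y" by auto
qed

lemma simple_graph_edgeE:
  assumes "simple_graph V E" "e \<in> E"
  obtains x y where "e = {x, y}" "x \<in> V" "y \<in> V" "x \<noteq> y"
proof -
  have "e \<subseteq> V" "card e = 2"
    using assms unfolding simple_graph_def all_pairs_def by blast+
  then show ?thesis using that by (auto simp: card_2_iff)
qed

lemma reach_in:
  assumes "simple_graph V E" "reach E x y" "x \<in> V"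
  shows "y \<in> V"
  using assms(2,3) by (rule reach_closed) (use simple_graph_edge[OF assms(1)] in auto)

lemma conn_set_singleton: "conn_set E {x}"
  by (simp add: conn_set_def)

lemma csetI:
  assumes "r \<in> X" "\<And>x. x \<in> X \<Longrightarrow> reach (induced E X) r x"
  shows "conn_set E X"
  unfolding conn_set_def using assms by (meson empty_iff reach_sym reach_trans)

lemma conn_set_mono: "conn_set E X \<Longrightarrow> E \<subseteq> E' \<Longrightarrow> conn_set E' X"
  unfolding conn_set_def by (meson induced_mono2 reach_mono)

lemma conn_set_induced: "X \<subseteq> Y \<Longrightarrow> conn_set (induced E Y) X \<longleftrightarrow> conn_set E X"
  by (simp add: conn_set_def induced_induced Int_absorb1)

lemma joinedI: "{x, y} \<in> E \<Longrightarrow> x \<in> X \<Longrightarrow> y \<in> Y \<Longrightarrow> joined E X Y"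
  by (auto simp: joined_def)

lemma joined_sym: "joined E X Y \<Longrightarrow> joined E Y X"
  unfolding joined_def by (metis insert_commute)

lemma joined_mono: "joined E X Y \<Longrightarrow> X \<subseteq> X' \<Longrightarrow> Y \<subseteq> Y' \<Longrightarrow> E \<subseteq> E' \<Longrightarrow> joined E' X' Y'"
  unfolding joined_def by blast

lemma joined_Un: "joined E (X \<union> Y) Z \<longleftrightarrow> joined E X Z \<or> joined E Y Z"
  "joined E Z (X \<union> Y) \<longleftrightarrow> joined E Z X \<or> joined E Z Y"
  by (auto simp: joined_def)

lemma conn_set_Un:
  assumes "conn_set E X" "conn_set E Y" "joined E X Y"
  shows "conn_set E (X \<union> Y)"
proof -
  obtain x y where xy: "x \<in> X" "y \<in> Y" "{x, y} \<in> E"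
    using assms(3) by (auto simp: joined_def)
  have X: "reach (induced E (X \<union> Y)) x z" if "z \<in> X" for z
    using assms(1) that xy(1) unfolding conn_set_def
    by (meson induced_mono reach_mono sup_ge1)
  have Y: "reach (induced E (X \<union> Y)) y z" if "z \<in> Y" for z
    using assms(2) that xy(2) unfolding conn_set_def
    by (meson induced_mono reach_mono sup_ge2)
  have "reach (induced E (X \<union> Y)) x y"
    using xy by (intro reach_edge) (auto simp: induced_def)
  then show ?thesis using X Y xy(1)
    by (intro csetI[of x]) (auto intro: reach_trans)
qed

lemma conn_set_joined:
  assumes "conn_set E (X \<union> Y)" "X \<noteq> {}" "Y \<noteq> {}" "X \<inter> Y = {}"
  shows "joined E X Y"
proof -
  obtain x y where "x \<in> X" "y \<in> Y" using assms by blast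
  then have r: "reach (induced E (X \<union> Y)) x y" "y \<notin> X" using assms by (auto simp: conn_set_def)
  obtain u v where "{u, v} \<in> induced E (X \<union> Y)" "u \<in> X" "v \<notin> X"
    using reach_cross[OF r(1) \<open>x \<in> X\<close> r(2)] .
  then show ?thesis by (auto simp: joined_def induced_def)
qed

text \<open>All vertices of a walk inside \<open>X\<close> from \<open>x\<close> belong to the
  component of \<open>x\<close>, so the component is connected by its own edges.\<close>

lemma conn_set_cls_induced:
  assumes "x \<in> X"
  shows "conn_set E {z. reach (induced E X) x z}" "{z. reach (induced E X) x z} \<subseteq> X"
proof -
  let ?C = "{z. reach (induced E X) x z}"
  have "reach (induced E ?C) x z" if "reach (induced E X) x z" for z
    using that
  proof (induction rule: reach_induct)
    case (step y z)
    have "{y, z} \<in> E" using step.hyps by (auto simp: induced_def)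
    moreover have "reach (induced E X) x z" using step.hyps by (meson reach_edge reach_trans)
    ultimately have "{y, z} \<in> induced E ?C" using step.hyps(1) by (auto simp: induced_def)
    then show ?case using step.IH by (meson reach_edge reach_trans)
  qed simp
  then show "conn_set E ?C" by (intro csetI[of x]) auto
  show "?C \<subseteq> X"
  proof
    fix z assume "z \<in> ?C"
    then have "reach (induced E X) x z" by simp
    then show "z \<in> X" using assms by (rule reach_closed) (auto simp: induced_def)
  qed
qed

text \<open>\<open>P\<close> is the component of \<open>X - B\<close> that contains
  \<open>A\<close>. An edge leaving \<open>P\<close> inside \<open>X\<close> ends in
  \<open>B\<close>, so a walk from \<open>B\<close> that returns from \<open>P\<close> arrives in
  \<open>B\<close> again, and \<open>B\<close> is connected by itself; hence \<open>X - P\<close> is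
  connected. Branch sets are refined with this lemma.\<close>

lemma conn_set_split:
  assumes X: "conn_set E X" and A: "conn_set E A" "A \<subseteq> X" and B: "conn_set E B" "B \<subseteq> X"
    and disj_list: "A \<inter> B = {}"
  obtains P Q where "P \<union> Q = X" "P \<inter> Q = {}" "A \<subseteq> P" "B \<subseteq> Q" "conn_set E P" "conn_set E Q"
    "joined E P Q"
proof -
  obtain a b where a: "a \<in> A" and b: "b \<in> B" using A B by (auto simp: conn_set_def)
  define P where "P = {z. reach (induced E (X - B)) a z}"
  have aXB: "a \<in> X - B" using a A disj_list by auto
  have P: "conn_set E P" "P \<subseteq> X - B" using conn_set_cls_induced[OF aXB] by (auto simp: P_def)
  have "A \<subseteq> P"
  proof
    fix z assume "z \<in> A"
    then have "reach (induced E A) a z" using A a by (auto simp: conn_set_def)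
    moreover have "induced E A \<subseteq> induced E (X - B)" using A disj_list by (intro induced_mono) auto
    ultimately show "z \<in> P" by (auto simp: P_def intro: reach_mono)
  qed
  have Bsub: "B \<subseteq> X - P" using P B by auto
  have "conn_set E (X - P)"
  proof (rule csetI[of b])
    show "b \<in> X - P" using b Bsub by auto
    fix x assume x: "x \<in> X - P"
    have "reach (induced E X) b x" using X x b B by (auto simp: conn_set_def)
    then have "x \<in> X - P \<longrightarrow> reach (induced E (X - P)) b x"
    proof (induction rule: reach_induct)
      case (step y z)
      have yz: "{y, z} \<in> E" "y \<in> X" "z \<in> X" using step.hyps by (auto simp: induced_def)
      show ?case
      proof
        assume z: "z \<in> X - P"
        show "reach (induced E (X - P)) b z"
        proof (cases "z \<in> B")
          case True
          then have "reach (induced E B) b z" using B b by (auto simp: conn_set_def)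
          then show ?thesis using induced_mono[OF Bsub] reach_mono by metis
        next
          case False
          have "y \<notin> P"
          proof
            assume "y \<in> P"
            then have "{y, z} \<in> induced E (X - B)" "reach (induced E (X - B)) a y"
              using yz z False P by (auto simp: induced_def P_def)
            then have "z \<in> P" by (auto simp: P_def intro: reach_edge reach_trans)
            then show False using z by simp
          qed
          then have "reach (induced E (X - P)) b y" "{y, z} \<in> induced E (X - P)"
            using step.IH yz z by (auto simp: induced_def)
          then show ?thesis by (meson reach_edge reach_trans)
        qed
      qed
    qed simp
    then show "reach (induced E (X - P)) b x" using x by simp
  qed
  moreover have "P \<union> (X - P) = X" using P by auto
  then have "joined E P (X - P)"
    by (intro conn_set_joined) (use X Bsub b \<open>A \<subseteq> P\<close> a in auto)
  ultimately show ?thesis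
    using that[of P "X - P"] P \<open>A \<subseteq> P\<close> Bsub by auto
qed

lemma conn_set_split_points:
  assumes "conn_set E X" "x \<in> X" "y \<in> X" "x \<noteq> y"
  obtains P Q where "P \<union> Q = X" "P \<inter> Q = {}" "x \<in> P" "y \<in> Q" "conn_set E P" "conn_set E Q"
    "joined E P Q"
  using conn_set_split[OF assms(1) conn_set_singleton _ conn_set_singleton, of x y] assms by auto

lemma conn_set_whole: "simple_graph V E \<Longrightarrow> connected_graph V E \<Longrightarrow> conn_set E V"
  by (simp add: conn_set_connected_graph induced_UNIV)

subsection \<open>Rank\<close>

lemma cls_eq_iff: "cls E x = cls E y \<longleftrightarrow> reach E x y"
  by (auto simp: cls_def intro: reach_trans reach_sym)

text \<open>Adding \<open>{a, b}\<close> merges at most the classes of \<open>a\<close> and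
  \<open>b\<close>, so the map from old classes to new ones is injective once the class of
  \<open>b\<close> is left out.\<close>

lemma card_cls_insert:
  assumes "finite S"
  shows "card (cls R ` S) \<le> Suc (card (cls (insert e R) ` S))"
proof (cases "\<exists>a b. e = {a, b}")
  case False
  have "reach R x y" if "reach (insert e R) x y" for x y
    using that by (rule reach_replace) (metis False insertE reach_edge)
  then have "reach (insert e R) x y \<longleftrightarrow> reach R x y" for x y
    by (meson reach_mono subset_insertI)
  then have "cls (insert e R) = cls R" by (auto simp: cls_def)
  then show ?thesis by simp
next
  case True
  then obtain a b where e: "e = {a, b}" by auto
  define f where "f K = (\<Union>x\<in>K. cls (insert e R) x)" for K
  have f: "f (cls R x) = cls (insert e R) x" for x
  proof -
    have "cls (insert e R) y = cls (insert e R) x" if "y \<in> cls R x" for y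
    proof -
      have "reach R x y" using that by (simp add: cls_def)
      then have "reach (insert e R) y x" using reach_sym reach_mono subset_insertI by metis
      then show ?thesis by (simp only: cls_eq_iff)
    qed
    then have "f (cls R x) = (\<Union>y\<in>cls R x. cls (insert e R) x)"
      unfolding f_def by (rule SUP_cong[OF refl])
    moreover have "x \<in> cls R x" by (simp add: cls_def)
    ultimately show ?thesis by auto
  qed
  have "inj_on f (cls R ` S - {cls R b})"
  proof (rule inj_onI)
    fix K L assume K: "K \<in> cls R ` S - {cls R b}" and L: "L \<in> cls R ` S - {cls R b}"
      and eq: "f K = f L"
    obtain x y where xy: "K = cls R x" "L = cls R y" using K L by auto
    have "reach (insert {a, b} R) x y" using eq by (simp add: xy f cls_eq_iff flip: e)
    moreover have "\<not> reach R x b" "\<not> reach R y b" using K L by (auto simp: xy cls_eq_iff)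
    ultimately have "reach R x y" using reach_insert_cases reach_sym by metis
    then show "K = L" by (simp add: xy cls_eq_iff)
  qed
  then have "card (cls R ` S - {cls R b}) \<le> card (cls (insert e R) ` S)"
    by (rule card_inj_on_le) (use f assms in auto)
  moreover have "card (cls R ` S) \<le> Suc (card (cls R ` S - {cls R b}))"
    using assms by (metis Suc_diff_le card_Diff_singleton_if card_gt_0_iff diff_Suc_1
      finite_imageI le_SucI order_refl Suc_pred empty_iff)
  ultimately show ?thesis by simp
qed

text \<open>Counting only the components that meet \<open>S\<close> makes the bound serve both for
  all of \<open>V\<close> and for a few terminals.\<close>

lemma rank_le:
  assumes "finite F" "finite S"
  shows "card (cls R ` S) \<le> card F + card (cls (R \<union> F) ` S)"
  using assms(1)
proof (induction F)
  case (insert e F)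
  have "card (cls (R \<union> F) ` S) \<le> Suc (card (cls (insert e (R \<union> F)) ` S))"
    by (rule card_cls_insert[OF assms(2)])
  then show ?case using insert by simp
qed simp

lemma card_cls_empty: "card (cls {} ` S) = card S"
proof -
  have "inj_on (cls {}) S" by (auto simp: inj_on_def cls_def reach_empty)
  then show ?thesis by (rule card_image)
qed

lemma card_cls_connected:
  assumes "\<And>x y. x \<in> S \<Longrightarrow> y \<in> S \<Longrightarrow> reach R x y"
  shows "card (cls R ` S) \<le> 1"
proof -
  have "cls R x = cls R y" if "x \<in> S" "y \<in> S" for x y
    using assms that by (simp add: cls_eq_iff)
  then have "\<exists>K. cls R ` S \<subseteq> {K}" by blast
  then obtain K where "cls R ` S \<subseteq> {K}" ..
  then have "card (cls R ` S) \<le> card {K}" by (intro card_mono) auto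
  then show ?thesis by simp
qed

lemma card_edges_ge:
  assumes "finite V" "finite F" "\<And>x y. x \<in> V \<Longrightarrow> y \<in> V \<Longrightarrow> reach F x y"
  shows "card V \<le> card F + 1"
  using rank_le[OF assms(2,1), of "{}"] card_cls_connected[of V F] assms(3)
  by (force simp: card_cls_empty)

text \<open>A tree is grown one vertex at a time along an edge leaving \<open>X\<close>. Acyclicity
  is recorded only through the number of edges, the form in which the counting arguments use
  it.\<close>

lemma spanning_tree:
  assumes "simple_graph V E" "connected_graph V E"
  obtains T where "T \<subseteq> E" "connected_graph V T" "card T + 1 = card V"
proof -
  have fin: "finite V" "finite E" using assms(1) by (auto dest: simple_graph_finite)
  have "\<exists>X T. X \<subseteq> V \<and> card X = Suc k \<and> T \<subseteq> E \<and> connected_graph X T \<and> card T = k"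
    if "Suc k \<le> card V" for k
    using that
  proof (induction k)
    case 0
    obtain v where "v \<in> V" using assms(2) by (auto simp: connected_graph_reach)
    then have "{v} \<subseteq> V \<and> card {v} = Suc 0 \<and> {} \<subseteq> E \<and> connected_graph {v} {} \<and>
      card ({}::'a set set) = 0"
      by (auto simp: connected_graph_reach)
    then show ?case by blast
  next
    case (Suc k)
    then obtain X T where XT: "X \<subseteq> V" "card X = Suc k" "T \<subseteq> E" "connected_graph X T" "card T = k"
      by auto
    have "X \<noteq> V" using XT Suc.prems by auto
    then obtain v where v: "v \<in> V" "v \<notin> X" using XT by auto
    obtain x where x: "x \<in> X" using XT by (auto simp: connected_graph_reach)
    have "reach E x v" using assms(2) v x XT by (auto simp: connected_graph_reach)
    then obtain a b where ab: "{a, b} \<in> E" "a \<in> X" "b \<notin> X"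
      using reach_cross[of E x v X] x v by blast
    have finT: "finite T" "finite X" using XT fin finite_subset by metis+
    have bV: "b \<in> V" using ab simple_graph_edge[OF assms(1)] by blast
    have X: "reach T u w" if "u \<in> X" "w \<in> X" for u w
      using XT(4) that by (auto simp: connected_graph_reach)
    define T' where "T' = (if {a, b} \<in> T then insert {b} T else insert {a, b} T)"
    show ?case
    proof (cases "{a, b} \<in> T")
      \<comment> \<open>\<open>connected_graph X T\<close> does not confine the edges of
        \<open>T\<close> to \<open>X\<close>, so the new edge may already be there; but then
        \<open>k\<close> edges would connect \<open>k + 2\<close> vertices.\<close>
      case True
      have "card (insert b X) \<le> card T + 1"
      proof (rule card_edges_ge)
        have r: "reach T a b" using True by (rule reach_edge)
        fix u w assume "u \<in> insert b X" "w \<in> insert b X"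
        then show "reach T u w"
          using X ab r by (metis insert_iff reach_sym reach_trans reach_refl)
      qed (use finT in auto)
      then show ?thesis using XT finT ab by simp
    next
      case False
      have r: "reach (insert {a, b} T) a b" by (rule reach_edge) simp
      have X': "reach (insert {a, b} T) u w" if "u \<in> X" "w \<in> X" for u w
        using X[OF that] by (rule reach_mono) auto
      have "connected_graph (insert b X) (insert {a, b} T)"
        unfolding connected_graph_reach
        using X' ab r by (metis empty_not_insert insert_iff reach_sym reach_trans reach_refl)
      moreover have "card (insert {a, b} T) = Suc k" "card (insert b X) = Suc (Suc k)"
        using finT False ab XT by auto
      ultimately show ?thesis using XT ab bV
        by (intro exI[of _ "insert b X"] exI[of _ "insert {a, b} T"]) auto
    qed
  qed
  moreover have pos: "card V > 0"
    using assms(2) fin by (simp add: connected_graph_reach card_gt_0_iff)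
  ultimately obtain X T where
    XT: "X \<subseteq> V" "card X = card V" "T \<subseteq> E" "connected_graph X T" "card T = card V - 1"
    by (metis Suc_pred' order_refl)
  have "X = V" using XT fin card_subset_eq by metis
  with pos show ?thesis using that[of T] XT by auto
qed

lemma nonbridge_exists:
  assumes "simple_graph V E" "connected_graph V E" "card V \<le> card E"
  obtains u v where "{u, v} \<in> E" "reach (E - {{u, v}}) u v"
proof -
  obtain T where T: "T \<subseteq> E" "connected_graph V T" "card T + 1 = card V"
    using spanning_tree[OF assms(1,2)] by blast
  then have "T \<noteq> E" using assms by auto
  then obtain e where e: "e \<in> E" "e \<notin> T" using T by auto
  obtain u v where uv: "e = {u, v}" "u \<in> V" "v \<in> V" using simple_graph_edgeE[OF assms(1) e(1)] .
  have "reach T u v" using T uv by (auto simp: connected_graph_reach)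
  then have "reach (E - {{u, v}}) u v" by (rule reach_mono) (use T e uv in auto)
  then show ?thesis using that e uv by blast
qed

lemma nonbridge_card:
  assumes "simple_graph V E" "connected_graph V E" "{u, v} \<in> E" "reach (E - {{u, v}}) u v"
  shows "card V \<le> card E"
proof -
  have fin: "finite V" "finite E" using assms(1) by (auto dest: simple_graph_finite)
  have "card V \<le> card (E - {{u, v}}) + 1"
    by (rule card_edges_ge) (use fin assms(2,4) in \<open>auto simp: connected_graph_reach intro:
      reach_Diff_edge\<close>)
  moreover have "card E > 0" using assms(3) fin card_gt_0_iff by blast
  ultimately show ?thesis using assms(3) fin by simp
qed

text \<open>A triangle minor covering \<open>V\<close>. Deleting a non-bridge \<open>{u, v}\<close>
  leaves a connected graph, which is split between \<open>u\<close> and \<open>v\<close>; a second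
  edge \<open>{s, t}\<close> joins the two sides. It differs from \<open>{u, v}\<close> at one end
  at least, and the side of that end is split once more so that the two edges reach different
  halves.\<close>

lemma triangle_split:
  assumes "simple_graph V E" "connected_graph V E" "card V \<le> card E"
  obtains P Q R where "P \<union> Q \<union> R = V" "P \<inter> Q = {}" "P \<inter> R = {}" "Q \<inter> R = {}"
    "conn_set E P" "conn_set E Q" "conn_set E R" "joined E P Q" "joined E P R" "joined E Q R"
proof -
  obtain u v where uv: "{u, v} \<in> E" "reach (E - {{u, v}}) u v"
    using nonbridge_exists[OF assms] .
  let ?E = "E - {{u, v}}"
  have uvV: "u \<in> V" "v \<in> V" "u \<noteq> v" using simple_graph_edge[OF assms(1) uv(1)] by auto
  have sg: "simple_graph V ?E" using assms(1) by (rule simple_graph_subset) auto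
  have "connected_graph V ?E"
    using assms(2) uv(2) by (auto simp: connected_graph_reach intro: reach_Diff_edge)
  then have c: "conn_set ?E V" using sg conn_set_whole by auto
  obtain P Q where PQ: "P \<union> Q = V" "P \<inter> Q = {}" "u \<in> P" "v \<in> Q" "conn_set ?E P" "conn_set ?E Q"
    "joined ?E P Q"
    using conn_set_split_points[OF c uvV] .
  obtain s t where st: "s \<in> P" "t \<in> Q" "{s, t} \<in> ?E" using PQ by (auto simp: joined_def)
  have c': "conn_set E P" "conn_set E Q" using PQ conn_set_mono by blast+
  show ?thesis
  proof (cases "s = u")
    case False
    then obtain P1 P2 where P: "P1 \<union> P2 = P" "P1 \<inter> P2 = {}" "s \<in> P1" "u \<in> P2" "conn_set E P1"
      "conn_set E P2" "joined E P1 P2"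
      using conn_set_split_points[OF c'(1) st(1) PQ(3)] by metis
    have "joined E P1 Q" "joined E P2 Q"
      using joinedI[of s t E P1 Q] joinedI[of u v E P2 Q] P(3,4) PQ(4) st uv(1) by simp_all
    moreover have "P1 \<union> P2 \<union> Q = V" "P1 \<inter> Q = {}" "P2 \<inter> Q = {}" using P PQ by auto
    ultimately show ?thesis using P(2,5-7) c'(2) by (rule_tac that[of P1 P2 Q])
  next
    case True
    then have "t \<noteq> v" using st by auto
    then obtain P1 P2 where P: "P1 \<union> P2 = Q" "P1 \<inter> P2 = {}" "t \<in> P1" "v \<in> P2" "conn_set E P1"
      "conn_set E P2" "joined E P1 P2"
      using conn_set_split_points[OF c'(2) st(2) PQ(4)] by metis
    have "joined E P P1" "joined E P P2"
      using joinedI[of s t E P P1] joinedI[of u v E P P2] P(3,4) PQ(3) st uv(1) by simp_all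
    moreover have "P \<union> P1 \<union> P2 = V" "P \<inter> P1 = {}" "P \<inter> P2 = {}" using P PQ by auto
    ultimately show ?thesis using P(2,5-7) c'(1) by (rule_tac that[of P P1 P2])
  qed
qed

subsection \<open>Paths, cycles and trees\<close>

lemma path_edges_simps [simp]:
  "path_edges [] = {}" "path_edges [x] = {}"
  "path_edges (x # y # xs) = insert {x, y} (path_edges (y # xs))"
proof -
  show "path_edges (x # y # xs) = insert {x, y} (path_edges (y # xs))"
  proof (intro equalityI subsetI)
    fix e assume "e \<in> path_edges (x # y # xs)"
    then obtain i where i: "e = {(x # y # xs) ! i, (x # y # xs) ! Suc i}"
      "Suc i < length (x # y # xs)"
      by (auto simp: path_edges_def)
    show "e \<in> insert {x, y} (path_edges (y # xs))"
    proof (cases i)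
      case (Suc j)
      then have "e = {(y # xs) ! j, (y # xs) ! Suc j}" "Suc j < length (y # xs)" using i by auto
      then show ?thesis unfolding path_edges_def by blast
    qed (use i in auto)
  next
    fix e assume "e \<in> insert {x, y} (path_edges (y # xs))"
    then show "e \<in> path_edges (x # y # xs)"
    proof
      assume "e = {x, y}"
      then show ?thesis by (auto simp: path_edges_def intro!: exI[of _ 0])
    next
      assume "e \<in> path_edges (y # xs)"
      then obtain i where "e = {(y # xs) ! i, (y # xs) ! Suc i}" "Suc i < length (y # xs)"
        by (auto simp: path_edges_def)
      then have "e = {(x # y # xs) ! Suc i, (x # y # xs) ! Suc (Suc i)}"
        "Suc (Suc i) < length (x # y # xs)" by auto
      then show ?thesis unfolding path_edges_def by blast
    qed
  qed
qed (auto simp: path_edges_def)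

lemma path_edges_append:
  "xs \<noteq> [] \<Longrightarrow> ys \<noteq> [] \<Longrightarrow>
    path_edges (xs @ ys) = insert {last xs, hd ys} (path_edges xs \<union> path_edges ys)"
proof (induction xs rule: induct_list012)
  case (2 x)
  then show ?case by (cases ys) auto
qed auto

lemma path_edges_sub: "e \<in> path_edges xs \<Longrightarrow> e \<subseteq> set xs"
  by (induction xs rule: induct_list012) auto

lemma path_edges_reach: "x \<in> set xs \<Longrightarrow> reach (path_edges xs) (hd xs) x"
proof (induction xs rule: induct_list012)
  case (3 y z xs)
  have "reach (path_edges (y # z # xs)) y z" by (rule reach_edge) simp
  moreover have "reach (path_edges (y # z # xs)) z x" if "x \<in> set (z # xs)"
    using "3.IH"(2)[OF that] by (auto elim: reach_mono)
  ultimately show ?case using "3.prems" by (auto intro: reach_trans)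
qed auto

lemma path_edges_split:
  assumes "e \<in> path_edges xs"
  obtains as bs where "xs = as @ bs" "as \<noteq> []" "bs \<noteq> []" "e = {last as, hd bs}"
proof -
  obtain i where i: "e = {xs ! i, xs ! Suc i}" "Suc i < length xs"
    using assms by (auto simp: path_edges_def)
  have "last (take (Suc i) xs) = xs ! i" using i by (simp add: take_Suc_conv_app_nth)
  moreover have "hd (drop (Suc i) xs) = xs ! Suc i" using i by (simp add: hd_drop_conv_nth)
  moreover have "take (Suc i) xs \<noteq> []" "drop (Suc i) xs \<noteq> []" using i by auto
  ultimately show ?thesis using that[of "take (Suc i) xs" "drop (Suc i) xs"] i by simp
qed

text \<open>If \<open>e\<close> joins the last vertex of \<open>as\<close> to the first of
  \<open>bs\<close>, the rotated list \<open>bs @ as\<close> closes up with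
  \<open>e\<close>.\<close>

lemma cycle_rotate:
  assumes "cycle_in E C" "e \<in> C"
  obtains ys where "3 \<le> length ys" "distinct ys" "e = {last ys, hd ys}" "C - {e} = path_edges ys"
proof -
  \<comment> \<open>\<open>C\<close> is a set, so removing the closing edge leaves all the path
    edges only if it is not one of them; this takes three vertices.\<close>
  have notin: "{last ys, hd ys} \<notin> path_edges ys" if "3 \<le> length ys" "distinct ys" for ys ::
    "'a list"
  proof
    assume "{last ys, hd ys} \<in> path_edges ys"
    then obtain i where i: "{last ys, hd ys} = {ys ! i, ys ! Suc i}" "Suc i < length ys"
      by (auto simp: path_edges_def)
    have "ys \<noteq> []" using that by auto
    then have "last ys = ys ! (length ys - 1)" "hd ys = ys ! 0"
      by (simp_all add: last_conv_nth hd_conv_nth)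
    then have "{ys ! (length ys - 1), ys ! 0} = {ys ! i, ys ! Suc i}" using i by simp
    moreover have "length ys - 1 < length ys" "0 < length ys" "i < length ys" using i by auto
    ultimately show False
      using that i by (auto simp: doubleton_eq_iff nth_eq_iff_index_eq)
  qed
  obtain xs where xs: "3 \<le> length xs" "distinct xs" "C = insert {last xs, hd xs} (path_edges xs)"
    using assms(1) by (auto simp: cycle_in_def)
  show ?thesis
  proof (cases "e = {last xs, hd xs}")
    case True
    have "C - {e} = path_edges xs" using notin[OF xs(1,2)] xs(3) True by auto
    then show ?thesis using that[of xs] xs True by blast
  next
    case False
    then have "e \<in> path_edges xs" using assms(2) xs by auto
    then obtain as bs where ab: "xs = as @ bs" "as \<noteq> []" "bs \<noteq> []" "e = {last as, hd bs}"
      by (rule path_edges_split)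
    have d: "3 \<le> length (bs @ as)" "distinct (bs @ as)" using xs ab by auto
    have e: "e = {last (bs @ as), hd (bs @ as)}" using ab by simp
    have "C = insert e (path_edges (bs @ as))"
      using ab xs(3) by (auto simp: path_edges_append)
    then have "C - {e} = path_edges (bs @ as)" using notin[OF d] e by auto
    then show ?thesis using that[of "bs @ as"] d e by blast
  qed
qed

lemma cycle_edge_reach:
  assumes "cycle_in E C" "{u, v} \<in> C"
  shows "reach (C - {{u, v}}) u v"
proof -
  obtain ys where ys: "3 \<le> length ys" "{u, v} = {last ys, hd ys}" "C - {{u, v}} = path_edges ys"
    using cycle_rotate[OF assms] by metis
  have "ys \<noteq> []" using ys by auto
  then have "reach (path_edges ys) (hd ys) (last ys)" by (intro path_edges_reach) simp
  then show ?thesis using ys(2,3) reach_sym by (metis doubleton_eq_iff)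
qed

text \<open>Without \<open>{u, v}\<close> the cycle is a path from one of these vertices to the
  other, and \<open>f\<close> cuts it in two: no remaining edge leaves the vertex set of the first
  piece.\<close>

lemma cycle_two_edges_separate:
  assumes "cycle_in E C" "{u, v} \<in> C" "f \<in> C" "f \<noteq> {u, v}"
  shows "\<not> reach (C - {{u, v}, f}) u v"
proof -
  obtain ys where ys: "distinct ys" "{u, v} = {last ys, hd ys}" "C - {{u, v}} = path_edges ys"
    using cycle_rotate[OF assms(1,2)] by metis
  have "f \<in> path_edges ys" using assms ys by blast
  then obtain as bs where ab: "ys = as @ bs" "as \<noteq> []" "bs \<noteq> []" "f = {last as, hd bs}"
    by (rule path_edges_split)
  have "C - {{u, v}, f} = path_edges ys - {f}" using ys by blast
  then have sub: "C - {{u, v}, f} \<subseteq> path_edges as \<union> path_edges bs"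
    using ab by (auto simp: path_edges_append)
  have closed: "y \<in> set as" if "x \<in> set as" "reach (C - {{u, v}, f}) x y" for x y
    using that(2,1)
  proof (rule reach_closed)
    fix a b assume "{a, b} \<in> C - {{u, v}, f}" "a \<in> set as"
    then have "{a, b} \<in> path_edges as \<or> {a, b} \<in> path_edges bs" "a \<notin> set bs"
      using sub ab(1) ys(1) by auto
    then show "b \<in> set as" using path_edges_sub[of "{a, b}"] by blast
  qed
  have "hd ys \<in> set as" "last ys \<notin> set as" using ab ys(1) by auto
  then have "\<not> reach (C - {{u, v}, f}) (hd ys) (last ys)" using closed by blast
  then show ?thesis using ys(2) reach_sym by (metis doubleton_eq_iff)
qed

lemma reach_path:
  assumes "reach E u v"
  obtains xs where "xs \<noteq> []" "distinct xs" "hd xs = u" "last xs = v" "path_edges xs \<subseteq> E"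
proof -
  have "\<exists>xs. xs \<noteq> [] \<and> distinct xs \<and> hd xs = u \<and> last xs = v \<and> path_edges xs \<subseteq> E"
    using assms
  proof (induction rule: reach_induct)
    case refl
    show ?case by (intro exI[of _ "[u]"]) simp
  next
    case (step y z)
    then obtain xs where xs: "xs \<noteq> []" "distinct xs" "hd xs = u" "last xs = y" "path_edges xs \<subseteq> E"
      by auto
    show ?case
    proof (cases "z \<in> set xs")
      \<comment> \<open>A vertex met before cuts the path back to its earlier occurrence.\<close>
      case True
      then obtain as bs where "xs = as @ z # bs" by (meson split_list)
      then have ab: "xs = (as @ [z]) @ bs" by simp
      have "path_edges (as @ [z]) \<subseteq> path_edges xs"
        using ab path_edges_append[of "as @ [z]" bs] by (cases "bs = []") auto
      moreover have "hd (as @ [z]) = u" using ab xs by (metis hd_append2 snoc_eq_iff_butlast)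
      ultimately show ?thesis using xs ab by (intro exI[of _ "as @ [z]"]) auto
    next
      case False
      then show ?thesis using xs step.hyps
        by (intro exI[of _ "xs @ [z]"]) (auto simp: path_edges_append)
    qed
  qed
  then show ?thesis using that by blast
qed

lemma nonbridge_cycle:
  assumes "{u, v} \<in> E" "u \<noteq> v" "reach (E - {{u, v}}) u v"
  obtains C where "cycle_in E C" "{u, v} \<in> C"
proof -
  obtain xs where xs: "xs \<noteq> []" "distinct xs" "hd xs = u" "last xs = v"
    "path_edges xs \<subseteq> E - {{u, v}}"
    using reach_path[OF assms(3)] .
  have "3 \<le> length xs"
  proof (rule ccontr)
    assume "\<not> 3 \<le> length xs"
    then consider a where "xs = [a]" | a b where "xs = [a, b]"
      using xs(1) by (cases xs; cases "tl xs") (auto simp: not_le)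
    then show False by cases (use xs assms in auto)
  qed
  moreover have "insert {v, u} (path_edges xs) \<subseteq> E" using xs assms by (auto simp: insert_commute)
  ultimately have "cycle_in E (insert {v, u} (path_edges xs))" using xs
    by (auto simp: cycle_in_def)
  then show ?thesis using that by (metis insertI1 insert_commute)
qed

lemma cycle_subset: "cycle_in E C \<Longrightarrow> C \<subseteq> E"
  by (simp add: cycle_in_def)

lemma cycle_nonbridge: "cycle_in E C \<Longrightarrow> {u, v} \<in> C \<Longrightarrow> reach (E - {{u, v}}) u v"
  by (rule reach_mono[OF cycle_edge_reach]) (auto dest: cycle_subset)

text \<open>Both a cycle and the inequality \<open>card V \<le> card E\<close> amount to the
  existence of an edge that is not a bridge. Acyclicity can thus be traded for an edge
  count.\<close>

lemma tree_graph_iff_card: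
  assumes "simple_graph V E" "connected_graph V E"
  shows "tree_graph V E \<longleftrightarrow> card E + 1 = card V"
proof -
  have "card V \<le> card E + 1"
    by (rule card_edges_ge) (use assms simple_graph_finite in \<open>auto simp: connected_graph_reach\<close>)
  moreover have "(\<exists>C. cycle_in E C) \<longleftrightarrow> card V \<le> card E"
  proof
    assume "\<exists>C. cycle_in E C"
    then obtain C where C: "cycle_in E C" ..
    then have "C \<noteq> {}" by (auto simp: cycle_in_def)
    then obtain e where e: "e \<in> C" by auto
    then obtain u v where uv: "e = {u, v}"
      using simple_graph_edgeE[OF assms(1)] cycle_subset[OF C] by blast
    show "card V \<le> card E"
      using nonbridge_card[OF assms] cycle_nonbridge[OF C] cycle_subset[OF C] e uv by blast
  next
    assume "card V \<le> card E"
    then obtain u v where "{u, v} \<in> E" "reach (E - {{u, v}}) u v"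
      using nonbridge_exists[OF assms] by metis
    then show "\<exists>C. cycle_in E C"
      using nonbridge_cycle simple_graph_edge(3)[OF assms(1)] by metis
  qed
  ultimately show ?thesis using assms by (auto simp: tree_graph_def)
qed

subsection \<open>Rainbow colourings\<close>

text \<open>It suffices to connect \<open>S\<close> by a rainbow set of edges: a spanning tree of
  the component of \<open>S\<close> in that set is the tree asked for.\<close>

lemma rainbow_coloringI:
  assumes "simple_graph V E" "c ` E \<subseteq> {1..q}" "k > 0"
    and "\<And>S. S \<subseteq> V \<Longrightarrow> card S = k \<Longrightarrow> \<exists>F\<subseteq>E. inj_on c F \<and> (\<forall>x\<in>S. \<forall>y\<in>S. reach F x y)"
  shows "rainbow_coloring k V E q c"
  unfolding rainbow_coloring_def
proof (intro conjI allI impI)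
  fix S assume S: "S \<subseteq> V \<and> card S = k"
  then obtain F where F: "F \<subseteq> E" "inj_on c F" "\<forall>x\<in>S. \<forall>y\<in>S. reach F x y" using assms(4) by metis
  obtain s where s: "s \<in> S" using S assms(3) by (metis card.empty ex_in_conv less_irrefl)
  have sF: "simple_graph V F" using assms(1) F(1) by (rule simple_graph_subset)
  define X where "X = {z. reach (induced F V) s z}"
  have X: "conn_set F X" "X \<subseteq> V" using conn_set_cls_induced[of s V F] s S by (auto simp: X_def)
  have SX: "S \<subseteq> X" using F s by (auto simp: X_def induced_UNIV[OF sF])
  have sX: "simple_graph X (induced F X)" using sF X(2) by (rule simple_graph_induced)
  obtain T where T: "T \<subseteq> induced F X" "connected_graph X T" "card T + 1 = card X"
    using spanning_tree[OF sX] X by (auto simp: conn_set_connected_graph)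
  have sT: "simple_graph X T" using sX T(1) by (rule simple_graph_subset)
  have "T \<subseteq> F" using T(1) induced_subset by blast
  moreover have "tree_graph X T" using T sT by (simp add: tree_graph_iff_card)
  ultimately show "\<exists>VT ET. VT \<subseteq> V \<and> ET \<subseteq> E \<and> tree_graph VT ET \<and> S \<subseteq> VT \<and> inj_on c ET"
    using X SX F by (intro exI[of _ X] exI[of _ T]) (auto intro: inj_on_subset)
qed (use assms in auto)

lemma rainbow_coloringD:
  assumes "rainbow_coloring k V E q c" "S \<subseteq> V" "card S = k"
  obtains F where "F \<subseteq> E" "inj_on c F" "\<And>x y. x \<in> S \<Longrightarrow> y \<in> S \<Longrightarrow> reach F x y"
proof -
  obtain VT ET where "ET \<subseteq> E" "tree_graph VT ET" "S \<subseteq> VT" "inj_on c ET"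
    using assms unfolding rainbow_coloring_def by metis
  moreover have "reach ET x y" if "x \<in> S" "y \<in> S" for x y
    using calculation that unfolding tree_graph_def connected_graph_reach by blast
  ultimately show ?thesis using that by blast
qed

text \<open>The edges of \<open>R\<close> get different colours above \<open>q\<close>, so all of
  \<open>R\<close> can be added to any rainbow \<open>F\<close> taken from \<open>M\<close>. This
  lifts a colouring with \<open>q\<close> colours from the graph in which \<open>R\<close> is
  contracted.\<close>

lemma rainbow_from_forest:
  assumes sg: "simple_graph V E" and RE: "R \<subseteq> E" and ME: "M \<subseteq> E" and RM: "R \<inter> M = {}"
    and k: "k ` M \<subseteq> {1..q}" and q: "0 < q" and p: "p > 0"
    and S: "\<And>S. S \<subseteq> V \<Longrightarrow> card S = p \<Longrightarrow>
      \<exists>F\<subseteq>M. inj_on k F \<and> (\<forall>x\<in>S. \<forall>y\<in>S. reach (R \<union> F) x y)"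
  shows "\<exists>c. rainbow_coloring p V E (q + card R) c"
proof -
  have "finite R" using sg RE simple_graph_finite finite_subset by metis
  then obtain h where h: "bij_betw h R {0..<card R}" using ex_bij_betw_finite_nat by blast
  \<comment> \<open>Edges outside \<open>R\<close> and \<open>M\<close> belong to no chosen tree;
    colour 1 is allowed because \<open>q > 0\<close>. The values of \<open>h\<close> start at 0,
    hence the \<open>Suc\<close>.\<close>
  define c where "c e = (if e \<in> M then k e else if e \<in> R then q + Suc (h e) else 1)" for e
  have hR: "h e < card R" if "e \<in> R" for e using h that by (auto dest: bij_betw_apply)
  have cR: "c e = q + Suc (h e)" if "e \<in> R" for e using that RM by (auto simp: c_def)
  have cM: "c e = k e" if "e \<in> M" for e using that by (auto simp: c_def)
  have "rainbow_coloring p V E (q + card R) c"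
  proof (rule rainbow_coloringI[OF sg _ p])
    show "c ` E \<subseteq> {1..q + card R}"
      using hR k q by (force simp: c_def)
    fix S assume "S \<subseteq> V" "card S = p"
    then obtain F where F: "F \<subseteq> M" "inj_on k F" "\<forall>x\<in>S. \<forall>y\<in>S. reach (R \<union> F) x y"
      using assms(8) by metis
    have "inj_on c (R \<union> F)"
    proof (rule inj_onI)
      fix e f assume ef: "e \<in> R \<union> F" "f \<in> R \<union> F" "c e = c f"
      have kq: "k e \<le> q" if "e \<in> F" for e
      proof -
        have "k e \<in> {1..q}" using that F(1) k by blast
        then show ?thesis by simp
      qed
      have cF: "c e = k e" if "e \<in> F" for e using that F cM by auto
      have hh: "h e = h f \<Longrightarrow> e \<in> R \<Longrightarrow> f \<in> R \<Longrightarrow> e = f" using h by (auto simp: bij_betw_def inj_on_def)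
      have kk: "k e = k f \<Longrightarrow> e \<in> F \<Longrightarrow> f \<in> F \<Longrightarrow> e = f" using F(2) by (auto simp: inj_on_def)
      consider "e \<in> R" "f \<in> R" | "e \<in> R" "f \<in> F" | "e \<in> F" "f \<in> R" | "e \<in> F" "f \<in> F"
        using ef by blast
      then show "e = f"
      proof cases
        case 1
        then show ?thesis using ef(3) cR hh by simp
      next
        case 2
        then show ?thesis using ef(3) cR[of e] cF[of f] kq[of f] by simp
      next
        case 3
        then show ?thesis using ef(3) cR[of f] cF[of e] kq[of e] by simp
      next
        case 4
        then show ?thesis using ef(3) cF kk by simp
      qed
    qed
    then show "\<exists>F\<subseteq>E. inj_on c F \<and> (\<forall>x\<in>S. \<forall>y\<in>S. reach F x y)"
      using F RE ME by (intro exI[of _ "R \<union> F"]) auto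
  qed
  then show ?thesis by (rule exI[of _ c])
qed

text \<open>One edge of a spanning tree plays the role of \<open>M\<close> with a single colour,
  since \<open>rainbow_from_forest\<close> asks for a positive \<open>q\<close>; the remaining n - 2
  edges get fresh colours.\<close>

lemma rainbow_coloring_trivial:
  assumes "simple_graph V E" "connected_graph V E" "card V \<ge> 2" "p > 0"
  shows "\<exists>c. rainbow_coloring p V E (card V - 1) c"
proof -
  obtain T where T: "T \<subseteq> E" "connected_graph V T" "card T + 1 = card V"
    using spanning_tree[OF assms(1,2)] .
  then have "T \<noteq> {}" using assms by auto
  then obtain e where e: "e \<in> T" by auto
  have "\<exists>c. rainbow_coloring p V E (1 + card (T - {e})) c"
  proof (rule rainbow_from_forest[OF assms(1), where M = "{e}" and k = "\<lambda>_. 1"])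
    fix S assume "S \<subseteq> V" "card S = p"
    moreover have "T - {e} \<union> {e} = T" using e by auto
    ultimately have "\<forall>x\<in>S. \<forall>y\<in>S. reach (T - {e} \<union> {e}) x y"
      using T(2) unfolding connected_graph_reach by (metis subsetD)
    then show "\<exists>F\<subseteq>{e}. inj_on (\<lambda>_. 1::nat) F \<and> (\<forall>x\<in>S. \<forall>y\<in>S. reach (T - {e} \<union> F) x y)"
      by (intro exI[of _ "{e}"]) simp
  qed (use T e assms in auto)
  moreover have "finite T" using T(1) assms(1) simple_graph_finite finite_subset by metis
  then have "1 + card (T - {e}) = card V - 1" using T(3) e card_gt_0_iff[of T] by auto
  ultimately show ?thesis by simp
qed

lemma rainbow_coloring_mono: "rainbow_coloring p V E q c \<Longrightarrow> q \<le> q' \<Longrightarrow> rainbow_coloring p V E q' c"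
  using atLeastatMost_subset_iff[of 1 q 1 q'] unfolding rainbow_coloring_def by blast

lemma rainbow_index_eq_iff:
  assumes "simple_graph V E" "connected_graph V E" "card V \<ge> 2" "p > 0"
  shows "rainbow_index p V E = card V - 1 \<longleftrightarrow> \<not> (\<exists>c. rainbow_coloring p V E (card V - 2) c)"
proof -
  let ?P = "\<lambda>q. \<exists>c. rainbow_coloring p V E q c"
  have triv: "?P (card V - 1)" using rainbow_coloring_trivial[OF assms] .
  then have le: "rainbow_index p V E \<le> card V - 1" and P: "?P (rainbow_index p V E)"
    unfolding rainbow_index_def by (rule Least_le, rule LeastI)
  have least: "rainbow_index p V E \<le> q" if "?P q" for q
    unfolding rainbow_index_def using that by (rule Least_le)
  show ?thesis
  proof
    assume eq: "rainbow_index p V E = card V - 1"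
    show "\<not> ?P (card V - 2)"
    proof
      assume "?P (card V - 2)"
      then have "rainbow_index p V E \<le> card V - 2" by (rule least)
      then show False using eq assms(3) by simp
    qed
  next
    assume no: "\<not> ?P (card V - 2)"
    have "\<not> rainbow_index p V E \<le> card V - 2"
      using P no rainbow_coloring_mono by blast
    then show "rainbow_index p V E = card V - 1" using le by simp
  qed
qed

subsection \<open>Colourings from partitions into connected parts\<close>

definition saves_color :: "'a set \<Rightarrow> 'a set set \<Rightarrow> bool" where
  "saves_color V E \<longleftrightarrow> (\<exists>c. rainbow_coloring 4 V E (card V - 2) c)"

text \<open>For an explicit list of parts this unfolds to finitely many disjointness statements, so
  parts can be permuted, merged and refined by simplification.\<close>

primrec disj_list :: "'a set list \<Rightarrow> bool" where
  "disj_list [] \<longleftrightarrow> True"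
| "disj_list (P # Ps) \<longleftrightarrow> (\<forall>Q\<in>set Ps. P \<inter> Q = {}) \<and> disj_list Ps"

text \<open>The branch sets of a minor that uses up all of \<open>V\<close>; adjacency of two branch
  sets is \<open>joined\<close>.\<close>

definition conn_parts :: "'a set set \<Rightarrow> 'a set \<Rightarrow> 'a set list \<Rightarrow> bool" where
  "conn_parts E V Ps \<longleftrightarrow> \<Union>(set Ps) = V \<and> disj_list Ps \<and> (\<forall>P\<in>set Ps. conn_set E P)"

text \<open>Quantifying over \<open>R\<close>, to be instantiated by spanning trees of the parts, keeps the check of a
  pattern independent of the choice of these trees.\<close>

definition linked :: "'a set list \<Rightarrow> 'a set set \<Rightarrow> 'a set \<Rightarrow> bool" where
  "linked Ps F X \<longleftrightarrow> (\<forall>R. (\<forall>P\<in>set Ps. \<forall>x\<in>P. \<forall>y\<in>P. reach R x y) \<longrightarrow>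
     (\<forall>x\<in>X. \<forall>y\<in>X. reach (R \<union> F) x y))"

text \<open>Where \<open>joined\<close> only asserts that an edge exists, this names it: colourings
  and bonds speak of particular edges.\<close>

definition crosses :: "'a set \<Rightarrow> 'a set \<Rightarrow> 'a set \<Rightarrow> bool" where
  "crosses A B e \<longleftrightarrow> (\<exists>x\<in>A. \<exists>y\<in>B. e = {x, y})"

lemma crosses_sym: "crosses A B e \<Longrightarrow> crosses B A e"
  by (auto simp: crosses_def insert_commute)

lemma joined_crosses: "joined E A B \<longleftrightarrow> (\<exists>e\<in>E. crosses A B e)"
  by (auto simp: joined_def crosses_def)

lemma disj_list_unique: "disj_list Ps \<Longrightarrow> A \<in> set Ps \<Longrightarrow> B \<in> set Ps \<Longrightarrow> x \<in> A \<Longrightarrow> x \<in> B \<Longrightarrow> A = B"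
  by (induction Ps) auto

text \<open>Under such a labelling an edge between parts \<open>i\<close> and \<open>j\<close> has
  the image \<open>{i, j}\<close>, so edges of a pattern are told apart by comparing
  numbers.\<close>

lemma disj_list_label: "disj_list Ps \<Longrightarrow> \<exists>f::'a \<Rightarrow> nat. \<forall>i<length Ps. \<forall>x\<in>Ps ! i. f x = i"
proof (induction Ps)
  case (Cons P Ps)
  then obtain f :: "'a \<Rightarrow> nat" where f: "\<forall>i<length Ps. \<forall>x\<in>Ps ! i. f x = i" by auto
  have "(if x \<in> P then 0 else Suc (f x)) = i" if "i < length (P # Ps)" "x \<in> (P # Ps) ! i" for i x
  proof (cases i)
    case (Suc j)
    then have "j < length Ps" "x \<in> Ps ! j" using that by auto
    then show ?thesis using f Suc Cons.prems by (metis IntI disj_list.simps(2) empty_iff nth_mem)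
  qed (use that in simp)
  then show ?case by (intro exI[of _ "\<lambda>x. if x \<in> P then 0 else Suc (f x)"]) blast
qed simp

text \<open>One spanning tree for each part; as its edges lie inside the parts, the forest is
  disjoint from every set of edges between parts.\<close>

lemma spanning_forest:
  assumes sg: "simple_graph V E"
  shows "disj_list Ps \<Longrightarrow> \<forall>P\<in>set Ps. conn_set E P \<and> P \<subseteq> V \<Longrightarrow>
    \<exists>R\<subseteq>E. card R + length Ps = card (\<Union>(set Ps)) \<and>
      (\<forall>P\<in>set Ps. \<forall>x\<in>P. \<forall>y\<in>P. reach R x y) \<and> (\<forall>e\<in>R. \<exists>P\<in>set Ps. e \<subseteq> P)"
proof (induction Ps)
  case Nil
  show ?case by (intro exI[of _ "{}"]) simp
next
  case (Cons P Ps)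
  then obtain R where R: "R \<subseteq> E" "card R + length Ps = card (\<Union>(set Ps))"
    "\<forall>P\<in>set Ps. \<forall>x\<in>P. \<forall>y\<in>P. reach R x y" "\<forall>e\<in>R. \<exists>P\<in>set Ps. e \<subseteq> P" by auto
  have "P \<subseteq> V" "conn_set E P" using Cons.prems by auto
  then obtain T where T: "T \<subseteq> induced E P" "connected_graph P T" "card T + 1 = card P"
    using spanning_tree[OF simple_graph_induced[OF sg]] by (metis conn_set_connected_graph)
  have TE: "T \<subseteq> E" using T(1) induced_subset by blast
  have fin: "finite T" "finite R" "finite V"
    using TE R(1) sg simple_graph_finite finite_subset by metis+
  have "T \<inter> R = {}"
  proof -
    have False if e: "e \<in> T" "e \<in> R" for e
    proof -
      obtain x y where "e = {x, y}" using simple_graph_edgeE[OF sg] e TE by blast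
      then show False using e T(1) R(4) Cons.prems(1) by (fastforce simp: induced_def)
    qed
    then show ?thesis by blast
  qed
  then have cTR: "card (T \<union> R) = card T + card R" using fin by (intro card_Un_disjoint)
  have "P \<subseteq> V" "\<Union>(set Ps) \<subseteq> V" using Cons.prems by auto
  then have "finite P" "finite (\<Union>(set Ps))" using fin(3) finite_subset by metis+
  then have "card (P \<union> \<Union>(set Ps)) = card P + card (\<Union>(set Ps))"
    using Cons.prems(1) by (intro card_Un_disjoint) auto
  then have card: "card (T \<union> R) + length (P # Ps) = card (\<Union>(set (P # Ps)))"
    using cTR T(3) R(2) by simp
  have "\<forall>Q\<in>set (P # Ps). \<forall>x\<in>Q. \<forall>y\<in>Q. reach (T \<union> R) x y"
    using T(2) R(3) reach_mono[of T _ _ "T \<union> R"] reach_mono[of R _ _ "T \<union> R"]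
    unfolding connected_graph_reach by (metis set_ConsD sup_ge1 sup_ge2)
  moreover have "\<forall>e\<in>T \<union> R. \<exists>Q\<in>set (P # Ps). e \<subseteq> Q"
    using T(1) R(4) by (force simp: induced_def)
  ultimately show ?case using card TE R(1) by (intro exI[of _ "T \<union> R"]) simp
qed

text \<open>Spanning trees of the parts use up \<open>card V - (q + 2)\<close> colours, which leaves \<open>q\<close> colours for the
  edges between parts. Four vertices always miss one of the five sets \<open>Qs\<close>.\<close>

lemma saves_color_from_parts:
  assumes sg: "simple_graph V E" and Ps: "conn_parts E V Ps" "length Ps = q + 2" and q: "q > 0"
    and ME: "M \<subseteq> E" and MP: "\<And>e P. e \<in> M \<Longrightarrow> P \<in> set Ps \<Longrightarrow> \<not> e \<subseteq> P"
    and k: "k ` M \<subseteq> {1..q}"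
    and Qs: "disj_list Qs" "length Qs = 5" "set Qs \<subseteq> Pow V"
    and F: "\<And>Q. Q \<in> set Qs \<Longrightarrow> \<exists>F\<subseteq>M. inj_on k F \<and> linked Ps F (V - Q)"
  shows "saves_color V E"
proof -
  obtain R where R: "R \<subseteq> E" "card R + length Ps = card (\<Union>(set Ps))"
    "\<forall>P\<in>set Ps. \<forall>x\<in>P. \<forall>y\<in>P. reach R x y" "\<forall>e\<in>R. \<exists>P\<in>set Ps. e \<subseteq> P"
    using spanning_forest[OF sg, of Ps] Ps(1) unfolding conn_parts_def by blast
  have "\<exists>c. rainbow_coloring 4 V E (q + card R) c"
  proof (rule rainbow_from_forest[OF sg R(1) ME _ k q])
    show "R \<inter> M = {}" using R(4) MP by blast
    fix S assume S: "S \<subseteq> V" "card S = 4"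
    have finS: "finite S" using S(2) card.infinite by fastforce
    obtain A B C D G where Q5: "Qs = [A, B, C, D, G]"
      using Qs(2) by (auto simp: numeral_eq_Suc length_Suc_conv)
    have "\<exists>Q\<in>set Qs. S \<inter> Q = {}"
    proof (rule ccontr)
      assume "\<not> ?thesis"
      then obtain a b c d g where abc: "a \<in> S \<inter> A" "b \<in> S \<inter> B" "c \<in> S \<inter> C" "d \<in> S \<inter> D" "g \<in> S \<inter> G"
        unfolding Q5 by (auto simp: ex_in_conv[symmetric])
      then have "distinct [a, b, c, d, g]" using Qs(1) unfolding Q5 by auto
      then have "card {a, b, c, d, g} = 5" by simp
      moreover have "card {a, b, c, d, g} \<le> card S" using abc finS by (intro card_mono) auto
      ultimately show False using S by simp
    qed
    then obtain Q where Q: "Q \<in> set Qs" "S \<inter> Q = {}" by auto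
    then obtain F' where F': "F' \<subseteq> M" "inj_on k F'" "linked Ps F' (V - Q)" using F by metis
    have "\<forall>x\<in>V - Q. \<forall>y\<in>V - Q. reach (R \<union> F') x y" using F'(3) R(3) unfolding linked_def by metis
    moreover have "S \<subseteq> V - Q" using S Q by auto
    ultimately show "\<exists>F\<subseteq>M. inj_on k F \<and> (\<forall>x\<in>S. \<forall>y\<in>S. reach (R \<union> F) x y)"
      using F' by blast
  qed simp
  moreover have "q + card R = card V - 2" using R(2) Ps by (simp add: conn_parts_def)
  ultimately show ?thesis by (simp add: saves_color_def)
qed

lemma linked_part: "P \<in> set Ps \<Longrightarrow> linked Ps F P"
  unfolding linked_def by (meson reach_mono sup_ge1)

lemma linked_step:
  assumes "linked Ps F X" "crosses A P e" "e \<in> F" "A \<subseteq> X" "P \<in> set Ps"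
  shows "linked Ps F (X \<union> P)"
  unfolding linked_def
proof (intro allI impI)
  fix R assume R: "\<forall>P\<in>set Ps. \<forall>x\<in>P. \<forall>y\<in>P. reach R x y"
  have X: "reach (R \<union> F) x y" if "x \<in> X" "y \<in> X" for x y
    using assms(1) R that unfolding linked_def by blast
  have P: "reach (R \<union> F) x y" if "x \<in> P" "y \<in> P" for x y
    using linked_part[OF assms(5)] R that unfolding linked_def by blast
  obtain a b where ab: "a \<in> A" "b \<in> P" "e = {a, b}" using assms(2) by (auto simp: crosses_def)
  have e: "reach (R \<union> F) a b" using ab assms(3) by (intro reach_edge) auto
  have a: "reach (R \<union> F) a x" if "x \<in> X \<union> P" for x
  proof (cases "x \<in> X")
    case True
    then show ?thesis using X[of a x] ab(1) assms(4) by blast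
  next
    case False
    then have "reach (R \<union> F) b x" using that P[of b x] ab(2) by blast
    with e show ?thesis by (rule reach_trans)
  qed
  show "\<forall>x\<in>X \<union> P. \<forall>y\<in>X \<union> P. reach (R \<union> F) x y"
    using a reach_sym reach_trans by metis
qed

lemma linked_mono: "linked Ps F X \<Longrightarrow> Y \<subseteq> X \<Longrightarrow> linked Ps F Y"
  unfolding linked_def by blast

text \<open>The parts are listed in the order in which a tree grows: \<open>B\<close> hangs on
  \<open>A\<close>, then \<open>C\<close> on \<open>X\<close>, then \<open>D\<close> on
  \<open>Y\<close>, where \<open>X\<close> and \<open>Y\<close> name parts already reached.\<close>

lemma linked4:
  assumes "{A, B, C, D} \<subseteq> set Ps" "crosses A B e1" "crosses X C e2" "crosses Y D e3"
    "X = A \<or> X = B" "Y = A \<or> Y = B \<or> Y = C" "{e1, e2, e3} \<subseteq> F" "Z \<subseteq> A \<union> B \<union> C \<union> D"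
  shows "linked Ps F Z"
proof -
  have "linked Ps F A" using assms(1) by (intro linked_part) simp
  then have "linked Ps F (A \<union> B)" using assms(1,2,7) by (auto elim!: linked_step)
  then have "linked Ps F (A \<union> B \<union> C)" using assms(1,3,5,7) by (auto elim!: linked_step)
  then have "linked Ps F (A \<union> B \<union> C \<union> D)" using assms(1,4,6,7) by (auto elim!: linked_step)
  then show ?thesis using assms(8) by (rule linked_mono)
qed

lemma linked5:
  assumes "{A, B, C, D, G} \<subseteq> set Ps" "crosses A B e1" "crosses X C e2" "crosses Y D e3"
    "crosses W G e4"
    "X = A \<or> X = B" "Y = A \<or> Y = B \<or> Y = C" "W = A \<or> W = B \<or> W = C \<or> W = D"
    "{e1, e2, e3, e4} \<subseteq> F" "Z \<subseteq> A \<union> B \<union> C \<union> D \<union> G"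
  shows "linked Ps F Z"
proof -
  have "linked Ps F (A \<union> B \<union> C \<union> D)" using assms(1-4,6,7,9) by (intro linked4) auto
  then have "linked Ps F (A \<union> B \<union> C \<union> D \<union> G)" using assms(1,5,8,9) by (auto elim!: linked_step)
  then show ?thesis using assms(10) by (rule linked_mono)
qed

lemma crossing_not_sub:
  assumes "disj_list Ps" "A \<in> set Ps" "B \<in> set Ps" "A \<noteq> B" "crosses A B e" "P \<in> set Ps"
  shows "\<not> e \<subseteq> P"
  using assms disj_list_unique[OF assms(1)] unfolding crosses_def by (metis insert_subset)

section \<open>Colourings of the patterns, each colour on two edges\<close>

definition crossing :: "'a set list \<Rightarrow> 'a set \<Rightarrow> bool" where
  "crossing Ps e \<longleftrightarrow> (\<exists>A\<in>set Ps. \<exists>B\<in>set Ps. A \<noteq> B \<and> crosses A B e)"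

lemma crossingI: "crosses A B e \<Longrightarrow> A \<in> set Ps \<Longrightarrow> B \<in> set Ps \<Longrightarrow> A \<inter> B = {} \<Longrightarrow> crossing Ps e"
  unfolding crossing_def crosses_def by blast

text \<open>Five parts leave three colours for the edges between them. When one part is avoided, one
  edge of each colour is just enough to join the other four.\<close>

lemma saves_color_three_pairs:
  assumes "simple_graph V E" "conn_parts E V Ps" "length Ps = 5"
    and "distinct [a, a', b, b', c, c']" "{a, a', b, b', c, c'} \<subseteq> E"
    and "\<And>e. e \<in> {a, a', b, b', c, c'} \<Longrightarrow> crossing Ps e"
    and "\<And>Q. Q \<in> set Ps \<Longrightarrow>
      \<exists>x\<in>{a, a'}. \<exists>y\<in>{b, b'}. \<exists>z\<in>{c, c'}. linked Ps {x, y, z} (V - Q)"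
  shows "saves_color V E"
proof -
  define k :: "'a set \<Rightarrow> nat"
    where "k e = (if e \<in> {a, a'} then 1 else if e \<in> {b, b'} then 2 else 3)" for e
  have ka: "k x = 1" if "x \<in> {a, a'}" for x using that by (simp add: k_def)
  have d: "{a, a'} \<inter> {b, b'} = {}" "{a, a'} \<inter> {c, c'} = {}" "{b, b'} \<inter> {c, c'} = {}"
    using assms(4) by simp_all
  have kb: "k x = 2" if "x \<in> {b, b'}" for x
  proof -
    have "x \<notin> {a, a'}" using that d by blast
    then show ?thesis using that by (simp only: k_def if_True if_False)
  qed
  have kc: "k x = 3" if "x \<in> {c, c'}" for x
  proof -
    have "x \<notin> {a, a'}" "x \<notin> {b, b'}" using that d by blast+
    then show ?thesis by (simp only: k_def if_False)
  qed
  show ?thesis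
  proof (rule saves_color_from_parts[OF assms(1,2), of 3 "{a, a', b, b', c, c'}" k Ps])
    fix e P assume "e \<in> {a, a', b, b', c, c'}" "P \<in> set Ps"
    then show "\<not> e \<subseteq> P"
      using assms(2) assms(6)[of e] crossing_not_sub[of Ps _ _ e P]
      unfolding crossing_def conn_parts_def by blast
  next
    fix Q assume "Q \<in> set Ps"
    then obtain x y z where xyz: "x \<in> {a, a'}" "y \<in> {b, b'}" "z \<in> {c, c'}"
      "linked Ps {x, y, z} (V - Q)"
      using assms(7) by metis
    have "k x = 1" "k y = 2" "k z = 3" using xyz ka kb kc by blast+
    then have "inj_on k {x, y, z}" by (auto simp: inj_on_def)
    then show "\<exists>F\<subseteq>{a, a', b, b', c, c'}. inj_on k F \<and> linked Ps F (V - Q)"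
      using xyz by (intro exI[of _ "{x, y, z}"]) auto
  next
    have "k e \<in> {1..3}" for e by (simp add: k_def)
    then show "k ` {a, a', b, b', c, c'} \<subseteq> {1..3}" by blast
    show "disj_list Ps" "set Ps \<subseteq> Pow V" using assms(2) by (auto simp: conn_parts_def)
    show "{a, a', b, b', c, c'} \<subseteq> E" by (rule assms(5))
  qed (use assms(3) in simp_all)
qed

text \<open>The part \<open>P\<close> stays in every tree and is not counted among the avoidable
  ones. Avoiding one of the other five leaves five parts, joined by one edge of each of four
  colours.\<close>

lemma saves_color_four_pairs:
  assumes "simple_graph V E" "conn_parts E V (P # Ps)" "length Ps = 5"
    and "distinct [a, a', b, b', c, c', d, d']" "{a, a', b, b', c, c', d, d'} \<subseteq> E"
    and "\<And>e. e \<in> {a, a', b, b', c, c', d, d'} \<Longrightarrow> crossing (P # Ps) e"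
    and "\<And>Q. Q \<in> set Ps \<Longrightarrow>
      \<exists>x\<in>{a, a'}. \<exists>y\<in>{b, b'}. \<exists>z\<in>{c, c'}. \<exists>w\<in>{d, d'}. linked (P # Ps) {x, y, z, w} (V - Q)"
  shows "saves_color V E"
proof -
  define k :: "'a set \<Rightarrow> nat"
    where "k e = (if e \<in> {a, a'} then 1 else if e \<in> {b, b'} then 2 else if e \<in> {c, c'} then 3 else
      4)" for e
  have ka: "k x = 1" if "x \<in> {a, a'}" for x using that by (simp add: k_def)
  have d: "{a, a'} \<inter> {b, b'} = {}" "{a, a'} \<inter> {c, c'} = {}" "{b, b'} \<inter> {c, c'} = {}"
    "{a, a'} \<inter> {d, d'} = {}" "{b, b'} \<inter> {d, d'} = {}" "{c, c'} \<inter> {d, d'} = {}"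
    using assms(4) by simp_all
  have kb: "k x = 2" if "x \<in> {b, b'}" for x
  proof -
    have "x \<notin> {a, a'}" using that d by blast
    then show ?thesis using that by (simp only: k_def if_True if_False)
  qed
  have kc: "k x = 3" if "x \<in> {c, c'}" for x
  proof -
    have "x \<notin> {a, a'}" "x \<notin> {b, b'}" using that d by blast+
    then show ?thesis using that by (simp only: k_def if_True if_False)
  qed
  have kd: "k x = 4" if "x \<in> {d, d'}" for x
  proof -
    have "x \<notin> {a, a'}" "x \<notin> {b, b'}" "x \<notin> {c, c'}" using that d by blast+
    then show ?thesis by (simp only: k_def if_False)
  qed
  show ?thesis
  proof (rule saves_color_from_parts[OF assms(1,2), of 4 "{a, a', b, b', c, c', d, d'}" k Ps])
    fix e Q assume "e \<in> {a, a', b, b', c, c', d, d'}" "Q \<in> set (P # Ps)"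
    then show "\<not> e \<subseteq> Q"
      using assms(2) assms(6)[of e] crossing_not_sub[of "P # Ps" _ _ e Q]
      unfolding crossing_def conn_parts_def by blast
  next
    fix Q assume "Q \<in> set Ps"
    then obtain x y z w where xyz: "x \<in> {a, a'}" "y \<in> {b, b'}" "z \<in> {c, c'}" "w \<in> {d, d'}"
      "linked (P # Ps) {x, y, z, w} (V - Q)"
      using assms(7) by metis
    have "k x = 1" "k y = 2" "k z = 3" "k w = 4" using xyz ka kb kc kd by blast+
    then have "inj_on k {x, y, z, w}" by (auto simp: inj_on_def)
    then show "\<exists>F\<subseteq>{a, a', b, b', c, c', d, d'}. inj_on k F \<and> linked (P # Ps) F (V - Q)"
      using xyz by (intro exI[of _ "{x, y, z, w}"]) auto
  next
    have "k e \<in> {1..4}" for e by (simp add: k_def)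
    then show "k ` {a, a', b, b', c, c', d, d'} \<subseteq> {1..4}" by blast
    show "disj_list Ps" "set Ps \<subseteq> Pow V" using assms(2) by (auto simp: conn_parts_def)
    show "{a, a', b, b', c, c', d, d'} \<subseteq> E" by (rule assms(5))
  qed (use assms(3) in simp_all)
qed

lemma crosses_image: "crosses A B e \<Longrightarrow> \<forall>x\<in>A. f x = i \<Longrightarrow> \<forall>x\<in>B. f x = j \<Longrightarrow> f ` e = {i, j}"
  by (auto simp: crosses_def)

text \<open>The fact \<open>dist\<close> lists the edges of a pattern so that the first two share a colour, the next two
  another one, and so on. In a pattern with six parts the first part is a cut vertex; each of the
  other five can be avoided by a rainbow tree on the rest.\<close>

lemma saves_color_K23:
  assumes sg: "simple_graph V E" and Ps: "conn_parts E V [X, Y, P, Q, R]"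
    and J: "joined E X P" "joined E X Q" "joined E X R" "joined E Y P" "joined E Y Q"
      "joined E Y R"
  shows "saves_color V E"
proof -
  let ?Ps = "[X, Y, P, Q, R]"
  obtain xp xq xr yp yq yr where e: "crosses X P xp" "crosses X Q xq" "crosses X R xr"
    "crosses Y P yp" "crosses Y Q yq" "crosses Y R yr"
    and E: "{xp, xq, xr, yp, yq, yr} \<subseteq> E"
    using J unfolding joined_crosses by blast
  have dj: "disj_list ?Ps" and V: "V = \<Union>(set ?Ps)"
    using Ps by (simp_all only: conn_parts_def)
  obtain f :: "'a \<Rightarrow> nat" where "\<forall>i<length ?Ps. \<forall>x\<in>?Ps ! i. f x = i"
    using disj_list_label[OF dj] by blast
  then have lab: "\<forall>x\<in>X. f x = 0" "\<forall>x\<in>Y. f x = 1" "\<forall>x\<in>P. f x = 2" "\<forall>x\<in>Q. f x = 3" "\<forall>x\<in>R. f x = 4"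
    by (force simp: numeral_eq_Suc)+
  note img = crosses_image[OF e(1) lab(1) lab(3)]
    crosses_image[OF e(2) lab(1) lab(4)]
    crosses_image[OF e(3) lab(1) lab(5)]
    crosses_image[OF e(4) lab(2) lab(3)]
    crosses_image[OF e(5) lab(2) lab(4)]
    crosses_image[OF e(6) lab(2) lab(5)]
  \<comment> \<open>Avoiding \<open>X\<close> leaves only the three edges at \<open>Y\<close>, which
    must have different colours, and likewise with \<open>X\<close> and \<open>Y\<close> exchanged;
    so each edge at \<open>X\<close> is paired with one at \<open>Y\<close>. The pair
    \<open>xp\<close>, \<open>yp\<close> would be lost together with \<open>P\<close>, so the
    pairing is a cyclic shift.\<close>
  have dist: "distinct [xp, yr, xq, yp, xr, yq]"
    using img by (simp, intro conjI notI) (simp_all add: doubleton_eq_iff)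
  have LX: "linked ?Ps {yr, yp, yq} (V - X)"
    by (rule linked4[OF _ e(6) e(4) e(5)]) (auto simp: V)
  have LY: "linked ?Ps {xp, xq, xr} (V - Y)"
    by (rule linked4[OF _ e(1) e(2) e(3)]) (auto simp: V)
  have LP: "linked ?Ps {yr, xq, xr} (V - P)"
    by (rule linked4[OF _ e(6) e(3)[THEN crosses_sym] e(2)]) (auto simp: V)
  have LQ: "linked ?Ps {xp, yp, xr} (V - Q)"
    by (rule linked4[OF _ e(1) e(4)[THEN crosses_sym] e(3)]) (auto simp: V)
  have LR: "linked ?Ps {xp, xq, yq} (V - R)"
    by (rule linked4[OF _ e(1) e(2) e(5)[THEN crosses_sym]]) (auto simp: V)
  have cr: "crossing ?Ps xp" "crossing ?Ps xq" "crossing ?Ps xr" "crossing ?Ps yp"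
    "crossing ?Ps yq" "crossing ?Ps yr"
    using e[THEN crossingI] dj by (simp_all add: Int_commute)
  show ?thesis
  proof (rule saves_color_three_pairs[OF sg Ps _ dist])
    show "{xp, yr, xq, yp, xr, yq} \<subseteq> E" using E by simp
    show "crossing ?Ps x" if "x \<in> {xp, yr, xq, yp, xr, yq}" for x
      using that cr by blast
    show "\<exists>x\<in>{xp, yr}. \<exists>y\<in>{xq, yp}. \<exists>z\<in>{xr, yq}. linked ?Ps {x, y, z} (V - K)"
      if "K \<in> set [X, Y, P, Q, R]" for K
      using that LX LY LP LQ LR by auto
  qed simp
qed

text \<open>Avoiding \<open>P\<close> or \<open>R\<close>, the parts of degree three, leaves only
  three edges, which must have different colours. Hence \<open>st\<close> shares its colour with the
  chord \<open>pr\<close>. As \<open>pq\<close> and \<open>qr\<close> would be lost together with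
  \<open>Q\<close>, the other pairs are \<open>pq\<close>, \<open>rs\<close> and \<open>qr\<close>,
  \<open>tp\<close>.\<close>

lemma saves_color_house:
  assumes sg: "simple_graph V E" and Ps: "conn_parts E V [P, Q, R, S, T]"
    and J: "joined E P Q" "joined E Q R" "joined E R S" "joined E S T" "joined E T P"
      "joined E P R"
  shows "saves_color V E"
proof -
  let ?Ps = "[P, Q, R, S, T]"
  obtain pq qr rs st tp pr where e: "crosses P Q pq" "crosses Q R qr" "crosses R S rs"
    "crosses S T st" "crosses T P tp" "crosses P R pr"
    and E: "{pq, qr, rs, st, tp, pr} \<subseteq> E"
    using J unfolding joined_crosses by blast
  have dj: "disj_list ?Ps" and V: "V = \<Union>(set ?Ps)"
    using Ps by (simp_all only: conn_parts_def)
  obtain f :: "'a \<Rightarrow> nat" where "\<forall>i<length ?Ps. \<forall>x\<in>?Ps ! i. f x = i"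
    using disj_list_label[OF dj] by blast
  then have lab: "\<forall>x\<in>P. f x = 0" "\<forall>x\<in>Q. f x = 1" "\<forall>x\<in>R. f x = 2" "\<forall>x\<in>S. f x = 3" "\<forall>x\<in>T. f x = 4"
    by (force simp: numeral_eq_Suc)+
  note img = crosses_image[OF e(1) lab(1) lab(2)]
    crosses_image[OF e(2) lab(2) lab(3)]
    crosses_image[OF e(3) lab(3) lab(4)]
    crosses_image[OF e(4) lab(4) lab(5)]
    crosses_image[OF e(5) lab(5) lab(1)]
    crosses_image[OF e(6) lab(1) lab(3)]
  have dist: "distinct [pq, rs, qr, tp, st, pr]"
    using img by (simp, intro conjI notI) (simp_all add: doubleton_eq_iff)
  have LP: "linked ?Ps {rs, qr, st} (V - P)"
    by (rule linked4[OF _ e(3) e(2)[THEN crosses_sym] e(4)]) (auto simp: V)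
  have LQ: "linked ?Ps {rs, tp, pr} (V - Q)"
    by (rule linked4[OF _ e(3) e(6)[THEN crosses_sym] e(5)[THEN crosses_sym]]) (auto simp: V)
  have LR: "linked ?Ps {pq, tp, st} (V - R)"
    by (rule linked4[OF _ e(1) e(5)[THEN crosses_sym] e(4)[THEN crosses_sym]]) (auto simp: V)
  have LS: "linked ?Ps {pq, tp, pr} (V - S)"
    by (rule linked4[OF _ e(1) e(5)[THEN crosses_sym] e(6)]) (auto simp: V)
  have LT: "linked ?Ps {rs, qr, pr} (V - T)"
    by (rule linked4[OF _ e(3) e(2)[THEN crosses_sym] e(6)[THEN crosses_sym]]) (auto simp: V)
  have cr: "crossing ?Ps pq" "crossing ?Ps qr" "crossing ?Ps rs" "crossing ?Ps st"
    "crossing ?Ps tp" "crossing ?Ps pr"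
    using e[THEN crossingI] dj by (simp_all add: Int_commute)
  show ?thesis
  proof (rule saves_color_three_pairs[OF sg Ps _ dist])
    show "{pq, rs, qr, tp, st, pr} \<subseteq> E" using E by simp
    show "crossing ?Ps x" if "x \<in> {pq, rs, qr, tp, st, pr}" for x
      using that cr by blast
    show "\<exists>x\<in>{pq, rs}. \<exists>y\<in>{qr, tp}. \<exists>z\<in>{st, pr}. linked ?Ps {x, y, z} (V - K)"
      if "K \<in> set [P, Q, R, S, T]" for K
      using that LP LQ LR LS LT by auto
  qed simp
qed

text \<open>The two edges from \<open>Z\<close> to \<open>U\<close> are what contraction leaves of a
  third cycle. Labels of parts cannot separate \<open>m\<close> from \<open>m'\<close>, so their
  being different is assumed. Each shares its colour with the edge of a triangle opposite to
  \<open>Z\<close>.\<close>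

lemma saves_color_three_cycles:
  assumes sg: "simple_graph V E" and Ps: "conn_parts E V [Z, U, P, Q, R, S]"
    and J: "joined E Z P" "joined E Z Q" "joined E P Q" "joined E Z R" "joined E Z S"
      "joined E R S"
    and D: "crosses Z U m" "crosses Z U m'" "m \<noteq> m'" "m \<in> E" "m' \<in> E"
  shows "saves_color V E"
proof -
  let ?Ps = "[Z, U, P, Q, R, S]"
  obtain zp zq pq zr zs rs where e: "crosses Z P zp" "crosses Z Q zq" "crosses P Q pq"
    "crosses Z R zr" "crosses Z S zs" "crosses R S rs"
    and E: "{zp, zq, pq, zr, zs, rs} \<subseteq> E"
    using J unfolding joined_crosses by blast
  note e = e D(1,2)
  have dj: "disj_list ?Ps" and V: "V = \<Union>(set ?Ps)"
    using Ps by (simp_all only: conn_parts_def)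
  obtain f :: "'a \<Rightarrow> nat" where "\<forall>i<length ?Ps. \<forall>x\<in>?Ps ! i. f x = i"
    using disj_list_label[OF dj] by blast
  then have lab: "\<forall>x\<in>Z. f x = 0" "\<forall>x\<in>U. f x = 1" "\<forall>x\<in>P. f x = 2" "\<forall>x\<in>Q. f x = 3" "\<forall>x\<in>R. f x = 4"
    "\<forall>x\<in>S. f x = 5"
    by (force simp: numeral_eq_Suc)+
  note img = crosses_image[OF e(1) lab(1) lab(3)]
    crosses_image[OF e(2) lab(1) lab(4)]
    crosses_image[OF e(3) lab(3) lab(4)]
    crosses_image[OF e(4) lab(1) lab(5)]
    crosses_image[OF e(5) lab(1) lab(6)]
    crosses_image[OF e(6) lab(5) lab(6)]
    crosses_image[OF e(7) lab(1) lab(2)]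
    crosses_image[OF e(8) lab(1) lab(2)]
  have dist: "distinct [m, pq, m', rs, zp, zr, zq, zs]"
    using img D(3) by (simp, intro conjI notI) (simp_all add: doubleton_eq_iff)
  have LU: "linked ?Ps {pq, rs, zp, zs} (V - U)"
    by (rule linked5[OF _ e(3) e(1)[THEN crosses_sym] e(5) e(6)[THEN crosses_sym]]) (auto simp: V)
  have LP: "linked ?Ps {m, rs, zr, zq} (V - P)"
    by (rule linked5[OF _ e(7) e(4) e(6) e(2)]) (auto simp: V)
  have LQ: "linked ?Ps {m, rs, zp, zs} (V - Q)"
    by (rule linked5[OF _ e(7) e(1) e(5) e(6)[THEN crosses_sym]]) (auto simp: V)
  have LR: "linked ?Ps {pq, m', zp, zs} (V - R)"
    by (rule linked5[OF _ e(3) e(1)[THEN crosses_sym] e(8) e(5)]) (auto simp: V)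
  have LS: "linked ?Ps {pq, m', zr, zq} (V - S)"
    by (rule linked5[OF _ e(3) e(2)[THEN crosses_sym] e(8) e(4)]) (auto simp: V)
  have cr: "crossing ?Ps zp" "crossing ?Ps zq" "crossing ?Ps pq" "crossing ?Ps zr"
    "crossing ?Ps zs" "crossing ?Ps rs" "crossing ?Ps m" "crossing ?Ps m'"
    using e[THEN crossingI] dj by (simp_all add: Int_commute)
  show ?thesis
  proof (rule saves_color_four_pairs[OF sg Ps _ dist])
    show "{m, pq, m', rs, zp, zr, zq, zs} \<subseteq> E" using E D(4,5) by simp
    show "crossing ?Ps x" if "x \<in> {m, pq, m', rs, zp, zr, zq, zs}" for x
      using that cr by blast
    show "\<exists>x\<in>{m, pq}. \<exists>y\<in>{m', rs}. \<exists>z\<in>{zp, zr}. \<exists>w\<in>{zq, zs}. linked ?Ps {x, y, z, w} (V - K)"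
      if "K \<in> set [U, P, Q, R, S]" for K
      using that LU LP LQ LR LS by auto
  qed simp
qed

text \<open>Each edge of the triangle \<open>A\<close>, \<open>P\<close>, \<open>Q\<close> is paired
  with an edge of the diamond. Avoiding \<open>P\<close> forces \<open>oq\<close>, so the diamond
  has to be spanned without \<open>ab\<close>; avoiding \<open>Q\<close> forces \<open>op\<close>,
  so it is spanned without \<open>ad\<close>. Avoiding a part of the diamond leaves a choice of two
  edges in the triangle.\<close>

lemma saves_color_diamond_triangle_hub:
  assumes sg: "simple_graph V E" and Ps: "conn_parts E V [A, B, C, D, P, Q]"
    and J: "joined E A B" "joined E A C" "joined E A D" "joined E B C" "joined E B D"
      "joined E A P" "joined E A Q" "joined E P Q"
  shows "saves_color V E"
proof -
  let ?Ps = "[A, B, C, D, P, Q]"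
  obtain ab ac ad bc bd op oq pq where e: "crosses A B ab" "crosses A C ac" "crosses A D ad"
    "crosses B C bc" "crosses B D bd" "crosses A P op" "crosses A Q oq" "crosses P Q pq"
    and E: "{ab, ac, ad, bc, bd, op, oq, pq} \<subseteq> E"
    using J unfolding joined_crosses by blast
  have dj: "disj_list ?Ps" and V: "V = \<Union>(set ?Ps)"
    using Ps by (simp_all only: conn_parts_def)
  obtain f :: "'a \<Rightarrow> nat" where "\<forall>i<length ?Ps. \<forall>x\<in>?Ps ! i. f x = i"
    using disj_list_label[OF dj] by blast
  then have lab: "\<forall>x\<in>A. f x = 0" "\<forall>x\<in>B. f x = 1" "\<forall>x\<in>C. f x = 2" "\<forall>x\<in>D. f x = 3" "\<forall>x\<in>P. f x = 4"
    "\<forall>x\<in>Q. f x = 5"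
    by (force simp: numeral_eq_Suc)+
  note img = crosses_image[OF e(1) lab(1) lab(2)]
    crosses_image[OF e(2) lab(1) lab(3)]
    crosses_image[OF e(3) lab(1) lab(4)]
    crosses_image[OF e(4) lab(2) lab(3)]
    crosses_image[OF e(5) lab(2) lab(4)]
    crosses_image[OF e(6) lab(1) lab(5)]
    crosses_image[OF e(7) lab(1) lab(6)]
    crosses_image[OF e(8) lab(5) lab(6)]
  have dist: "distinct [op, ad, oq, ab, pq, bc, ac, bd]"
    using img by (simp, intro conjI notI) (simp_all add: doubleton_eq_iff)
  have LB: "linked ?Ps {ad, oq, pq, ac} (V - B)"
    by (rule linked5[OF _ e(3) e(7) e(8)[THEN crosses_sym] e(2)]) (auto simp: V)
  have LC: "linked ?Ps {op, ab, pq, bd} (V - C)"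
    by (rule linked5[OF _ e(6) e(1) e(8) e(5)]) (auto simp: V)
  have LD: "linked ?Ps {op, ab, pq, ac} (V - D)"
    by (rule linked5[OF _ e(6) e(1) e(8) e(2)]) (auto simp: V)
  have LP: "linked ?Ps {ad, oq, bc, ac} (V - P)"
    by (rule linked5[OF _ e(3) e(7) e(2) e(4)[THEN crosses_sym]]) (auto simp: V)
  have LQ: "linked ?Ps {op, ab, bc, bd} (V - Q)"
    by (rule linked5[OF _ e(6) e(1) e(4) e(5)]) (auto simp: V)
  have cr: "crossing ?Ps ab" "crossing ?Ps ac" "crossing ?Ps ad" "crossing ?Ps bc"
    "crossing ?Ps bd" "crossing ?Ps op" "crossing ?Ps oq" "crossing ?Ps pq"
    using e[THEN crossingI] dj by (simp_all add: Int_commute)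
  show ?thesis
  proof (rule saves_color_four_pairs[OF sg Ps _ dist])
    show "{op, ad, oq, ab, pq, bc, ac, bd} \<subseteq> E" using E by simp
    show "crossing ?Ps x" if "x \<in> {op, ad, oq, ab, pq, bc, ac, bd}" for x
      using that cr by blast
    show "\<exists>x\<in>{op, ad}. \<exists>y\<in>{oq, ab}. \<exists>z\<in>{pq, bc}. \<exists>w\<in>{ac, bd}. linked ?Ps {x, y, z, w} (V - K)"
      if "K \<in> set [B, C, D, P, Q]" for K
      using that LB LC LD LP LQ by auto
  qed simp
qed

text \<open>The cut vertex is now the tip \<open>C\<close>; the pairing used for a triangle at a hub
  works here as well.\<close>

lemma saves_color_diamond_triangle_tip:
  assumes sg: "simple_graph V E" and Ps: "conn_parts E V [C, A, B, D, P, Q]"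
    and J: "joined E A B" "joined E A C" "joined E A D" "joined E B C" "joined E B D"
      "joined E C P" "joined E C Q" "joined E P Q"
  shows "saves_color V E"
proof -
  let ?Ps = "[C, A, B, D, P, Q]"
  obtain ab ac ad bc bd op oq pq where e: "crosses A B ab" "crosses A C ac" "crosses A D ad"
    "crosses B C bc" "crosses B D bd" "crosses C P op" "crosses C Q oq" "crosses P Q pq"
    and E: "{ab, ac, ad, bc, bd, op, oq, pq} \<subseteq> E"
    using J unfolding joined_crosses by blast
  have dj: "disj_list ?Ps" and V: "V = \<Union>(set ?Ps)"
    using Ps by (simp_all only: conn_parts_def)
  obtain f :: "'a \<Rightarrow> nat" where "\<forall>i<length ?Ps. \<forall>x\<in>?Ps ! i. f x = i"
    using disj_list_label[OF dj] by blast
  then have lab: "\<forall>x\<in>C. f x = 0" "\<forall>x\<in>A. f x = 1" "\<forall>x\<in>B. f x = 2" "\<forall>x\<in>D. f x = 3" "\<forall>x\<in>P. f x = 4"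
    "\<forall>x\<in>Q. f x = 5"
    by (force simp: numeral_eq_Suc)+
  note img = crosses_image[OF e(1) lab(2) lab(3)]
    crosses_image[OF e(2) lab(2) lab(1)]
    crosses_image[OF e(3) lab(2) lab(4)]
    crosses_image[OF e(4) lab(3) lab(1)]
    crosses_image[OF e(5) lab(3) lab(4)]
    crosses_image[OF e(6) lab(1) lab(5)]
    crosses_image[OF e(7) lab(1) lab(6)]
    crosses_image[OF e(8) lab(5) lab(6)]
  have dist: "distinct [op, ad, oq, ab, pq, bc, ac, bd]"
    using img by (simp, intro conjI notI) (simp_all add: doubleton_eq_iff)
  have LA: "linked ?Ps {op, oq, bc, bd} (V - A)"
    by (rule linked5[OF _ e(6) e(7) e(4)[THEN crosses_sym] e(5)]) (auto simp: V)
  have LB: "linked ?Ps {ad, oq, pq, ac} (V - B)"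
    by (rule linked5[OF _ e(3) e(2) e(7) e(8)[THEN crosses_sym]]) (auto simp: V)
  have LD: "linked ?Ps {op, ab, pq, ac} (V - D)"
    by (rule linked5[OF _ e(6) e(8) e(2)[THEN crosses_sym] e(1)]) (auto simp: V)
  have LP: "linked ?Ps {ad, oq, bc, ac} (V - P)"
    by (rule linked5[OF _ e(3) e(2) e(7) e(4)[THEN crosses_sym]]) (auto simp: V)
  have LQ: "linked ?Ps {op, ab, bc, bd} (V - Q)"
    by (rule linked5[OF _ e(6) e(4)[THEN crosses_sym] e(1)[THEN crosses_sym] e(5)]) (auto simp: V)
  have cr: "crossing ?Ps ab" "crossing ?Ps ac" "crossing ?Ps ad" "crossing ?Ps bc"
    "crossing ?Ps bd" "crossing ?Ps op" "crossing ?Ps oq" "crossing ?Ps pq"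
    using e[THEN crossingI] dj by (simp_all add: Int_commute)
  show ?thesis
  proof (rule saves_color_four_pairs[OF sg Ps _ dist])
    show "{op, ad, oq, ab, pq, bc, ac, bd} \<subseteq> E" using E by simp
    show "crossing ?Ps x" if "x \<in> {op, ad, oq, ab, pq, bc, ac, bd}" for x
      using that cr by blast
    show "\<exists>x\<in>{op, ad}. \<exists>y\<in>{oq, ab}. \<exists>z\<in>{pq, bc}. \<exists>w\<in>{ac, bd}. linked ?Ps {x, y, z, w} (V - K)"
      if "K \<in> set [A, B, D, P, Q]" for K
      using that LA LB LD LP LQ by auto
  qed simp
qed

text \<open>Two perfect matchings of K4, \<open>ab\<close>, \<open>cd\<close> and \<open>ac\<close>,
  \<open>bd\<close>, are colour classes and form a 4-cycle; whichever part of it is avoided, two of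
  its edges in different colours join the other three. If both leaves are needed, \<open>ap\<close>
  and \<open>aq\<close> use up the other two colours. If one leaf is avoided, its colour is
  available on \<open>ad\<close> or \<open>bc\<close>.\<close>

lemma saves_color_K4_two_leaves:
  assumes sg: "simple_graph V E" and Ps: "conn_parts E V [A, B, C, D, P, Q]"
    and J: "joined E A B" "joined E A C" "joined E A D" "joined E B C" "joined E B D"
      "joined E C D" "joined E A P" "joined E A Q"
  shows "saves_color V E"
proof -
  let ?Ps = "[A, B, C, D, P, Q]"
  obtain ab ac ad bc bd cd ap aq where e: "crosses A B ab" "crosses A C ac" "crosses A D ad"
    "crosses B C bc" "crosses B D bd" "crosses C D cd" "crosses A P ap" "crosses A Q aq"
    and E: "{ab, ac, ad, bc, bd, cd, ap, aq} \<subseteq> E"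
    using J unfolding joined_crosses by blast
  have dj: "disj_list ?Ps" and V: "V = \<Union>(set ?Ps)"
    using Ps by (simp_all only: conn_parts_def)
  obtain f :: "'a \<Rightarrow> nat" where "\<forall>i<length ?Ps. \<forall>x\<in>?Ps ! i. f x = i"
    using disj_list_label[OF dj] by blast
  then have lab: "\<forall>x\<in>A. f x = 0" "\<forall>x\<in>B. f x = 1" "\<forall>x\<in>C. f x = 2" "\<forall>x\<in>D. f x = 3" "\<forall>x\<in>P. f x = 4"
    "\<forall>x\<in>Q. f x = 5"
    by (force simp: numeral_eq_Suc)+
  note img = crosses_image[OF e(1) lab(1) lab(2)]
    crosses_image[OF e(2) lab(1) lab(3)]
    crosses_image[OF e(3) lab(1) lab(4)]
    crosses_image[OF e(4) lab(2) lab(3)]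
    crosses_image[OF e(5) lab(2) lab(4)]
    crosses_image[OF e(6) lab(3) lab(4)]
    crosses_image[OF e(7) lab(1) lab(5)]
    crosses_image[OF e(8) lab(1) lab(6)]
  have dist: "distinct [ap, ad, aq, bc, ab, cd, ac, bd]"
    using img by (simp, intro conjI notI) (simp_all add: doubleton_eq_iff)
  have LB: "linked ?Ps {ap, aq, cd, ac} (V - B)"
    by (rule linked5[OF _ e(7) e(8) e(2) e(6)]) (auto simp: V)
  have LC: "linked ?Ps {ap, aq, ab, bd} (V - C)"
    by (rule linked5[OF _ e(7) e(8) e(1) e(5)]) (auto simp: V)
  have LD: "linked ?Ps {ap, aq, ab, ac} (V - D)"
    by (rule linked5[OF _ e(7) e(8) e(1) e(2)]) (auto simp: V)
  have LP: "linked ?Ps {ad, aq, ab, ac} (V - P)"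
    by (rule linked5[OF _ e(3) e(8) e(1) e(2)]) (auto simp: V)
  have LQ: "linked ?Ps {ap, bc, ab, bd} (V - Q)"
    by (rule linked5[OF _ e(7) e(1) e(4) e(5)]) (auto simp: V)
  have cr: "crossing ?Ps ab" "crossing ?Ps ac" "crossing ?Ps ad" "crossing ?Ps bc"
    "crossing ?Ps bd" "crossing ?Ps cd" "crossing ?Ps ap" "crossing ?Ps aq"
    using e[THEN crossingI] dj by (simp_all add: Int_commute)
  show ?thesis
  proof (rule saves_color_four_pairs[OF sg Ps _ dist])
    show "{ap, ad, aq, bc, ab, cd, ac, bd} \<subseteq> E" using E by simp
    show "crossing ?Ps x" if "x \<in> {ap, ad, aq, bc, ab, cd, ac, bd}" for x
      using that cr by blast
    show "\<exists>x\<in>{ap, ad}. \<exists>y\<in>{aq, bc}. \<exists>z\<in>{ab, cd}. \<exists>w\<in>{ac, bd}. linked ?Ps {x, y, z, w} (V - K)"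
      if "K \<in> set [B, C, D, P, Q]" for K
      using that LB LC LD LP LQ by auto
  qed simp
qed

subsection \<open>Large bonds\<close>

text \<open>Connectedness of both sides makes the cut a bond. It has at least three edges;
  \<open>e\<close>, \<open>f\<close>, \<open>g\<close> need not be all of them.\<close>

definition big_bond :: "'a set set \<Rightarrow> 'a set \<Rightarrow> bool" where
  "big_bond E V \<longleftrightarrow> (\<exists>P Q e f g. P \<union> Q = V \<and> P \<inter> Q = {} \<and> conn_set E P \<and> conn_set E Q \<and>
     distinct [e, f, g] \<and> {e, f, g} \<subseteq> E \<and> crosses P Q e \<and> crosses P Q f \<and> crosses P Q g)"

lemma big_bondI:
  assumes "P \<union> Q = V" "P \<inter> Q = {}" "conn_set E P" "conn_set E Q" "e \<noteq> f" "e \<noteq> g" "f \<noteq> g"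
    "e \<in> E" "f \<in> E" "g \<in> E" "crosses P Q e" "crosses P Q f" "crosses P Q g"
  shows "big_bond E V"
  unfolding big_bond_def
  by (intro exI[of _ P] exI[of _ Q] exI[of _ e] exI[of _ f] exI[of _ g]) (use assms in simp)

lemma big_bondE:
  assumes "big_bond E V"
  obtains P Q e f g where "P \<union> Q = V" "P \<inter> Q = {}" "conn_set E P" "conn_set E Q"
    "distinct [e, f, g]" "{e, f, g} \<subseteq> E" "crosses P Q e" "crosses P Q f" "crosses P Q g"
  using assms unfolding big_bond_def by (elim exE conjE) (rule that)

text \<open>Without \<open>e\<close> and \<open>f\<close> the cycle \<open>C\<close> falls into two
  arcs, which are extended to a partition of \<open>V\<close> into connected sides. Both edges cross
  it. The rest of \<open>D\<close> joins the ends of \<open>e\<close> and uses neither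
  \<open>e\<close> nor \<open>f\<close>, so it crosses a third time.\<close>

lemma two_cycles_big_bond:
  assumes sg: "simple_graph V E" and con: "connected_graph V E"
    and C: "cycle_in E C" "e \<in> C" "f \<in> C" and D: "cycle_in E D" "e \<in> D" "f \<notin> D"
  shows "big_bond E V"
proof -
  have eE: "e \<in> E" and fE: "f \<in> E" using C cycle_subset by blast+
  obtain u v where uv: "e = {u, v}" "u \<in> V" "v \<in> V" "u \<noteq> v" using simple_graph_edgeE[OF sg eE] .
  obtain s t where st: "f = {s, t}" "s \<in> V" "t \<in> V" using simple_graph_edgeE[OF sg fE] .
  have fe: "f \<noteq> e" using D by auto
  let ?F = "C - {e, f}"
  have FE: "?F \<subseteq> E" using C cycle_subset by blast
  have ns: "\<not> reach ?F u v" using cycle_two_edges_separate[of E C u v f] C fe uv(1) by simp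
  define A where "A = {z. reach ?F u z}"
  define B where "B = {z. reach ?F v z}"
  have iU: "induced ?F UNIV = ?F" by (auto simp: induced_def)
  have A: "conn_set E A" "A \<subseteq> V"
    using conn_set_cls_induced(1)[of u UNIV ?F] conn_set_mono[OF _ FE] iU reach_in[OF
      simple_graph_subset[OF sg FE]] uv(2)
    by (auto simp: A_def)
  have B: "conn_set E B" "B \<subseteq> V"
    using conn_set_cls_induced(1)[of v UNIV ?F] conn_set_mono[OF _ FE] iU reach_in[OF
      simple_graph_subset[OF sg FE]] uv(3)
    by (auto simp: B_def)
  have AB: "A \<inter> B = {}"
  proof -
    have False if "z \<in> A" "z \<in> B" for z
    proof -
      have "reach ?F u z" "reach ?F v z" using that by (simp_all add: A_def B_def)
      then have "reach ?F u v" using reach_sym reach_trans by metis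
      then show False using ns by simp
    qed
    then show ?thesis by blast
  qed
  obtain P Q where PQ: "P \<union> Q = V" "P \<inter> Q = {}" "A \<subseteq> P" "B \<subseteq> Q" "conn_set E P" "conn_set E Q"
    using conn_set_split[OF conn_set_whole[OF sg con] A B AB] by metis
  have uA: "u \<in> A" "v \<in> B" by (auto simp: A_def B_def)
  then have uP: "u \<in> P" "v \<in> Q" "v \<notin> P" using PQ by auto
  have eP: "crosses P Q e" using uP uv(1) by (auto simp: crosses_def)
  have "C - {e} = insert {s, t} ?F" using C(3) fe st(1) by blast
  then have "reach (insert {s, t} ?F) u v" using cycle_edge_reach[of E C u v] C uv(1) by simp
  then have "reach ?F u s \<and> reach ?F t v \<or> reach ?F u t \<and> reach ?F s v"
    using reach_insert_cases ns by metis
  then have "s \<in> A \<and> t \<in> B \<or> t \<in> A \<and> s \<in> B"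
    using reach_sym[of ?F] by (simp add: A_def B_def) metis
  then have "crosses A B f"
  proof
    assume "s \<in> A \<and> t \<in> B"
    then show ?thesis unfolding crosses_def st(1) by blast
  next
    assume "t \<in> A \<and> s \<in> B"
    moreover have "f = {t, s}" using st(1) by (simp add: insert_commute)
    ultimately show ?thesis unfolding crosses_def by blast
  qed
  then have fP: "crosses P Q f" using PQ(3,4) unfolding crosses_def by blast
  have "D - {{u, v}} \<subseteq> E - {e, f}" using D cycle_subset uv(1) by blast
  then have "reach (E - {e, f}) u v" using cycle_edge_reach[of E D u v] D uv(1) reach_mono
    by metis
  then obtain a b where ab: "{a, b} \<in> E - {e, f}" "a \<in> P" "b \<notin> P"
    using reach_cross[of _ u v P] uP by metis
  then have "b \<in> Q" using PQ(1) simple_graph_edge(2)[OF sg, of a b] by blast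
  then have "crosses P Q {a, b}" using ab by (auto simp: crosses_def)
  then show ?thesis using PQ eP fP eE fE fe ab(1) by (intro big_bondI[of P Q V E e f
    "{a, b}"]) auto
qed

lemma not_cactus_big_bond:
  assumes "simple_graph V E" "connected_graph V E" "\<not> cactus V E"
  shows "big_bond E V"
proof -
  obtain e C D where CD: "cycle_in E C" "e \<in> C" "cycle_in E D" "e \<in> D" "C \<noteq> D"
    using assms unfolding cactus_def by blast
  show ?thesis
  proof (cases "C \<subseteq> D")
    case True
    then obtain f where "f \<in> D" "f \<notin> C" using CD by blast
    then show ?thesis using two_cycles_big_bond[OF assms(1,2)] CD by blast
  next
    case False
    then obtain f where "f \<in> C" "f \<notin> D" by blast
    then show ?thesis using two_cycles_big_bond[OF assms(1,2)] CD by blast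
  qed
qed

text \<open>For each crossing edge \<open>h\<close> other than \<open>e\<close>, the connected sides
  close up a cycle through \<open>e\<close> and \<open>h\<close> that contains no further crossing
  edge. Taking \<open>f\<close> and \<open>g\<close> for \<open>h\<close> gives two cycles through
  \<open>e\<close>.\<close>

lemma big_bond_not_cactus:
  assumes sg: "simple_graph V E" and bb: "big_bond E V"
  shows "\<not> cactus V E"
proof
  assume cac: "cactus V E"
  obtain P Q e f g where PQ: "P \<union> Q = V" "P \<inter> Q = {}" "conn_set E P" "conn_set E Q"
    "distinct [e, f, g]" "{e, f, g} \<subseteq> E" "crosses P Q e" "crosses P Q f" "crosses P Q g"
    using big_bondE[OF bb] .
  obtain u v where uv: "e = {u, v}" "u \<in> P" "v \<in> Q" using PQ by (auto simp: crosses_def)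
  let ?I = "induced E P \<union> induced E Q"
  have cyc: "\<exists>C. cycle_in E C \<and> e \<in> C \<and> h \<in> C \<and> C \<subseteq> ?I \<union> {e, h}"
    if h: "crosses P Q h" "h \<in> E" "h \<noteq> e" for h
  proof -
    obtain s t where st: "h = {s, t}" "s \<in> P" "t \<in> Q" using h by (auto simp: crosses_def)
    let ?H = "?I \<union> {e, h}"
    have eI: "e \<notin> ?I" using PQ(2) uv by (auto simp: induced_def)
    have "reach (insert h ?I) u s"
      using PQ(3) uv st unfolding conn_set_def by (metis Un_upper1 reach_mono subset_insertI2)
    moreover have "reach (insert h ?I) s t" using st by (intro reach_edge) simp
    moreover have "reach (insert h ?I) t v"
      using PQ(4) uv st unfolding conn_set_def by (metis Un_upper2 reach_mono subset_insertI2)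
    ultimately have "reach (insert h ?I) u v" by (meson reach_trans)
    moreover have "?H - {{u, v}} = insert h ?I" using eI h uv by auto
    ultimately have r: "reach (?H - {{u, v}}) u v" by simp
    have "u \<noteq> v" using uv PQ(2) by auto
    then obtain C where C: "cycle_in ?H C" "e \<in> C"
      using nonbridge_cycle[OF _ _ r] uv by blast
    have HE: "?H \<subseteq> E" using PQ(6) h induced_subset by auto
    have "h \<in> C"
    proof (rule ccontr)
      assume "h \<notin> C"
      then have "C - {e} \<subseteq> ?I" using cycle_subset[OF C(1)] by blast
      then have "reach ?I u v" using cycle_edge_reach[of ?H C u v] C uv reach_mono by metis
      then have "v \<in> P" using uv(2)
        by (rule reach_closed) (use PQ(2) in \<open>auto simp: induced_def\<close>)
      then show False using uv PQ(2) by auto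
    qed
    moreover have "cycle_in E C" using C(1) HE by (auto simp: cycle_in_def)
    ultimately show ?thesis using C cycle_subset[OF C(1)] by blast
  qed
  have "f \<noteq> e" "g \<noteq> e" "f \<in> E" "g \<in> E" "e \<in> E" using PQ by auto
  then obtain C D where C: "cycle_in E C" "e \<in> C" "f \<in> C" and D: "cycle_in E D" "e \<in> D"
    "D \<subseteq> ?I \<union> {e, g}"
    using cyc[of f] cyc[of g] PQ(8,9) by metis
  have "f \<notin> ?I" using PQ(2,8) by (auto simp: crosses_def induced_def)
  then have "f \<notin> D" using D(3) PQ(5) by auto
  moreover have "C = D" using cac C D \<open>e \<in> E\<close> unfolding cactus_def by blast
  ultimately show False using C by blast
qed

text \<open>Branch sets of a \<open>K\<^sub>4 - e\<close> minor; \<open>A\<close> and \<open>B\<close> are its vertices of degree three.\<close>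

definition diamond :: "'a set set \<Rightarrow> 'a set \<Rightarrow> 'a set \<Rightarrow> 'a set \<Rightarrow> 'a set \<Rightarrow> 'a set \<Rightarrow> bool" where
  "diamond E V A B C D \<longleftrightarrow> conn_parts E V [A, B, C, D] \<and>
     joined E A B \<and> joined E A C \<and> joined E A D \<and> joined E B C \<and> joined E B D"

section \<open>From a large bond to a diamond\<close>

lemma diamond_swap_hubs: "diamond E V A B C D \<Longrightarrow> diamond E V B A C D"
  unfolding diamond_def conn_parts_def by (auto simp: joined_sym)

lemma diamond_swap_tips: "diamond E V A B C D \<Longrightarrow> diamond E V A B D C"
  unfolding diamond_def conn_parts_def by auto

text \<open>Splitting \<open>Q\<close> between \<open>q1\<close> and \<open>q3\<close> makes
  \<open>P1\<close>, \<open>Q1\<close>, \<open>Q3\<close> pairwise adjacent. \<open>P2\<close> is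
  adjacent to \<open>P1\<close> and to the half that contains \<open>q2\<close>, so
  \<open>P1\<close> and this half are the hubs.\<close>

lemma diamond_split:
  assumes P: "P1 \<union> P2 \<union> Q = V" "P1 \<inter> P2 = {}" "P1 \<inter> Q = {}" "P2 \<inter> Q = {}" "conn_set E P1"
    "conn_set E P2" "joined E P1 P2" "conn_set E Q"
    and e: "{p1, q1} \<in> E" "{p2, q2} \<in> E" "{p3, q3} \<in> E" "p1 \<in> P1" "p2 \<in> P2" "p3 \<in> P1"
      "q1 \<in> Q" "q2 \<in> Q" "q3 \<in> Q" "q1 \<noteq> q3"
  shows "\<exists>A B C D. diamond E V A B C D"
proof -
  obtain Q1 Q3 where Q: "Q1 \<union> Q3 = Q" "Q1 \<inter> Q3 = {}" "q1 \<in> Q1" "q3 \<in> Q3" "conn_set E Q1"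
    "conn_set E Q3" "joined E Q1 Q3"
    using conn_set_split_points[OF P(8) e(7,9,10)] .
  have j: "joined E P1 Q1" "joined E P1 Q3" using e Q by (auto intro: joinedI)
  have part: "conn_parts E V [P1, Q1, P2, Q3]" "conn_parts E V [P1, Q3, P2, Q1]"
    unfolding conn_parts_def using P Q by auto
  from e(8) Q(1) consider "q2 \<in> Q1" | "q2 \<in> Q3" by blast
  then show ?thesis
  proof cases
    case 1
    then have "joined E Q1 P2" using e by (intro joined_sym[OF joinedI]) auto
    then have "diamond E V P1 Q1 P2 Q3" using part j Q P by (simp add: diamond_def)
    then show ?thesis by blast
  next
    case 2
    then have "joined E Q3 P2" using e by (intro joined_sym[OF joinedI]) auto
    then have "diamond E V P1 Q3 P2 Q1" using part j Q P by (simp add: diamond_def joined_sym)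
    then show ?thesis by blast
  qed
qed

text \<open>If all three edges start at \<open>p\<close>, the side \<open>P\<close> remains whole as
  a hub and \<open>Q\<close> is split into three parts, one for each edge. As \<open>Q\<close> is
  connected, one of them is adjacent to the other two and is the second hub.\<close>

lemma diamond_fan:
  assumes P: "P \<union> Q = V" "P \<inter> Q = {}" "conn_set E P" "conn_set E Q"
    and e: "p \<in> P" "{p, q1} \<in> E" "{p, q2} \<in> E" "{p, q3} \<in> E" "q1 \<in> Q" "q2 \<in> Q" "q3 \<in> Q"
      "distinct [q1, q2, q3]"
  shows "\<exists>A B C D. diamond E V A B C D"
proof -
  have main: "\<exists>A B C D. diamond E V A B C D"
    if Q: "Q1 \<union> Q2 = Q" "Q1 \<inter> Q2 = {}" "conn_set E Q1" "conn_set E Q2" "joined E Q1 Q2"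
      and r: "{p, r1} \<in> E" "{p, r2} \<in> E" "{p, r3} \<in> E" "r1 \<in> Q1" "r3 \<in> Q1" "r1 \<noteq> r3" "r2 \<in> Q2"
    for Q1 Q2 r1 r2 r3
  proof -
    obtain R1 R3 where R: "R1 \<union> R3 = Q1" "R1 \<inter> R3 = {}" "r1 \<in> R1" "r3 \<in> R3" "conn_set E R1"
      "conn_set E R3" "joined E R1 R3"
      using conn_set_split_points[OF Q(3) r(4-6)] .
    have j: "joined E P R1" "joined E P R3" "joined E P Q2" using e(1) r R
      by (auto intro: joinedI)
    have part: "conn_parts E V [P, R1, Q2, R3]" "conn_parts E V [P, R3, Q2, R1]"
      unfolding conn_parts_def using P Q R by auto
    have "joined E R1 Q2 \<or> joined E R3 Q2" using Q(5) R(1) joined_Un(1) by metis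
    then have "diamond E V P R1 Q2 R3 \<or> diamond E V P R3 Q2 R1"
      using part j R(7) by (auto simp: diamond_def joined_sym)
    then show ?thesis by blast
  qed
  obtain Q1 Q2 where Q: "Q1 \<union> Q2 = Q" "Q1 \<inter> Q2 = {}" "q1 \<in> Q1" "q2 \<in> Q2" "conn_set E Q1"
    "conn_set E Q2" "joined E Q1 Q2"
    using conn_set_split_points[OF P(4) e(5,6)] e(8) by auto
  from e(7) Q(1) consider "q3 \<in> Q1" | "q3 \<in> Q2" by blast
  then show ?thesis
  proof cases
    case 1
    then show ?thesis using main[OF Q(1,2,5,6,7) e(2,3,4) Q(3) 1 _ Q(4)] e(8) by simp
  next
    case 2
    have "Q2 \<union> Q1 = Q" "Q2 \<inter> Q1 = {}" "joined E Q2 Q1" using Q joined_sym by auto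
    then show ?thesis using main[OF _ _ Q(6,5) _ e(3,2,4) Q(4) 2 _ Q(3)] e(8) by simp
  qed
qed

text \<open>Three edges with a common end form a fan. Otherwise each side has two different ends and
  can be split; the third edge then joins one of the halves, which leads to
  \<open>diamond_split\<close> up to the roles of the sides.\<close>

lemma big_bond_diamond:
  assumes sg: "simple_graph V E" and "big_bond E V"
  shows "\<exists>A B C D. diamond E V A B C D"
proof -
  obtain P Q e1 e2 e3 where PQ: "P \<union> Q = V" "P \<inter> Q = {}" "conn_set E P" "conn_set E Q"
    "distinct [e1, e2, e3]" "{e1, e2, e3} \<subseteq> E" "crosses P Q e1" "crosses P Q e2" "crosses P Q e3"
    using big_bondE[OF assms(2)] .
  obtain p1 q1 where e1: "e1 = {p1, q1}" "p1 \<in> P" "q1 \<in> Q" using PQ(7) by (auto simp: crosses_def)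
  obtain p2 q2 where e2: "e2 = {p2, q2}" "p2 \<in> P" "q2 \<in> Q" using PQ(8) by (auto simp: crosses_def)
  obtain p3 q3 where e3: "e3 = {p3, q3}" "p3 \<in> P" "q3 \<in> Q" using PQ(9) by (auto simp: crosses_def)
  have E: "{p1, q1} \<in> E" "{p2, q2} \<in> E" "{p3, q3} \<in> E" using PQ(6) e1 e2 e3 by auto
  have d: "p1 = p2 \<Longrightarrow> q1 \<noteq> q2" "p1 = p3 \<Longrightarrow> q1 \<noteq> q3" "p2 = p3 \<Longrightarrow> q2 \<noteq> q3"
    using PQ(5) e1 e2 e3 by auto
  have QP: "Q \<union> P = V" "Q \<inter> P = {}" using PQ by auto
  have main: "\<exists>A B C D. diamond E V A B C D"
    if S: "S1 \<union> S2 = P" "S1 \<inter> S2 = {}" "conn_set E S1" "conn_set E S2" "joined E S1 S2"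
      and r: "{r1, t1} \<in> E" "{r2, t2} \<in> E" "{r3, t3} \<in> E" "r1 \<in> S1" "r3 \<in> S1" "r2 \<in> S2"
        "t1 \<in> Q" "t2 \<in> Q" "t3 \<in> Q" "r1 = r3 \<Longrightarrow> t1 \<noteq> t3" "\<not> (t1 = t2 \<and> t1 = t3)"
    for S1 S2 r1 r2 r3 t1 t2 t3
  proof (cases "t1 = t3")
    case False
    show ?thesis
      by (rule diamond_split[of S1 S2 Q V E r1 t1 r2 t2 r3 t3]) (use PQ S r False in auto)
  next
    \<comment> \<open>The two edges from \<open>S1\<close> meet at \<open>t1\<close>, so their ends
      in \<open>P\<close> differ. The sides exchange roles: \<open>Q\<close> is split between
      \<open>t1\<close> and \<open>t2\<close>, and \<open>P\<close> between \<open>r1\<close> and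
      \<open>r3\<close>.\<close>
    case True
    then have n: "t1 \<noteq> t2" "r1 \<noteq> r3" using r by auto
    obtain T1 T2 where T: "T1 \<union> T2 = Q" "T1 \<inter> T2 = {}" "t1 \<in> T1" "t2 \<in> T2" "conn_set E T1"
      "conn_set E T2" "joined E T1 T2"
      using conn_set_split_points[OF PQ(4) r(7,8) n(1)] .
    show ?thesis
      by (rule diamond_split[of T1 T2 P V E t1 r1 t2 r2 t3 r3])
        (use PQ S r T n True in \<open>auto simp: insert_commute\<close>)
  qed
  show ?thesis
  proof (cases "q1 = q2 \<and> q1 = q3")
    case True
    have "distinct [p1, p2, p3]" using d True by auto
    moreover have "{q1, p1} \<in> E" "{q1, p2} \<in> E" "{q1, p3} \<in> E"
      using E True by (metis insert_commute)+
    ultimately show ?thesis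
      using diamond_fan[OF QP PQ(4,3) e1(3), of p1 p2 p3] e1(2) e2(2) e3(2) by blast
  next
    case nq: False
    show ?thesis
    proof (cases "p1 = p2 \<and> p1 = p3")
      case True
      then have "distinct [q1, q2, q3]" using d by auto
      moreover have "{p1, q1} \<in> E" "{p1, q2} \<in> E" "{p1, q3} \<in> E"
        using E True by metis+
      ultimately show ?thesis
        using diamond_fan[OF PQ(1,2,3,4) e1(2), of q1 q2 q3] e1(3) e2(3) e3(3) by blast
    next
      case False
      have sub: "\<exists>A B C D. diamond E V A B C D"
        if r: "r1 \<noteq> r2" "{r1, t1} \<in> E" "{r2, t2} \<in> E" "{r3, t3} \<in> E" "r1 \<in> P" "r2 \<in> P" "r3 \<in> P"
          "t1 \<in> Q" "t2 \<in> Q" "t3 \<in> Q" "r1 = r3 \<Longrightarrow> t1 \<noteq> t3" "r2 = r3 \<Longrightarrow> t2 \<noteq> t3" "\<not> (t1 = t2 \<and>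
            t1 = t3)"
        for r1 r2 r3 t1 t2 t3
      proof -
        obtain S1 S2 where S: "S1 \<union> S2 = P" "S1 \<inter> S2 = {}" "r1 \<in> S1" "r2 \<in> S2" "conn_set E S1"
          "conn_set E S2" "joined E S1 S2"
          using conn_set_split_points[OF PQ(3) r(5,6,1)] .
        from r(7) S(1) consider "r3 \<in> S1" | "r3 \<in> S2" by blast
        then show ?thesis
        proof cases
          case 1
          show ?thesis by (rule main[OF S(1,2,5,6,7) r(2,3,4) S(3) 1 S(4) r(8,9,10,11,13)])
        next
          case 2
          have "S2 \<union> S1 = P" "S2 \<inter> S1 = {}" "joined E S2 S1" "\<not> (t2 = t1 \<and> t2 = t3)"
            using S r(13) joined_sym by auto
          then show ?thesis using main[OF _ _ S(6,5) _ r(3,2,4) S(4) 2 S(3) r(9,8,10,12)] by blast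
        qed
      qed
      from False consider "p1 \<noteq> p2" | "p1 \<noteq> p3" by blast
      then show ?thesis
      proof cases
        case 1
        show ?thesis
          by (rule sub[of p1 p2 q1 q2 p3 q3]) (use 1 E e1 e2 e3 d nq in blast)+
      next
        case 2
        have "p3 = p2 \<Longrightarrow> q3 \<noteq> q2" "\<not> (q1 = q3 \<and> q1 = q2)" using d nq by auto
        then show ?thesis
          by (intro sub[of p1 p3 q1 q3 p2 q2]) (use 2 E e1 e2 e3 d in blast)+
      qed
    qed
  qed
qed

text \<open>Splitting the hub between two attachment vertices gives two adjacent halves, and
  \<open>B\<close>, \<open>C\<close>, \<open>D\<close> can be distributed so that one half takes
  exactly one of them. If that one is the other hub \<open>B\<close>, the result is
  \<open>K_{2,3}\<close>; if it is a tip, it is the 5-cycle with a chord.\<close>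

lemma hub_attached_once:
  assumes sg: "simple_graph V E" and dm: "diamond E V A B C D"
    and u: "{u, y} \<in> E" "{u', y'} \<in> E" "u \<in> A" "u' \<in> A" "y \<notin> A" "y' \<notin> A" "u \<noteq> u'"
  shows "saves_color V E"
proof -
  have Ps: "conn_parts E V [A, B, C, D]" and J: "joined E A B" "joined E A C" "joined E A D"
    "joined E B C" "joined E B D"
    using dm by (auto simp: diamond_def)
  have cA: "conn_set E A" using Ps by (simp add: conn_parts_def)
  obtain S T where S: "S \<union> T = A" "S \<inter> T = {}" "u \<in> S" "u' \<in> T" "conn_set E S" "conn_set E T"
    "joined E S T"
    using conn_set_split_points[OF cA u(3,4,7)] .
  have V: "V = A \<union> B \<union> C \<union> D" using Ps by (auto simp: conn_parts_def)
  have y: "y \<in> B \<union> C \<union> D" "y' \<in> B \<union> C \<union> D" using u simple_graph_edge(2)[OF sg] V by blast+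
  have S1: "joined E S B \<or> joined E S C \<or> joined E S D"
    using joinedI[OF u(1) S(3)] y by blast
  have T1: "joined E T B \<or> joined E T C \<or> joined E T D"
    using joinedI[OF u(2) S(4)] y by blast
  have ST: "joined E S B \<or> joined E T B" "joined E S C \<or> joined E T C" "joined E S D \<or>
    joined E T D"
    using J S(1) joined_Un(1) by metis+
  have patterns: "saves_color V E"
    if X: "X \<union> Y = A" "X \<inter> Y = {}" "conn_set E X" "conn_set E Y" "joined E X Y"
      and j: "joined E X B \<and> joined E Y C \<and> joined E Y D \<or> joined E X C \<and> joined E Y B \<and>
        joined E Y D
        \<or> joined E X D \<and> joined E Y B \<and> joined E Y C"
    for X Y
  proof -
    have parts: "conn_parts E V [Y, B, X, C, D]" "conn_parts E V [B, D, Y, X, C]"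
      "conn_parts E V [B, C, Y, X, D]"
      using Ps X unfolding conn_parts_def by auto
    note sm = J X(5) J[THEN joined_sym] X(5)[THEN joined_sym]
    from j consider "joined E X B" "joined E Y C" "joined E Y D"
      | "joined E X C" "joined E Y B" "joined E Y D" | "joined E X D" "joined E Y B"
        "joined E Y C" by blast
    then show ?thesis
    proof cases
      case 1
      show ?thesis by (rule saves_color_K23[OF sg parts(1)]) (use sm 1 joined_sym in blast)+
    next
      case 2
      show ?thesis by (rule saves_color_house[OF sg parts(2)]) (use sm 2 joined_sym in blast)+
    next
      case 3
      show ?thesis by (rule saves_color_house[OF sg parts(3)]) (use sm 3 joined_sym in blast)+
    qed
  qed
  have TS: "T \<union> S = A" "T \<inter> S = {}" "joined E T S" using S joined_sym by auto
  show ?thesis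
    using patterns[OF S(1,2,5,6,7)] patterns[OF TS(1,2) S(6,5) TS(3)] S1 T1 ST by blast
qed

text \<open>After the split, either the halves of \<open>C\<close> reach different hubs, or one half
  reaches both hubs and the other reaches the tip \<open>D\<close>. Both cases give a 5-cycle with a
  chord, the chord being \<open>A\<close>, \<open>B\<close> in the first and \<open>A\<close>,
  \<open>D\<close> in the second.\<close>

lemma tip_attached_once:
  assumes sg: "simple_graph V E" and dm: "diamond E V A B C D"
    and u: "{u, y} \<in> E" "{u', y'} \<in> E" "u \<in> C" "u' \<in> C" "y \<notin> C" "y' \<notin> C" "u \<noteq> u'"
  shows "saves_color V E"
proof -
  have Ps: "conn_parts E V [A, B, C, D]" and J: "joined E A B" "joined E A C" "joined E A D"
    "joined E B C" "joined E B D"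
    using dm by (auto simp: diamond_def)
  have cC: "conn_set E C" using Ps by (simp add: conn_parts_def)
  obtain S T where S: "S \<union> T = C" "S \<inter> T = {}" "u \<in> S" "u' \<in> T" "conn_set E S" "conn_set E T"
    "joined E S T"
    using conn_set_split_points[OF cC u(3,4,7)] .
  have V: "V = A \<union> B \<union> C \<union> D" using Ps by (auto simp: conn_parts_def)
  have y: "y \<in> A \<union> B \<union> D" "y' \<in> A \<union> B \<union> D" using u simple_graph_edge(2)[OF sg] V by blast+
  have S1: "joined E S A \<or> joined E S B \<or> joined E S D"
    using joinedI[OF u(1) S(3)] y by blast
  have T1: "joined E T A \<or> joined E T B \<or> joined E T D"
    using joinedI[OF u(2) S(4)] y by blast
  have ST: "joined E S A \<or> joined E T A" "joined E S B \<or> joined E T B"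
    using J S(1) joined_Un(2) joined_sym by metis+
  have patterns: "saves_color V E"
    if X: "X \<union> Y = C" "X \<inter> Y = {}" "conn_set E X" "conn_set E Y" "joined E X Y"
      and j: "joined E X A \<and> joined E Y B \<or> joined E X A \<and> joined E X B \<and> joined E Y D"
    for X Y
  proof -
    note sm = J X(5) J[THEN joined_sym] X(5)[THEN joined_sym]
    from j consider "joined E X A" "joined E Y B" | "joined E X A" "joined E X B" "joined E Y D"
      by blast
    then show ?thesis
    proof cases
      case 1
      have "conn_parts E V [A, D, B, Y, X]" using Ps X unfolding conn_parts_def by auto
      then show ?thesis by (rule saves_color_house[OF sg]) (use sm 1 joined_sym in blast)+
    next
      case 2
      have "conn_parts E V [A, B, D, Y, X]" using Ps X unfolding conn_parts_def by auto
      then show ?thesis by (rule saves_color_house[OF sg]) (use sm 2 joined_sym in blast)+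
    qed
  qed
  have TS: "T \<union> S = C" "T \<inter> S = {}" "joined E T S" using S joined_sym by auto
  show ?thesis
    using patterns[OF S(1,2,5,6,7)] patterns[OF TS(1,2) S(6,5) TS(3)] S1 T1 ST by blast
qed

section \<open>Parts that contain a cycle\<close>

lemma cycle_in_mono: "cycle_in E C \<Longrightarrow> E \<subseteq> E' \<Longrightarrow> cycle_in E' C"
  unfolding cycle_in_def by blast

lemma nontree_triangle:
  assumes "simple_graph V E" "X \<subseteq> V" "conn_set E X" "card X \<le> card (induced E X)"
  obtains P Q R where "P \<union> Q \<union> R = X" "P \<inter> Q = {}" "P \<inter> R = {}" "Q \<inter> R = {}"
    "conn_set E P" "conn_set E Q" "conn_set E R" "joined E P Q" "joined E P R" "joined E Q R"
proof -
  obtain P Q R where P: "P \<union> Q \<union> R = X" "P \<inter> Q = {}" "P \<inter> R = {}" "Q \<inter> R = {}"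
    "conn_set (induced E X) P" "conn_set (induced E X) Q" "conn_set (induced E X) R"
    "joined (induced E X) P Q" "joined (induced E X) P R" "joined (induced E X) Q R"
    using triangle_split[OF simple_graph_induced[OF assms(1,2)]] assms(3,4)
      conn_set_connected_graph by metis
  show ?thesis
    using P(1-4) P(5-7)[THEN conn_set_mono, OF induced_subset]
      P(8-10)[THEN joined_mono, OF order_refl order_refl induced_subset] by (rule that)
qed

text \<open>\<open>mark\<close> stands for a property inherited by one of the three parts, such as
  containing the root or being joined to the outside. By symmetry that part may come first.\<close>

lemma nontree_triangle_marked:
  assumes "simple_graph V E" "X \<subseteq> V" "conn_set E X" "card X \<le> card (induced E X)"
    and mark: "\<And>P Q R. P \<union> Q \<union> R = X \<Longrightarrow> mark P \<or> mark Q \<or> mark R"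
  obtains P Q R where "P \<union> Q \<union> R = X" "P \<inter> Q = {}" "P \<inter> R = {}" "Q \<inter> R = {}"
    "conn_set E P" "conn_set E Q" "conn_set E R" "joined E P Q" "joined E P R" "joined E Q R"
      "mark P"
proof -
  obtain P Q R where P: "P \<union> Q \<union> R = X" "P \<inter> Q = {}" "P \<inter> R = {}" "Q \<inter> R = {}"
    "conn_set E P" "conn_set E Q" "conn_set E R" "joined E P Q" "joined E P R" "joined E Q R"
    using nontree_triangle[OF assms(1-4)] .
  from mark[OF P(1)] consider "mark P" | "mark Q" | "mark R" by blast
  then show ?thesis
  proof cases
    case 1
    show ?thesis by (rule that[OF P 1])
  next
    case 2
    show ?thesis
      by (rule that[of Q P R]) (use P 2 joined_sym in \<open>auto simp: Int_commute\<close>)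
  next
    case 3
    show ?thesis
      by (rule that[of R P Q]) (use P 3 joined_sym in \<open>auto simp: Int_commute\<close>)
  qed
qed

text \<open>Spanning trees of the three parts have \<open>card V - 3\<close> edges in all, and one
  edge for each pair of parts supplies the missing three.\<close>

lemma card_edges_triangle:
  assumes sg: "simple_graph V E" and P: "conn_parts E V [P, Q, R]"
    and J: "joined E P Q" "joined E P R" "joined E Q R"
  shows "card V \<le> card E"
proof -
  have PV: "disj_list [P, Q, R]" "\<Union>(set [P, Q, R]) = V" "\<forall>X\<in>set [P, Q, R]. conn_set E X"
    using P[unfolded conn_parts_def, THEN conjunct1] P[unfolded conn_parts_def, THEN conjunct2]
      by simp_all
  then have "\<forall>X\<in>set [P, Q, R]. conn_set E X \<and> X \<subseteq> V" by (metis Union_upper)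
  note PV = PV(1,2) this
  obtain F where F: "F \<subseteq> E" "card F + length [P, Q, R] = card V" "\<forall>e\<in>F. \<exists>X\<in>set [P, Q, R]. e \<subseteq> X"
    using spanning_forest[OF sg PV(1,3)] unfolding PV(2) by blast
  obtain e f g where e: "e \<in> E" "f \<in> E" "g \<in> E" "crosses P Q e" "crosses P R f" "crosses Q R g"
    using J unfolding joined_crosses by blast
  have d: "P \<inter> Q = {}" "P \<inter> R = {}" "Q \<inter> R = {}" using P by (auto simp: conn_parts_def)
  have "e \<noteq> f" "e \<noteq> g" "f \<noteq> g" using e d by (auto simp: crosses_def doubleton_eq_iff)
  moreover have "h \<notin> F" if "crosses A B h" "A \<in> set [P, Q, R]" "B \<in> set [P, Q, R]"
    "A \<inter> B = {}" for A B h
  proof -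
    have "A \<noteq> B" using that by (auto simp: crosses_def)
    then show ?thesis using F(3) crossing_not_sub[OF PV(1) that(2,3) _ that(1)] by blast
  qed
  then have "e \<notin> F" "f \<notin> F" "g \<notin> F" using e(4-6) d by simp_all
  moreover have "finite F" using F(1) sg simple_graph_finite finite_subset by metis
  ultimately have "card (insert e (insert f (insert g F))) = card V" using F(2) by simp
  moreover have "insert e (insert f (insert g F)) \<subseteq> E" using e F by auto
  ultimately show ?thesis using card_mono simple_graph_finite(2)[OF sg] by metis
qed

text \<open>Used when parts are regrouped: a union of three mutually adjacent parts counts as a part
  with a cycle.\<close>

lemma nontree_Un:
  assumes sg: "simple_graph V E" and P: "conn_set E P" "conn_set E Q" "conn_set E R"
    "P \<union> Q \<union> R \<subseteq> V"
    "P \<inter> Q = {}" "P \<inter> R = {}" "Q \<inter> R = {}"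
    and J: "joined E P Q" "joined E P R" "joined E Q R"
  shows "card (P \<union> Q \<union> R) \<le> card (induced E (P \<union> Q \<union> R))"
proof (rule card_edges_triangle[OF simple_graph_induced[OF sg P(4)]])
  let ?X = "P \<union> Q \<union> R"
  have "conn_set (induced E ?X) P" "conn_set (induced E ?X) Q" "conn_set (induced E ?X) R"
    using P by (subst conn_set_induced; auto)+
  then show "conn_parts (induced E ?X) ?X [P, Q, R]" using P by (auto simp: conn_parts_def)
  show "joined (induced E ?X) P Q" "joined (induced E ?X) P R" "joined (induced E ?X) Q R"
    using J by (auto simp: joined_def induced_def)
qed

subsection \<open>Graphs with a large bond\<close>

text \<open>A part with a cycle splits into a triangle. All edges to the outside end in one vertex
  \<open>x\<close>, so the piece with \<open>x\<close> takes over its role in the diamond and the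
  other two pieces form a triangle with it. The remaining two parts follow by exchanging hubs or
  tips.\<close>

lemma diamond_part_tree:
  assumes sg: "simple_graph V E" and dm: "diamond E V A B C D"
    and F: "\<And>x y. {x, y} \<in> E \<Longrightarrow> x \<in> A \<Longrightarrow> y \<notin> A \<Longrightarrow> x = a"
      "\<And>x y. {x, y} \<in> E \<Longrightarrow> x \<in> C \<Longrightarrow> y \<notin> C \<Longrightarrow> x = c"
    and X: "X = A \<or> X = C" and ng: "\<not> saves_color V E"
  shows "tree_graph X (induced E X)"
proof (rule ccontr)
  assume nt: "\<not> ?thesis"
  have Ps: "conn_parts E V [A, B, C, D]" and J: "joined E A B" "joined E A C" "joined E A D"
    "joined E B C" "joined E B D"
    using dm by (auto simp: diamond_def)
  have XV: "X \<subseteq> V" "conn_set E X" using X Ps by (auto simp: conn_parts_def)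
  have sX: "simple_graph X (induced E X)" using sg XV(1) by (rule simple_graph_induced)
  have cX: "connected_graph X (induced E X)" using XV(2) by (simp add: conn_set_connected_graph)
  have "card X \<le> card (induced E X) + 1"
    by (rule card_edges_ge) (use cX sX simple_graph_finite in \<open>auto simp: connected_graph_reach\<close>)
  then have cd: "card X \<le> card (induced E X)" using nt tree_graph_iff_card[OF sX cX] by simp
  obtain x where x: "\<And>u y. {u, y} \<in> E \<Longrightarrow> u \<in> X \<Longrightarrow> y \<notin> X \<Longrightarrow> u = x"
    using X F by blast
  have "joined E X B" "B \<inter> X = {}" using X J joined_sym Ps by (auto simp: conn_parts_def)
  then have xX: "x \<in> X" using x by (auto simp: joined_def)
  obtain P Q R where P: "P \<union> Q \<union> R = X" "P \<inter> Q = {}" "P \<inter> R = {}" "Q \<inter> R = {}"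
    "conn_set E P" "conn_set E Q" "conn_set E R" "joined E P Q" "joined E P R" "joined E Q R"
      "x \<in> P"
    using nontree_triangle_marked[OF sg XV cd, of "\<lambda>Y. x \<in> Y"] xX by blast
  have jP: "joined E P Y" if jX: "joined E X Y" and XY: "X \<inter> Y = {}" for Y
  proof -
    obtain u v where uv: "u \<in> X" "v \<in> Y" "{u, v} \<in> E" using jX by (auto simp: joined_def)
    then have "u = x" using x XY by blast
    then show ?thesis using uv P(11) by (auto intro: joinedI)
  qed
  show False
  proof (cases "X = A")
    case True
    have "conn_parts E V [P, B, C, D, Q, R]" using Ps P True unfolding conn_parts_def by auto
    moreover have "A \<inter> B = {}" "A \<inter> C = {}" "A \<inter> D = {}" using Ps
      by (simp_all add: conn_parts_def)
    then have "joined E P B" "joined E P C" "joined E P D" using jP J True by blast+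
    ultimately show False using saves_color_diamond_triangle_hub[OF sg, of P B C D Q R] J P ng
      by blast
  next
    case False
    then have XC: "X = C" using X by simp
    have "conn_parts E V [P, A, B, D, Q, R]" using Ps P XC unfolding conn_parts_def by auto
    moreover have "C \<inter> A = {}" "C \<inter> B = {}" using Ps by (auto simp: conn_parts_def)
    then have "joined E P A" "joined E P B" using jP J[THEN joined_sym] XC by blast+
    ultimately show False
      using saves_color_diamond_triangle_tip[OF sg, of P A B D Q R] J P ng joined_sym by blast
  qed
qed

text \<open>Two branches are split off at the first branching seen from the root. If
  \<open>r\<close> has only one branch, acyclicity makes \<open>w\<close> its only neighbour, the
  induction continues at \<open>w\<close>, and \<open>r\<close> joins the part of
  \<open>w\<close>.\<close>

lemma tree_not_path_split:
  assumes "simple_graph V E" "X \<subseteq> V" "conn_set E X" "r \<in> X" "tree_graph X (induced E X)"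
    "\<not> path_graph_from r X (induced E X)"
  shows "\<exists>P Q R. P \<union> Q \<union> R = X \<and> P \<inter> Q = {} \<and> P \<inter> R = {} \<and> Q \<inter> R = {} \<and>
    conn_set E P \<and> conn_set E Q \<and> conn_set E R \<and> joined E P Q \<and> joined E P R \<and> r \<in> P"
  using assms(2-6)
proof (induction "card X" arbitrary: X r rule: less_induct)
  case less
  have finX: "finite X" using less.prems(1) assms(1) simple_graph_finite finite_subset by metis
  have noloop: "u \<noteq> v" if "{u, v} \<in> E" for u v using simple_graph_edge(3)[OF assms(1) that] .
  show ?case
  proof (cases "X = {r}")
    case True
    have "e \<notin> induced E {r}" for e
    proof
      assume "e \<in> induced E {r}"
      then have e: "e \<in> E" "e \<subseteq> {r}" by (auto simp: induced_def)
      obtain x y where "e = {x, y}" "x \<noteq> y" using simple_graph_edgeE[OF assms(1) e(1)] .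
      then show False using e(2) by auto
    qed
    then have "induced E {r} = {}" by blast
    then have "path_graph_from r X (induced E X)"
      using True by (auto simp: path_graph_from_def intro!: exI[of _ "[r]"])
    then show ?thesis using less.prems by simp
  next
    case False
    have "{r} \<union> (X - {r}) = X" using less.prems by auto
    then have "joined E {r} (X - {r})"
      using conn_set_joined[of E "{r}" "X - {r}"] less.prems False by auto
    then obtain w where w: "w \<in> X" "w \<noteq> r" "{r, w} \<in> E" by (auto simp: joined_def)
    define P where "P = {z. reach (induced E (X - {r})) w z}"
    have "w \<in> X - {r}" using w by auto
    note P = conn_set_cls_induced[OF this, of E, folded P_def]
    have wP: "w \<in> P" by (simp add: P_def)
    show ?thesis
    proof (cases "P = X - {r}")
      case True
      have XP: "X = insert r P" "r \<notin> P" using True less.prems by auto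
      have uniq: "z = w" if z: "{r, z} \<in> E" "z \<in> P" for z
      proof (rule ccontr)
        assume zw: "z \<noteq> w"
        let ?I = "induced E X"
        have "reach (induced E P) z w" using P(1) z wP by (auto simp: conn_set_def)
        moreover have "induced E P \<subseteq> ?I - {{r, w}}" using XP by (auto simp: induced_def)
        ultimately have "reach (?I - {{r, w}}) z w" by (rule reach_mono)
        moreover have "reach (?I - {{r, w}}) r z"
          using z zw XP by (intro reach_edge) (auto simp: induced_def doubleton_eq_iff)
        ultimately have "reach (?I - {{r, w}}) r w" by (meson reach_trans)
        moreover have "{r, w} \<in> ?I" using w less.prems by (auto simp: induced_def)
        ultimately obtain C where "cycle_in ?I C" using nonbridge_cycle w(2) by metis
        then show False using less.prems(4) by (auto simp: tree_graph_def)
      qed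
      have IX: "induced E X = insert {r, w} (induced E P)"
      proof
        show "induced E X \<subseteq> insert {r, w} (induced E P)"
        proof
          fix e assume "e \<in> induced E X"
          then have e: "e \<in> E" "e \<subseteq> X" by (auto simp: induced_def)
          obtain a b where ab: "e = {a, b}" using simple_graph_edgeE[OF assms(1) e(1)] by metis
          show "e \<in> insert {r, w} (induced E P)"
          proof (cases "r \<in> e")
            case True
            then obtain z where z: "e = {r, z}" using ab by blast
            then have "z \<in> P" using e XP noloop[of r z] by auto
            then show ?thesis using uniq z e by blast
          qed (use e XP in \<open>auto simp: induced_def\<close>)
        qed
        show "insert {r, w} (induced E P) \<subseteq> induced E X" using w XP wP by (auto simp: induced_def)
      qed
      have cP: "card P < card X" using finX XP by (intro psubset_card_mono) auto
      have PV: "P \<subseteq> V" using less.prems(1) XP by auto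
      have tP: "tree_graph P (induced E P)"
      proof -
        have "\<nexists>C. cycle_in (induced E P) C"
          using less.prems(4) IX cycle_in_mono[of "induced E P" _ "induced E X"]
          unfolding tree_graph_def by blast
        then show ?thesis
          using P(1) simple_graph_induced[OF assms(1) PV]
            by (simp add: tree_graph_def conn_set_connected_graph)
      qed
      have "\<not> path_graph_from w P (induced E P)"
      proof
        assume "path_graph_from w P (induced E P)"
        then obtain xs where xs: "xs \<noteq> []" "distinct xs" "hd xs = w" "P = set xs"
          "induced E P = path_edges xs"
          by (auto simp: path_graph_from_def)
        then have "path_edges (r # xs) = induced E X" using IX by (cases xs) auto
        then have "path_graph_from r X (induced E X)"
          using xs XP by (auto simp: path_graph_from_def intro!: exI[of _ "r # xs"])
        then show False using less.prems by simp
      qed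
      then obtain A B C where A: "A \<union> B \<union> C = P" "A \<inter> B = {}" "A \<inter> C = {}" "B \<inter> C = {}"
        "conn_set E A" "conn_set E B" "conn_set E C" "joined E A B" "joined E A C" "w \<in> A"
        using less.hyps[OF cP PV P(1) wP tP] by blast
      have "conn_set E ({r} \<union> A)"
        using conn_set_Un[OF conn_set_singleton A(5)] w(3) A(10) by (auto simp: joined_def)
      moreover have "joined E ({r} \<union> A) B" "joined E ({r} \<union> A) C" using A(8,9) joined_Un(1)
        by metis+
      moreover have "({r} \<union> A) \<union> B \<union> C = X" "({r} \<union> A) \<inter> B = {}" "({r} \<union> A) \<inter> C = {}"
        using A XP by auto
      ultimately show ?thesis using A by blast
    next
      \<comment> \<open>A second branch at \<open>r\<close>: the component \<open>P\<close> is one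
        part, and what is left is split between \<open>r\<close> and a vertex \<open>z\<close> of
        another branch.\<close>
      case False
      then obtain z where z: "z \<in> X" "z \<noteq> r" "z \<notin> P" using P(2) by auto
      have rP: "P \<inter> {r} = {}" "P \<subseteq> X" "{r} \<subseteq> X" using P(2) less.prems by auto
      obtain S T where S: "S \<union> T = X" "S \<inter> T = {}" "P \<subseteq> S" "{r} \<subseteq> T" "conn_set E S" "conn_set E T"
        using conn_set_split[OF less.prems(2) P(1) rP(2) conn_set_singleton rP(3) rP(1)] by metis
      have "S \<subseteq> P"
      proof
        fix x assume "x \<in> S"
        then have "reach (induced E S) w x" using S wP by (auto simp: conn_set_def)
        moreover have "induced E S \<subseteq> induced E (X - {r})" using S by (intro induced_mono) auto
        ultimately show "x \<in> P" unfolding P_def by (auto intro: reach_mono)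
      qed
      then have rz: "r \<in> T" "z \<in> T" "r \<noteq> z" using S z by auto
      obtain A B where A: "A \<union> B = T" "A \<inter> B = {}" "r \<in> A" "z \<in> B" "conn_set E A" "conn_set E B"
        "joined E A B"
        using conn_set_split_points[OF S(6) rz] .
      have "joined E A S" using w(3) A(3) S(3) wP by (auto intro: joinedI)
      moreover have "A \<union> B \<union> S = X" "A \<inter> S = {}" "B \<inter> S = {}" using A S by auto
      ultimately show ?thesis using A S by blast
    qed
  qed
qed

text \<open>An edge between two parts ends at the root of each, hence it is a pair from
  \<open>W\<close>; every other edge lies inside one part.\<close>

lemma attachmentI:
  assumes sg: "simple_graph V E" and part: "(\<Union>w\<in>W. A w) = V" "disjoint_family_on A W" "\<And>w. w \<in> W \<Longrightarrow>
    w \<in> A w"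
    and root: "\<And>x y w. {x, y} \<in> E \<Longrightarrow> w \<in> W \<Longrightarrow> x \<in> A w \<Longrightarrow> y \<notin> A w \<Longrightarrow> x = w"
  shows "attachment W (E \<inter> all_pairs W) A (\<lambda>w. induced E (A w)) V E"
proof -
  have "e \<in> E \<inter> all_pairs W \<or> (\<exists>w\<in>W. e \<in> induced E (A w))" if e: "e \<in> E" for e
  proof -
    obtain x y where xy: "e = {x, y}" "x \<in> V" "y \<in> V" "x \<noteq> y" using simple_graph_edgeE[OF sg e] .
    obtain w w' where w: "w \<in> W" "x \<in> A w" "w' \<in> W" "y \<in> A w'" using xy part(1) by blast
    show ?thesis
    proof (cases "y \<in> A w")
      case True
      then show ?thesis using e xy w by (auto simp: induced_def)
    next
      case False
      then have xw: "x = w" using root[of x y w] e xy w by simp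
      have "w \<noteq> w'" using w False by auto
      then have "x \<notin> A w'"
        using part(2) w unfolding disjoint_family_on_def by blast
      then have "y = w'" using root[of y x w'] e xy w by (simp add: insert_commute)
      then show ?thesis using e xy w xw by (auto simp: all_pairs_def)
    qed
  qed
  then have "E = E \<inter> all_pairs W \<union> (\<Union>w\<in>W. induced E (A w))" using induced_subset by blast
  then show ?thesis using part by (simp add: attachment_def)
qed

text \<open>As each part of the diamond is attached at a single vertex, adjacent parts have adjacent
  roots, so the roots span K4 or K4 - e.\<close>

lemma big_bond_classes:
  assumes sg: "simple_graph V E" and bb: "big_bond E V" and ng: "\<not> saves_color V E"
  shows "(V, E) \<in> K4_with_paths \<union> K4_minus_edge_with_trees"
proof -
  obtain A B C D where dm: "diamond E V A B C D" using big_bond_diamond[OF sg bb] by blast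
  have Ps: "conn_parts E V [A, B, C, D]" and J: "joined E A B" "joined E A C" "joined E A D"
    "joined E B C" "joined E B D"
    using dm by (auto simp: diamond_def)
  have V: "V = A \<union> B \<union> C \<union> D" using Ps by (auto simp: conn_parts_def)
  have dj: "A \<inter> B = {}" "A \<inter> C = {}" "A \<inter> D = {}" "B \<inter> C = {}" "B \<inter> D = {}" "C \<inter> D = {}"
    using Ps by (auto simp: conn_parts_def)
  note dmB = diamond_swap_hubs[OF dm] and dmD = diamond_swap_tips[OF dm]
  define once where "once X \<longleftrightarrow> (\<forall>u y u' y'. {u, y} \<in> E \<and> {u', y'} \<in> E \<and> u \<in> X \<and> u' \<in> X \<and>
    y \<notin> X \<and> y' \<notin> X \<and> u \<noteq> u' \<longrightarrow> saves_color V E)" for X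
  have onceA: "once A" unfolding once_def using hub_attached_once[OF sg dm] by blast
  have onceB: "once B" unfolding once_def using hub_attached_once[OF sg dmB] by blast
  have onceC: "once C" unfolding once_def using tip_attached_once[OF sg dm] by blast
  have onceD: "once D" unfolding once_def using tip_attached_once[OF sg dmD] by blast
  have root: "\<exists>x\<in>X. \<forall>u y. {u, y} \<in> E \<longrightarrow> u \<in> X \<longrightarrow> y \<notin> X \<longrightarrow> u = x"
    if once: "once X"
      and j: "joined E X Y" "X \<inter> Y = {}" for X Y
  proof -
    obtain x y where xy: "{x, y} \<in> E" "x \<in> X" "y \<in> Y" using j(1) by (auto simp: joined_def)
    then have "y \<notin> X" using j(2) by blast
    then have "u = x" if "{u, z} \<in> E" "u \<in> X" "z \<notin> X" for u z
      using once that xy ng unfolding once_def by blast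
    then show ?thesis using xy(2) by blast
  qed
  obtain a where a: "a \<in> A" "\<And>u y. {u, y} \<in> E \<Longrightarrow> u \<in> A \<Longrightarrow> y \<notin> A \<Longrightarrow> u = a"
    using root[OF onceA J(1) dj(1)] by blast
  obtain b where b: "b \<in> B" "\<And>u y. {u, y} \<in> E \<Longrightarrow> u \<in> B \<Longrightarrow> y \<notin> B \<Longrightarrow> u = b"
    using root[OF onceB J(4) dj(4)] by blast
  obtain c where c: "c \<in> C" "\<And>u y. {u, y} \<in> E \<Longrightarrow> u \<in> C \<Longrightarrow> y \<notin> C \<Longrightarrow> u = c"
    using root[OF onceC J(2)[THEN joined_sym]] dj(2) by blast
  obtain d where d: "d \<in> D" "\<And>u y. {u, y} \<in> E \<Longrightarrow> u \<in> D \<Longrightarrow> y \<notin> D \<Longrightarrow> u = d"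
    using root[OF onceD J(3)[THEN joined_sym]] dj(3) by blast
  have ne: "a \<noteq> b" "a \<noteq> c" "a \<noteq> d" "b \<noteq> c" "b \<noteq> d" "c \<noteq> d" using dj a(1) b(1) c(1) d(1) by auto
  have rooted: "{x, y} \<in> E"
    if jj: "joined E X Y" "X \<inter> Y = {}" and r: "\<And>u y. {u, y} \<in> E \<Longrightarrow> u \<in> X \<Longrightarrow> y \<notin> X \<Longrightarrow> u = x"
      "\<And>u z. {u, z} \<in> E \<Longrightarrow> u \<in> Y \<Longrightarrow> z \<notin> Y \<Longrightarrow> u = y" for X Y x y
  proof -
    obtain u v where uv: "u \<in> X" "v \<in> Y" "{u, v} \<in> E" using jj(1) by (auto simp: joined_def)
    then have "u = x" using r(1)[of u v] jj(2) by blast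
    moreover have "{v, u} \<in> E" "u \<notin> Y" using uv jj(2) by (auto simp: insert_commute)
    then have "v = y" using r(2)[of v u] uv by blast
    ultimately show ?thesis using uv by simp
  qed
  have ed: "{a, b} \<in> E" "{a, c} \<in> E" "{a, d} \<in> E" "{b, c} \<in> E" "{b, d} \<in> E"
    using rooted[OF J(1) dj(1) a(2) b(2)] rooted[OF J(2) dj(2) a(2) c(2)] rooted[OF J(3) dj(3)
      a(2) d(2)]
      rooted[OF J(4) dj(4) b(2) c(2)] rooted[OF J(5) dj(5) b(2) d(2)] by simp_all
  have "tree_graph A (induced E A)"
    by (rule diamond_part_tree[OF sg dm, of a c A]) (use a(2) c(2) ng in blast)+
  moreover have "tree_graph C (induced E C)"
    by (rule diamond_part_tree[OF sg dm, of a c C]) (use a(2) c(2) ng in blast)+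
  moreover have "tree_graph B (induced E B)"
    by (rule diamond_part_tree[OF sg dmB, of b c B]) (use b(2) c(2) ng in blast)+
  moreover have "tree_graph D (induced E D)"
    by (rule diamond_part_tree[OF sg dmD, of a d D]) (use a(2) d(2) ng in blast)+
  ultimately have tree: "tree_graph A (induced E A)" "tree_graph B (induced E B)"
    "tree_graph C (induced E C)" "tree_graph D (induced E D)"
    by simp_all
  define W where "W = {a, b, c, d}"
  define f where "f w = (if w = a then A else if w = b then B else if w = c then C else D)" for w
  have f: "f a = A" "f b = B" "f c = C" "f d = D" using ne by (auto simp: f_def)
  have card: "card W = 4" using ne by (simp add: W_def)
  have att: "attachment W (E \<inter> all_pairs W) f (\<lambda>w. induced E (f w)) V E"
  proof (rule attachmentI[OF sg])
    show "(\<Union>w\<in>W. f w) = V" using f V by (auto simp: W_def)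
    show "disjoint_family_on f W" using f dj by (auto simp: W_def disjoint_family_on_def)
    show "w \<in> f w" if "w \<in> W" for w using that f a(1) b(1) c(1) d(1) by (auto simp: W_def)
    show "x = w" if "{x, y} \<in> E" "w \<in> W" "x \<in> f w" "y \<notin> f w" for x y w
      using that f a(2)[of x y] b(2)[of x y] c(2)[of x y] d(2)[of x y] by (auto simp: W_def)
  qed
  have treeW: "tree_graph (f w) (induced E (f w))" if "w \<in> W" for w
    using that f tree by (auto simp: W_def)
  have all: "e \<in> {{a, b}, {a, c}, {a, d}, {b, c}, {b, d}, {c, d}}" if e: "e \<in> all_pairs W" for e
  proof -
    have "card e = 2" "e \<subseteq> W" using e by (auto simp: all_pairs_def)
    then obtain x y where "e = {x, y}" "x \<noteq> y" "x \<in> W" "y \<in> W" by (auto simp: card_2_iff)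
    then show ?thesis unfolding W_def by (auto simp: insert_commute)
  qed
  have cdW: "{c, d} \<in> all_pairs W" using ne by (simp add: all_pairs_def W_def)
  \<comment> \<open>A diamond says nothing about the pair of tips. With \<open>{c, d}\<close>
    present the four parts become interchangeable, and a part that is not a path from its root would
    yield K4 with two leaves at one vertex.\<close>
  show ?thesis
  proof (cases "{c, d} \<in> E")
    case False
    have "E \<inter> all_pairs W = all_pairs W - {{c, d}}"
      using all ed False by blast
    then have "attachment W (all_pairs W - {{c, d}}) f (\<lambda>w. induced E (f w)) V E" using att
      by simp
    then have "(V, E) \<in> K4_minus_edge_with_trees"
      unfolding K4_minus_edge_with_trees_def mem_Collect_eq case_prod_conv using card cdW treeW
      by (intro exI[of _ W] exI[of _ "{c, d}"] exI[of _ f] exI[of _ "\<lambda>w. induced E (f w)"]) blast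
    then show ?thesis ..
  next
    case True
    have "E \<inter> all_pairs W = all_pairs W" using all ed True by blast
    then have att': "attachment W (all_pairs W) f (\<lambda>w. induced E (f w)) V E" using att by simp
    have leaves: "path_graph_from w X (induced E X)"
      if parts: "conn_parts E V [X, Y, Z, U]" and w: "w \<in> X" "tree_graph X (induced E X)"
        and r: "\<And>u y. {u, y} \<in> E \<Longrightarrow> u \<in> X \<Longrightarrow> y \<notin> X \<Longrightarrow> u = w"
        and j: "joined E X Y" "joined E X Z" "joined E X U" "joined E Y Z" "joined E Y U"
          "joined E Z U"
      for w X Y Z U
    proof (rule ccontr)
      assume np: "\<not> ?thesis"
      have X: "X \<subseteq> V" "conn_set E X" using parts by (auto simp: conn_parts_def)
      obtain P Q R where P: "P \<union> Q \<union> R = X" "P \<inter> Q = {}" "P \<inter> R = {}" "Q \<inter> R = {}"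
        "conn_set E P" "conn_set E Q" "conn_set E R" "joined E P Q" "joined E P R" "w \<in> P"
        using tree_not_path_split[OF sg X w np] by blast
      have jP: "joined E P T" if "joined E X T" "X \<inter> T = {}" for T
      proof -
        obtain u v where uv: "u \<in> X" "v \<in> T" "{u, v} \<in> E" using \<open>joined E X T\<close>
          by (auto simp: joined_def)
        then have "u = w" using r[of u v] that(2) by blast
        then show ?thesis using uv P(10) by (auto intro: joinedI)
      qed
      have "X \<inter> Y = {}" "X \<inter> Z = {}" "X \<inter> U = {}" using parts by (simp_all add: conn_parts_def)
      then have "joined E P Y" "joined E P Z" "joined E P U" using jP j by blast+
      moreover have "conn_parts E V [P, Y, Z, U, Q, R]" using parts P unfolding conn_parts_def
        by auto
      ultimately show False using saves_color_K4_two_leaves[OF sg, of P Y Z U Q R] j P ng by blast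
    qed
    have J6: "joined E C D" using True c(1) d(1) by (auto intro: joinedI)
    have perm: "conn_parts E V [B, A, C, D]" "conn_parts E V [C, A, B, D]"
      "conn_parts E V [D, A, B, C]"
      using Ps unfolding conn_parts_def by auto
    note J' = J J6 J[THEN joined_sym] J6[THEN joined_sym]
    have "path_graph_from a A (induced E A)"
      by (rule leaves[OF Ps a(1) tree(1)]) (use a(2) J' in blast)+
    moreover have "path_graph_from b B (induced E B)"
      by (rule leaves[OF perm(1) b(1) tree(2)]) (use b(2) J' in blast)+
    moreover have "path_graph_from c C (induced E C)"
      by (rule leaves[OF perm(2) c(1) tree(3)]) (use c(2) J' in blast)+
    moreover have "path_graph_from d D (induced E D)"
      by (rule leaves[OF perm(3) d(1) tree(4)]) (use d(2) J' in blast)+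
    ultimately have "\<forall>w\<in>W. path_graph_from w (f w) (induced E (f w))"
      using f by (simp add: W_def)
    then have "(V, E) \<in> K4_with_paths"
      unfolding K4_with_paths_def mem_Collect_eq case_prod_conv using card att'
      by (intro exI[of _ W] exI[of _ f] exI[of _ "\<lambda>w. induced E (f w)"]) blast
    then show ?thesis ..
  qed
qed

subsection \<open>Graphs without a large bond\<close>

text \<open>These parts form a diamond with hubs \<open>O'\<close> and \<open>P\<close>. The cut
  around \<open>P\<close> has an edge to each of the others, and those are connected through
  \<open>O'\<close>.\<close>

lemma big_bond_triangle:
  assumes P: "conn_parts E V [O', P, Q, R]"
    and J: "joined E O' P" "joined E O' Q" "joined E P Q" "joined E O' R" "joined E P R"
  shows "big_bond E V"
proof -
  have d: "O' \<inter> P = {}" "O' \<inter> Q = {}" "O' \<inter> R = {}" "P \<inter> Q = {}" "P \<inter> R = {}" "Q \<inter> R = {}"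
    using P by (simp_all add: conn_parts_def)
  have c: "conn_set E O'" "conn_set E P" "conn_set E Q" "conn_set E R" using P
    by (simp_all add: conn_parts_def)
  obtain e f g where e: "e \<in> E" "f \<in> E" "g \<in> E" "crosses P O' e" "crosses P Q f" "crosses P R g"
    using J joined_sym unfolding joined_crosses by (metis crosses_sym)
  have "conn_set E (O' \<union> Q \<union> R)" using J c conn_set_Un joined_Un(1) by metis
  moreover have "P \<union> (O' \<union> Q \<union> R) = V" "P \<inter> (O' \<union> Q \<union> R) = {}" using P d
    by (auto simp: conn_parts_def)
  moreover have "e \<noteq> f" "e \<noteq> g" "f \<noteq> g" using e d by (auto simp: crosses_def doubleton_eq_iff)
  moreover have "crosses P (O' \<union> Q \<union> R) e" "crosses P (O' \<union> Q \<union> R) f" "crosses P (O' \<union> Q \<union> R) g"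
    using e unfolding crosses_def by blast+
  ultimately show ?thesis using e c by (intro big_bondI[of P "O' \<union> Q \<union> R" V E e f g])
qed

text \<open>\<open>R\<close> is added to a side of the bond to which it is joined; this keeps both
  sides connected and loses no crossing edge.\<close>

lemma big_bond_extend:
  assumes bb: "big_bond (induced E X) X" and V: "X \<union> R = V" "X \<inter> R = {}" "conn_set E R"
    "joined E X R"
  shows "big_bond E V"
proof -
  obtain P Q e f g where P: "P \<union> Q = X" "P \<inter> Q = {}" "conn_set (induced E X) P"
    "conn_set (induced E X) Q"
    "distinct [e, f, g]" "{e, f, g} \<subseteq> induced E X" "crosses P Q e" "crosses P Q f" "crosses P Q g"
    using big_bondE[OF bb] .
  have c: "conn_set E P" "conn_set E Q" using P(3,4) conn_set_mono induced_subset by metis+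
  have E: "e \<in> E" "f \<in> E" "g \<in> E" "e \<noteq> f" "e \<noteq> g" "f \<noteq> g" using P(5,6) by (auto simp: induced_def)
  have "joined E P R \<or> joined E Q R" using V(4) P(1) joined_Un(1) by metis
  then show ?thesis
  proof
    assume "joined E P R"
    then have "conn_set E (P \<union> R)" using c V conn_set_Un by metis
    moreover have "crosses (P \<union> R) Q e" "crosses (P \<union> R) Q f" "crosses (P \<union> R) Q g"
      using P unfolding crosses_def by blast+
    moreover have "(P \<union> R) \<union> Q = V" "(P \<union> R) \<inter> Q = {}" using P V by auto
    ultimately show ?thesis using E c by (intro big_bondI[of "P \<union> R" Q V E e f g])
  next
    assume "joined E Q R"
    then have "conn_set E (Q \<union> R)" using c V conn_set_Un by metis
    moreover have "crosses P (Q \<union> R) e" "crosses P (Q \<union> R) f" "crosses P (Q \<union> R) g"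
      using P unfolding crosses_def by blast+
    moreover have "P \<union> (Q \<union> R) = V" "P \<inter> (Q \<union> R) = {}" using P V by auto
    ultimately show ?thesis using E c by (intro big_bondI[of P "Q \<union> R" V E e f g])
  qed
qed

text \<open>Two edges from \<open>X\<close> to \<open>Y\<close> and one from \<open>X\<close> to
  \<open>Z\<close> would form a bond around \<open>X\<close>. So only three edges run between the
  parts.\<close>

lemma card_edges_triangle_no_big_bond:
  assumes sg: "simple_graph V E" and nb: "\<not> big_bond E V" and P: "conn_parts E V [P, Q, R]"
    and J: "joined E P Q" "joined E P R" "joined E Q R"
  shows "card E \<le> card (induced E P) + card (induced E Q) + card (induced E R) + 3"
proof -
  have d: "P \<inter> Q = {}" "P \<inter> R = {}" "Q \<inter> R = {}" and V: "V = P \<union> Q \<union> R" and c: "conn_set E P"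
    "conn_set E Q" "conn_set E R"
    using P by (auto simp: conn_parts_def)
  obtain e f g where e: "e \<in> E" "f \<in> E" "g \<in> E" "crosses P Q e" "crosses P R f" "crosses Q R g"
    using J unfolding joined_crosses by blast
  have uniq: "h = h'"
    if X: "X \<inter> Y = {}" "X \<inter> Z = {}" "Y \<inter> Z = {}" "X \<union> (Y \<union> Z) = V" "conn_set E X" "conn_set E Y"
      "conn_set E Z" "joined E X Z" "joined E Y Z"
      and h: "h \<in> E" "h' \<in> E" "crosses X Y h" "crosses X Y h'" for X Y Z h h'
  proof (rule ccontr)
    assume hh: "h \<noteq> h'"
    obtain k where k: "k \<in> E" "crosses X Z k" using X(8) unfolding joined_crosses by blast
    have kk: "h \<noteq> k" "h' \<noteq> k" using h k X by (auto simp: crosses_def doubleton_eq_iff)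
    have "conn_set E (Y \<union> Z)" using X conn_set_Un by metis
    moreover have "crosses X (Y \<union> Z) h" "crosses X (Y \<union> Z) h'" "crosses X (Y \<union> Z) k"
      using h k unfolding crosses_def by blast+
    moreover have "X \<inter> (Y \<union> Z) = {}" using X by auto
    ultimately have "big_bond E V" using X h k hh kk by (intro big_bondI[of X "Y \<union> Z" V E h h' k])
    then show False using nb by simp
  qed
  note J' = J[THEN joined_sym]
  have d': "R \<inter> Q = {}" "R \<inter> P = {}" "Q \<inter> P = {}" using d by auto
  have V': "P \<union> (Q \<union> R) = V" "P \<union> (R \<union> Q) = V" "Q \<union> (R \<union> P) = V" using V by auto
  have "E \<subseteq> insert e (insert f (insert g (induced E P \<union> induced E Q \<union> induced E R)))"
  proof
    fix h assume h: "h \<in> E"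
    obtain x y where xy: "h = {x, y}" "x \<in> V" "y \<in> V" using simple_graph_edgeE[OF sg h] .
    have "h \<in> induced E P \<or> h \<in> induced E Q \<or> h \<in> induced E R \<or> crosses P Q h \<or> crosses P R h \<or>
      crosses Q R h"
      using h xy V unfolding crosses_def induced_def by (auto simp: insert_commute)
    moreover have "crosses P Q h \<Longrightarrow> h = e"
      using uniq[OF d(1,2,3) V'(1) c J(2,3) h e(1) _ e(4)] .
    moreover have "crosses P R h \<Longrightarrow> h = f"
      using uniq[OF d(2,1) d'(1) V'(2) c(1,3,2) J(1) J'(3) h e(2) _ e(5)] .
    moreover have "crosses Q R h \<Longrightarrow> h = g"
      using uniq[OF d(3) d'(3,2) V'(3) c(2,3,1) J'(1,2) h e(3) _ e(6)] .
    ultimately show "h \<in> insert e (insert f (insert g (induced E P \<union> induced E Q \<union> induced E R)))"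
      by blast
  qed
  moreover have fin: "finite (induced E X)" for X
    using sg simple_graph_finite(2) induced_subset finite_subset by metis
  ultimately have "card E \<le> card (insert e (insert f (insert g (induced E P \<union> induced E Q \<union>
    induced E R))))"
    by (intro card_mono) auto
  also have "\<dots> \<le> 3 + card (induced E P \<union> induced E Q \<union> induced E R)"
    using card_insert_le_m1 fin by (simp add: card_insert_if)
  also have "\<dots> \<le> 3 + (card (induced E P) + card (induced E Q) + card (induced E R))"
    using card_Un_le[of "induced E P \<union> induced E Q" "induced E R"] card_Un_le[of "induced E P"
      "induced E Q"] by simp
  finally show ?thesis by simp
qed

text \<open>If two parts of the triangle inside \<open>X\<close> were joined to \<open>R\<close>,
  these four sets would form a diamond.\<close>

lemma nontree_attached:
  assumes sg: "simple_graph V E" and nb: "\<not> big_bond E V"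
    and X: "X \<union> R = V" "X \<inter> R = {}" "conn_set E X" "conn_set E R" "joined E X R"
      "card X \<le> card (induced E X)"
  obtains P Q S where "P \<union> Q \<union> S = X" "P \<inter> Q = {}" "P \<inter> S = {}" "Q \<inter> S = {}"
    "conn_set E P" "conn_set E Q" "conn_set E S" "joined E P Q" "joined E P S" "joined E Q S"
    "joined E P R" "\<not> joined E Q R" "\<not> joined E S R"
proof -
  have XV: "X \<subseteq> V" using X by auto
  obtain P Q S where P: "P \<union> Q \<union> S = X" "P \<inter> Q = {}" "P \<inter> S = {}" "Q \<inter> S = {}"
    "conn_set E P" "conn_set E Q" "conn_set E S" "joined E P Q" "joined E P S" "joined E Q S"
      "joined E P R"
    using nontree_triangle_marked[OF sg XV X(3,6), of "\<lambda>Y. joined E Y R"] X(5) joined_Un(1)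
      by metis
  have "conn_parts E V [P, Q, S, R]" "conn_parts E V [P, S, Q, R]"
    using P X unfolding conn_parts_def by auto
  then have "\<not> joined E Q R" "\<not> joined E S R"
    using big_bond_triangle[of E V P Q S R] big_bond_triangle[of E V P S Q R] P joined_sym nb
      by blast+
  then show ?thesis using that P by blast
qed

text \<open>\<open>P\<close> and \<open>Q\<close> split into triangles whose attached corners
  \<open>A\<close> and \<open>A'\<close> are adjacent, and both are adjacent to \<open>R\<close>.
  Contracting \<open>A\<close> with \<open>A'\<close> yields two triangles at a common vertex and a
  double edge to \<open>R\<close>.\<close>

lemma saves_color_two_nontree_parts:
  assumes sg: "simple_graph V E" and nb: "\<not> big_bond E V" and P: "conn_parts E V [P, Q, R]"
    and J: "joined E P Q" "joined E P R" "joined E Q R"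
    and nt: "card P \<le> card (induced E P)" "card Q \<le> card (induced E Q)"
  shows "saves_color V E"
proof -
  have d: "P \<inter> Q = {}" "P \<inter> R = {}" "Q \<inter> R = {}" and V: "V = P \<union> Q \<union> R" and c: "conn_set E P"
    "conn_set E Q" "conn_set E R"
    using P by (auto simp: conn_parts_def)
  note J' = J[THEN joined_sym]
  have "conn_set E (Q \<union> R)" "joined E P (Q \<union> R)" using c J conn_set_Un joined_Un(2) by metis+
  then obtain A B C where A: "A \<union> B \<union> C = P" "A \<inter> B = {}" "A \<inter> C = {}" "B \<inter> C = {}"
    "conn_set E A" "conn_set E B" "conn_set E C" "joined E A B" "joined E A C" "joined E B C"
    "joined E A (Q \<union> R)" "\<not> joined E B (Q \<union> R)" "\<not> joined E C (Q \<union> R)"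
    using nontree_attached[OF sg nb, of P "Q \<union> R"] V d c nt
      by (auto simp: Un_assoc Int_Un_distrib)
  have "conn_set E (P \<union> R)" "joined E Q (P \<union> R)" using c J J' conn_set_Un joined_Un(2) by metis+
  moreover have "Q \<union> (P \<union> R) = V" "Q \<inter> (P \<union> R) = {}" using V d by auto
  ultimately obtain A' B' C' where A': "A' \<union> B' \<union> C' = Q" "A' \<inter> B' = {}" "A' \<inter> C' = {}"
    "B' \<inter> C' = {}"
    "conn_set E A'" "conn_set E B'" "conn_set E C'" "joined E A' B'" "joined E A' C'"
      "joined E B' C'"
    "joined E A' (P \<union> R)" "\<not> joined E B' (P \<union> R)" "\<not> joined E C' (P \<union> R)"
    using nontree_attached[OF sg nb, of Q "P \<union> R"] c nt by metis
  have AQ: "joined E A Q" "joined E A R"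
    using J(1,2) A(1,12,13) joined_Un by metis+
  have "joined E A' P" "joined E A' R"
    using J(3) J'(1) A'(1,12,13) joined_Un by metis+
  have "\<not> joined E A B'" "\<not> joined E A C'"
    using A'(12,13) A(1) joined_sym joined_Un by metis+
  \<comment> \<open>\<open>B'\<close> and \<open>C'\<close> are joined to nothing in
    \<open>P\<close>, so the edges from \<open>A\<close> to \<open>Q\<close> end in
    \<open>A'\<close>.\<close>
  then have AA': "joined E A A'" using AQ(1) A'(1) joined_Un(2) by metis
  let ?Z = "A \<union> A'"
  have Z: "conn_set E ?Z" using A A' AA' conn_set_Un by metis
  obtain m m' where m: "m \<in> E" "m' \<in> E" "crosses A R m" "crosses A' R m'"
    using AQ(2) \<open>joined E A' R\<close> unfolding joined_crosses by blast
  have "crosses ?Z R m" "crosses ?Z R m'" using m unfolding crosses_def by blast+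
  moreover have "m \<noteq> m'"
  proof
    assume "m = m'"
    then obtain x where "x \<in> A" "x \<in> m'" using m by (auto simp: crosses_def)
    then have "x \<in> A' \<union> R" using m by (auto simp: crosses_def)
    then show False using \<open>x \<in> A\<close> A(1) A'(1) d by auto
  qed
  moreover have "conn_parts E V [?Z, R, B, C, B', C']"
    using Z c A A' V d unfolding conn_parts_def by auto
  moreover have "joined E ?Z B" "joined E ?Z C" "joined E ?Z B'" "joined E ?Z C'"
    using A A' by (simp_all add: joined_Un)
  ultimately show ?thesis
    using saves_color_three_cycles[OF sg, of ?Z R B C B' C' m m'] A(10) A'(10) m by blast
qed

text \<open>\<open>P\<close> splits into a triangle with one corner \<open>A\<close> attached to
  \<open>Q\<close> and \<open>R\<close>. The triangle accounts for only one of the two independent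
  cycles, so some corner contains another. Parts are then regrouped until two different parts
  contain cycles, unless all three cycles share a corner.\<close>

lemma saves_color_nontree_part_twice:
  assumes sg: "simple_graph V E" and nb: "\<not> big_bond E V" and P: "conn_parts E V [P, Q, R]"
    and J: "joined E P Q" "joined E P R" "joined E Q R"
    and nt: "card P + 1 \<le> card (induced E P)"
  shows "saves_color V E"
proof -
  have d: "P \<inter> Q = {}" "P \<inter> R = {}" "Q \<inter> R = {}" and V: "V = P \<union> Q \<union> R" and c: "conn_set E P"
    "conn_set E Q" "conn_set E R"
    using P by (auto simp: conn_parts_def)
  note J' = J[THEN joined_sym]
  let ?R = "Q \<union> R"
  have R: "conn_set E ?R" "joined E P ?R" using c J conn_set_Un joined_Un(2) by metis+
  then obtain A B C where A: "A \<union> B \<union> C = P" "A \<inter> B = {}" "A \<inter> C = {}" "B \<inter> C = {}"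
    "conn_set E A" "conn_set E B" "conn_set E C" "joined E A B" "joined E A C" "joined E B C"
    "joined E A ?R" "\<not> joined E B ?R" "\<not> joined E C ?R"
    using nontree_attached[OF sg nb, of P ?R] V d c nt by (auto simp: Un_assoc Int_Un_distrib)
  have PV: "P \<subseteq> V" using V by auto
  have AQ: "joined E A Q" "joined E A R"
    using J(1,2) A(1,12,13) joined_Un by metis+
  have nbP: "\<not> big_bond (induced E P) P"
    using big_bond_extend[of E P ?R V] R V d nb by (auto simp: Un_assoc Int_Un_distrib)
  have cP: "conn_parts (induced E P) P [A, B, C]"
  proof -
    have "conn_set (induced E P) A" "conn_set (induced E P) B" "conn_set (induced E P) C"
      using A by (subst conn_set_induced; auto)+
    then show ?thesis using A(1-4) by (auto simp: conn_parts_def)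
  qed
  have JP: "joined (induced E P) A B" "joined (induced E P) A C" "joined (induced E P) B C"
    using A unfolding joined_def induced_def by blast+
  have ii: "induced (induced E P) A = induced E A" "induced (induced E P) B = induced E B"
    "induced (induced E P) C = induced E C"
    using A(1) by (auto simp: induced_def)
  have "card (induced E P) \<le> card (induced E A) + card (induced E B) + card (induced E C) + 3"
    using card_edges_triangle_no_big_bond[OF simple_graph_induced[OF sg PV] nbP cP JP]
      by (simp only: ii)
  moreover have "card P = card A + card B + card C"
  proof -
    have "finite A" "finite B" "finite C"
      using A(1) PV simple_graph_finite(1)[OF sg] finite_subset by blast+
    then have "card (A \<union> B \<union> C) = card A + card B + card C"
      using A(2-4) by (simp add: card_Un_disjoint Int_Un_distrib2)
    then show ?thesis using A(1) by simp
  qed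
  ultimately have "card A \<le> card (induced E A) \<or> card B \<le> card (induced E B) \<or>
    card C \<le> card (induced E C)"
    using nt by linarith
  then consider "card B \<le> card (induced E B)" | "card C \<le> card (induced E C)" |
    "card A \<le> card (induced E A)" by blast
  then show ?thesis
  proof cases
    \<comment> \<open>\<open>A\<close>, \<open>Q\<close> and \<open>R\<close> form a triangle, so
      their union and \<open>B\<close> are two parts with cycles.\<close>
    case 1
    have n: "card (A \<union> Q \<union> R) \<le> card (induced E (A \<union> Q \<union> R))"
      by (rule nontree_Un[OF sg]) (use A AQ c J V d in auto)
    have "conn_set E (A \<union> Q \<union> R)" using A R AQ c conn_set_Un joined_Un(1) by metis
    then have "conn_parts E V [A \<union> Q \<union> R, B, C]" using A V d unfolding conn_parts_def by auto
    then show ?thesis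
      by (rule saves_color_two_nontree_parts[OF sg nb]) (use A n 1 in \<open>auto simp: joined_Un\<close>)
  next
    case 2
    have n: "card (A \<union> Q \<union> R) \<le> card (induced E (A \<union> Q \<union> R))"
      by (rule nontree_Un[OF sg]) (use A AQ c J V d in auto)
    have "conn_set E (A \<union> Q \<union> R)" using A R AQ c conn_set_Un joined_Un(1) by metis
    then have "conn_parts E V [A \<union> Q \<union> R, C, B]" using A V d unfolding conn_parts_def by auto
    then show ?thesis
      by (rule saves_color_two_nontree_parts[OF sg nb])
        (use A n 2 joined_sym in \<open>auto simp: joined_Un\<close>)
  next
    case 3
    let ?T = "B \<union> C"
    have T: "conn_set E ?T" "joined E A ?T" using A conn_set_Un joined_Un(2) by metis+
    have cAR: "conn_set E (A \<union> ?R)" "conn_set E (A \<union> ?T)" using conn_set_Un A(5,11) R(1) T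
      by metis+
    have VV: "A \<union> ?R \<subseteq> V" "A \<union> ?T \<subseteq> V" "A \<inter> ?R = {}" "A \<inter> ?T = {}" using A V d by auto
    have RT: "A \<union> ?R \<union> ?T = V" "(A \<union> ?R) \<inter> ?T = {}" "A \<union> ?T \<union> ?R = V" "(A \<union> ?T) \<inter> ?R = {}"
      using A(1-4) V d by auto
    have "joined E (A \<union> ?R) ?T" "joined E (A \<union> ?T) ?R" using T(2) A(11) joined_Un(1) by metis+
    \<comment> \<open>A large bond found within \<open>A\<close> and one of its two neighbours would
      extend over the other neighbour to all of \<open>V\<close>.\<close>
    then have nbR: "\<not> big_bond (induced E (A \<union> ?R)) (A \<union> ?R)"
      and nbT: "\<not> big_bond (induced E (A \<union> ?T)) (A \<union> ?T)"
      using big_bond_extend[OF _ RT(1,2) T(1)] big_bond_extend[OF _ RT(3,4) R(1)] nb by blast+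
    have AV: "A \<subseteq> V" using VV by auto
    obtain X Y Z where X: "X \<union> Y \<union> Z = A" "X \<inter> Y = {}" "X \<inter> Z = {}" "Y \<inter> Z = {}"
      "conn_set E X" "conn_set E Y" "conn_set E Z" "joined E X Y" "joined E X Z" "joined E Y Z"
        "joined E X ?R"
      using nontree_triangle_marked[OF sg AV A(5) 3, of "\<lambda>Y. joined E Y ?R"] A(11) joined_Un(1)
        by metis
    \<comment> \<open>At most one corner of a triangle inside \<open>A\<close> is joined to
      \<open>U\<close>, as in \<open>nontree_attached\<close>; \<open>U\<close> will be the union of
      \<open>Q\<close> and \<open>R\<close> or that of \<open>B\<close> and
      \<open>C\<close>.\<close>
    have once: "\<not> (joined E S U \<and> joined E S' U)"
      if S: "S \<union> S' \<union> S'' = A" "S \<inter> S' = {}" "S \<inter> S'' = {}" "S' \<inter> S'' = {}"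
        "conn_set E S" "conn_set E S'" "conn_set E S''" "joined E S S'" "joined E S S''"
          "joined E S' S''"
        and U: "conn_set E U" "A \<inter> U = {}" "\<not> big_bond (induced E (A \<union> U)) (A \<union> U)" for S S' S'' U
    proof
      assume j: "joined E S U \<and> joined E S' U"
      let ?I = "induced E (A \<union> U)"
      have "conn_set ?I S" "conn_set ?I S'" "conn_set ?I S''" "conn_set ?I U"
        using S U by (subst conn_set_induced; auto)+
      then have "conn_parts ?I (A \<union> U) [S, S', S'', U]" using S U unfolding conn_parts_def by auto
      moreover have "joined ?I S S'" "joined ?I S S''" "joined ?I S' S''" "joined ?I S U"
        "joined ?I S' U"
        using S j unfolding joined_def induced_def by blast+
      ultimately show False using big_bond_triangle U(3) by metis
    qed
    have X': "X \<union> Z \<union> Y = A" "Z \<inter> Y = {}" "joined E Z Y" using X joined_sym by auto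
    have Y: "\<not> joined E Y ?R" "\<not> joined E Z ?R"
      using once[OF X(1-10) R(1) VV(3) nbR] once[OF X'(1) X(3,2) X'(2) X(5,7,6,9,8) X'(3) R(1)
        VV(3) nbR] X(11)
      by blast+
    have XQ: "joined E X Q" "joined E X R" using AQ X(1) Y joined_Un by metis+
    have "joined E X ?T \<or> joined E Y ?T \<or> joined E Z ?T" using T(2) X(1) joined_Un(1) by metis
    moreover have attached: "joined E S B \<and> joined E S C"
      if S: "S \<union> S' \<union> S'' = A" "S \<inter> S' = {}" "S \<inter> S'' = {}" "S' \<inter> S'' = {}"
        "conn_set E S" "conn_set E S'" "conn_set E S''" "joined E S S'" "joined E S S''"
          "joined E S' S''" "joined E S ?T"
      for S S' S''
    proof -
      have S': "S \<union> S'' \<union> S' = A" "S'' \<inter> S' = {}" "joined E S'' S'" using S joined_sym by auto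
      have "\<not> joined E S' ?T" "\<not> joined E S'' ?T"
        using once[OF S(1-10) T(1) VV(4) nbT] once[OF S'(1) S(3,2) S'(2) S(5,7,6,9,8) S'(3) T(1)
          VV(4) nbT] S(11)
        by blast+
      then show ?thesis using A(8,9) S(1) joined_Un by metis
    qed
    \<comment> \<open>Regrouped around the triangle \<open>X\<close>, \<open>Y\<close>, \<open>Z\<close>, two parts contain a cycle.\<close>
    have elsewhere: "saves_color V E"
      if S: "S \<union> S' = Y \<union> Z" "S \<inter> S' = {}" "conn_set E S" "conn_set E S'" "joined E X S"
        "joined E X S'" "joined E S S'"
        "joined E S B" "joined E S C" for S S'
    proof -
      have XYZ: "X \<union> S \<union> S' = A" "X \<inter> S = {}" "X \<inter> S' = {}" using X S by auto
      have n1: "card (X \<union> Q \<union> R) \<le> card (induced E (X \<union> Q \<union> R))"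
        by (rule nontree_Un[OF sg]) (use A X XQ c J V d in auto)
      have n2: "card (S \<union> B \<union> C) \<le> card (induced E (S \<union> B \<union> C))"
        by (rule nontree_Un[OF sg]) (use A XYZ S V in auto)
      have "conn_set E (X \<union> Q \<union> R)" "conn_set E (S \<union> B \<union> C)"
        using X(5) S(3) XQ S(8,9) c A(6,7) conn_set_Un joined_Un(1) by metis+
      then have "conn_parts E V [X \<union> Q \<union> R, S \<union> B \<union> C, S']"
        using A XYZ S V d unfolding conn_parts_def by auto
      then show ?thesis
        by (rule saves_color_two_nontree_parts[OF sg nb]) (use S n1 n2 in \<open>auto simp: joined_Un\<close>)
    qed
    ultimately consider "joined E X ?T" | "joined E Y ?T" | "joined E Z ?T" by blast
    then show ?thesis
    proof cases
      \<comment> \<open>Both outer triangles meet \<open>A\<close> in the corner \<open>X\<close>.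
        The triangle inside \<open>A\<close> contributes the double edge from \<open>X\<close> to
        the union of \<open>Y\<close> and \<open>Z\<close>.\<close>
      case 1
      then have X1: "joined E X B" "joined E X C" using attached[of X Y Z] X by auto
      obtain m m' where m: "m \<in> E" "m' \<in> E" "crosses X Y m" "crosses X Z m'"
        using X(8,9) unfolding joined_crosses by blast
      have "crosses X (Y \<union> Z) m" "crosses X (Y \<union> Z) m'" using m unfolding crosses_def by blast+
      moreover have "m \<noteq> m'" using m X by (auto simp: crosses_def doubleton_eq_iff)
      moreover have "conn_set E (Y \<union> Z)" using X conn_set_Un by metis
      then have "conn_parts E V [X, Y \<union> Z, B, C, Q, R]" using X A c V d unfolding conn_parts_def
        by auto
      ultimately show ?thesis
        using saves_color_three_cycles[OF sg, of X "Y \<union> Z" B C Q R m m'] X1 XQ A(10) J(3) m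
          by blast
    next
      case 2
      have "Y \<union> X \<union> Z = A" "Y \<inter> X = {}" "joined E Y X" using X joined_sym by auto
      then have "joined E Y B \<and> joined E Y C"
        using attached[OF _ _ X(4,3,6,5,7) _ X(10,9) 2] by blast
      then show ?thesis using elsewhere[of Y Z] X by simp
    next
      case 3
      have "Z \<union> X \<union> Y = A" "Z \<inter> X = {}" "Z \<inter> Y = {}" "joined E Z X" "joined E Z Y"
        using X joined_sym by auto
      moreover from this have "joined E Z B" "joined E Z C"
        using attached[OF _ _ _ X(2,7,5,6) _ _ X(8) 3] by blast+
      moreover have "Z \<union> Y = Y \<union> Z" by blast
      ultimately show ?thesis using elsewhere[OF _ _ X(7,6,9,8)] by blast
    qed
  qed
qed

text \<open>A triangle of parts uses up one of at least three independent cycles. The other two lie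
  inside parts, either in the same one or in two different ones.\<close>

lemma saves_color_no_big_bond:
  assumes sg: "simple_graph V E" and con: "connected_graph V E" and nb: "\<not> big_bond E V"
    and ce: "card V + 2 \<le> card E"
  shows "saves_color V E"
proof -
  obtain P Q R where P: "P \<union> Q \<union> R = V" "P \<inter> Q = {}" "P \<inter> R = {}" "Q \<inter> R = {}"
    "conn_set E P" "conn_set E Q" "conn_set E R" "joined E P Q" "joined E P R" "joined E Q R"
    using triangle_split[OF sg con] ce by auto
  have parts: "conn_parts E V [P, Q, R]" "conn_parts E V [P, R, Q]" "conn_parts E V [Q, R, P]"
    "conn_parts E V [Q, P, R]" "conn_parts E V [R, P, Q]"
    using P unfolding conn_parts_def by auto
  note J = P(8-10) and J' = P(8-10)[THEN joined_sym]
  have "card E \<le> card (induced E P) + card (induced E Q) + card (induced E R) + 3"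
    by (rule card_edges_triangle_no_big_bond[OF sg nb parts(1) J])
  moreover have "card V = card P + card Q + card R"
  proof -
    have "finite P" "finite Q" "finite R"
      using P(1) simple_graph_finite(1)[OF sg] finite_subset by blast+
    then have "card (P \<union> Q \<union> R) = card P + card Q + card R"
      using P(2-4) by (simp add: card_Un_disjoint Int_Un_distrib2)
    then show ?thesis using P(1) by simp
  qed
  ultimately have "card P + 1 \<le> card (induced E P) \<or> card Q + 1 \<le> card (induced E Q) \<or>
    card R + 1 \<le> card (induced E R)
    \<or> card P \<le> card (induced E P) \<and> card Q \<le> card (induced E Q)
    \<or> card P \<le> card (induced E P) \<and> card R \<le> card (induced E R)
    \<or> card Q \<le> card (induced E Q) \<and> card R \<le> card (induced E R)"
    using ce by linarith
  then show ?thesis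
    using saves_color_nontree_part_twice[OF sg nb parts(1) J] saves_color_nontree_part_twice[OF sg
      nb parts(4) J'(1) J(3,2)]
      saves_color_nontree_part_twice[OF sg nb parts(5) J'(2,3) J(1)]
      saves_color_two_nontree_parts[OF sg nb parts(1) J] saves_color_two_nontree_parts[OF sg nb
        parts(2) J(2,1) J'(3)]
      saves_color_two_nontree_parts[OF sg nb parts(3) J(3) J'(1,2)] by blast
qed

lemma not_saves_color_classes:
  assumes sg: "simple_graph V E" and con: "connected_graph V E" and ng: "\<not> saves_color V E"
  shows "tree_graph V E \<or> unicyclic V E \<or> (cactus V E \<and> cyclomatic V E = 2) \<or>
    (V, E) \<in> K4_with_paths \<union> K4_minus_edge_with_trees"
proof (cases "big_bond E V")
  case True
  then show ?thesis using big_bond_classes[OF sg _ ng] by blast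
next
  case False
  then have cac: "cactus V E" using not_cactus_big_bond[OF sg con] by blast
  have "card V \<le> card E + 1"
    by (rule card_edges_ge) (use sg con simple_graph_finite in \<open>auto simp: connected_graph_reach\<close>)
  moreover have "card E < card V + 2" using saves_color_no_big_bond[OF sg con False] ng
    by fastforce
  ultimately consider "card E + 1 = card V" | "card E = card V" | "card E = card V + 1"
    by linarith
  then show ?thesis
  proof cases
    case 1
    then show ?thesis using tree_graph_iff_card[OF sg con] by blast
  next
    case 2
    then show ?thesis using con by (simp add: unicyclic_def cyclomatic_def)
  next
    case 3
    then show ?thesis using cac by (simp add: cyclomatic_def)
  qed
qed

subsection \<open>Lower bounds\<close>

text \<open>A rainbow \<open>F\<close> contains at most one edge of \<open>M\<close> per colour, and
  each such edge reduces the number of components by at most one.\<close>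

lemma rainbow_cls_bound:
  assumes "finite M" "finite S" "F \<subseteq> E" "inj_on c F" "\<And>x y. x \<in> S \<Longrightarrow> y \<in> S \<Longrightarrow> reach F x y"
  shows "card (cls (E - M) ` S) \<le> card (c ` M) + 1"
proof -
  have "card (cls (E - M) ` S) \<le> card (F \<inter> M) + card (cls ((E - M) \<union> (F \<inter> M)) ` S)"
    using assms by (intro rank_le) auto
  moreover have "card (cls ((E - M) \<union> (F \<inter> M)) ` S) \<le> 1"
    by (rule card_cls_connected) (rule reach_mono[OF assms(5)], use assms(3) in auto)
  moreover have "card (F \<inter> M) = card (c ` (F \<inter> M))"
    using assms(4) by (metis card_image inf_le1 inj_on_subset)
  moreover have "card (c ` (F \<inter> M)) \<le> card (c ` M)"
    using assms(1) by (intro card_mono) auto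
  ultimately show ?thesis by linarith
qed

text \<open>With at most two colours in \<open>M\<close>, representatives of two more components
  than colours still fit into a set of four vertices.\<close>

lemma few_colours_few_components:
  assumes sg: "simple_graph V E" and V: "4 \<le> card V" and col: "rainbow_coloring 4 V E q c"
    and M: "M \<subseteq> E" "card (c ` M) \<le> 2"
  shows "card (cls (E - M) ` V) \<le> card (c ` M) + 1"
proof (rule ccontr)
  let ?f = "cls (E - M)" and ?j = "card (c ` M)"
  assume "\<not> ?thesis"
  then have big: "?j + 2 \<le> card (?f ` V)" by simp
  have fin: "finite V" "finite M" using sg M(1) simple_graph_finite finite_subset by metis+
  obtain S0 where S0: "S0 \<subseteq> V" "inj_on ?f S0" "?f ` V = ?f ` S0"
    using subset_image_inj[of "?f ` V" ?f V] by auto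
  then have "?j + 2 \<le> card S0" using big card_image by metis
  then obtain S1 where S1: "S1 \<subseteq> S0" "card S1 = ?j + 2" by (rule obtain_subset_with_card_n)
  obtain S where S: "S1 \<subseteq> S" "S \<subseteq> V" "card S = 4"
    using exists_subset_between[of S1 4 V] S1 S0(1) M(2) V fin by auto
  have finS: "finite S" using S(2) fin finite_subset by metis
  obtain F where F: "F \<subseteq> E" "inj_on c F" "\<And>x y. x \<in> S \<Longrightarrow> y \<in> S \<Longrightarrow> reach F x y"
    using rainbow_coloringD[OF col S(2,3)] by blast
  have "card (?f ` S) \<le> ?j + 1" by (rule rainbow_cls_bound[OF fin(2) finS F])
  moreover have "card (?f ` S1) \<le> card (?f ` S)" using S(1) finS by (intro card_mono) auto
  moreover have "card (?f ` S1) = ?j + 2" using S1 S0(2) by (metis card_image inj_on_subset)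
  ultimately show False by simp
qed

lemma cls_insert_same:
  assumes "reach R u v"
  shows "cls (insert {u, v} R) = cls R"
proof -
  have "reach R x y" if "{x, y} \<in> insert {u, v} R" for x y
    using that assms reach_sym reach_edge by (metis doubleton_eq_iff insert_iff)
  then have "reach (insert {u, v} R) x y \<longleftrightarrow> reach R x y" for x y
    by (meson reach_mono reach_replace subset_insertI)
  then show ?thesis by (intro ext) (simp add: cls_def)
qed

text \<open>This makes a connection between four components meet a fifth one for free, when the
  fifth separates two of the terminals.\<close>

lemma reach_escape:
  assumes sg: "simple_graph V E" and "F \<subseteq> E" "reach F x y" "x \<in> V - K"
    "\<not> reach (induced E (V - K)) x y"
  shows "\<exists>k\<in>K. reach F x k"
proof -
  have "(\<exists>k\<in>K. reach F x k) \<or> y \<in> V - K \<and> reach (induced E (V - K)) x y"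
    using assms(3)
  proof (induction rule: reach_induct)
    case (step y z)
    have z: "z \<in> V" "{y, z} \<in> E" using step.hyps assms(2) simple_graph_edge(2)[OF sg] by blast+
    show ?case
    proof (cases "z \<in> K")
      case True
      then show ?thesis using step.hyps by (meson reach_edge reach_trans)
    next
      case False
      show ?thesis
      proof (cases "\<exists>k\<in>K. reach F x k")
        case nk: False
        then have y: "y \<in> V - K" "reach (induced E (V - K)) x y" using step.IH by auto
        then have "{y, z} \<in> induced E (V - K)" using z False by (auto simp: induced_def)
        then have "reach (induced E (V - K)) x z" using y(2) reach_edge reach_trans by metis
        then show ?thesis using z False by blast
      qed simp
    qed
  qed (use assms(4) in simp)
  then show ?thesis using assms(5) by blast
qed

text \<open>The extremal case of the component count: it leaves cyclomatic number two and three
  colours occurring in pairs, with every inequality tight.\<close>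

lemma rainbow_few_colours_structure:
  assumes sg: "simple_graph V E" and V: "4 \<le> card V"
    and ce: "card V \<le> card E + 1" "card E \<le> card V + 1"
    and col: "rainbow_coloring 4 V E (card V - 2) c"
  obtains M where "M \<subseteq> E" "card M = 6" "card (cls (E - M) ` V) = 5"
    "\<forall>u v. {u, v} \<in> M \<longrightarrow> \<not> reach (E - M) u v"
    "\<forall>k\<in>V. conn_set E (V - cls (E - M) k)" "card E = card V + 1"
proof -
  have fin: "finite V" "finite E" using sg simple_graph_finite by metis+
  \<comment> \<open>The cyclomatic number; by \<open>ce\<close> the subtraction is not cut
    off.\<close>
  define a where "a = card E + 1 - card V"
  have a: "card E + 1 = card V + a" "a \<le> 2" using ce by (simp_all add: a_def)
  define rep where "rep e = (SOME e'. e' \<in> E \<and> c e' = c e)" for e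
  have rep: "rep e \<in> E" "c (rep e) = c e" if "e \<in> E" for e
    using someI[of "\<lambda>e'. e' \<in> E \<and> c e' = c e" e] that unfolding rep_def by auto
  have rep_eq: "rep e = rep e'" if "c e = c e'" for e e' using that by (simp add: rep_def)
  have inj_rep: "inj_on c (rep ` E)"
  proof (rule inj_onI)
    fix x y assume "x \<in> rep ` E" "y \<in> rep ` E" and eq: "c x = c y"
    then obtain e e' where "e \<in> E" "e' \<in> E" "x = rep e" "y = rep e'" by blast
    then show "x = y" using eq rep(2) rep_eq[of e e'] by simp
  qed
  from card_image[OF inj_rep] have "card (rep ` E) = card (c ` rep ` E)" by simp
  also have "\<dots> \<le> card {1..card V - 2}"
  proof (rule card_mono)
    have "rep ` E \<subseteq> E" using rep(1) by blast
    then have "c ` rep ` E \<subseteq> c ` E" by (rule image_mono)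
    also have "\<dots> \<subseteq> {1..card V - 2}" using col by (simp add: rainbow_coloring_def)
    finally show "c ` rep ` E \<subseteq> {1..card V - 2}" .
  qed simp
  finally have "card (rep ` E) \<le> card V - 2" by simp
  \<comment> \<open>There are n - 1 + a edges and at most n - 2 representatives, one for each
    colour.\<close>
  then have "a + 1 \<le> card (E - rep ` E)"
    using card_Diff_subset[of "rep ` E" E] rep(1) fin a V by (auto simp: image_subset_iff)
  then obtain X where X: "X \<subseteq> E - rep ` E" "card X = a + 1" by (rule obtain_subset_with_card_n)
  \<comment> \<open>Adding the representatives makes each colour of \<open>X\<close> occur at least
    twice, so \<open>M\<close> has a + 1 more edges than colours; n - 2 - j edges remain
    outside.\<close>
  define M where "M = X \<union> rep ` X"
  define j where "j = card (c ` M)"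
  have finX: "finite X" using X(1) fin finite_subset by blast
  have XE: "X \<subseteq> E" using X by auto
  have ME: "M \<subseteq> E" using X rep(1) by (auto simp: M_def)
  have finM: "finite M" using ME fin finite_subset by blast
  have "c ` rep ` X = c ` X" using rep(2) XE by (simp add: image_image subset_eq cong: image_cong)
  then have "c ` M = c ` rep ` X" by (simp add: M_def image_Un)
  moreover have "inj_on c (rep ` X)" using inj_rep XE by (meson image_mono inj_on_subset)
  ultimately have j: "j = card (rep ` X)" by (simp add: j_def card_image)
  have "X \<inter> rep ` X = {}" using X by auto
  then have cM: "card M = a + 1 + j" using X(2) finX j by (simp add: M_def card_Un_disjoint)
  have "card V \<le> card (E - M) + card (cls (E - M) ` V)"
    using rank_le[of "E - M" V "{}"] fin by (simp add: card_cls_empty)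
  moreover have "card (E - M) = card E - card M" using ME finM by (rule card_Diff_subset[rotated])
  moreover have "card M \<le> card E" using ME fin card_mono by metis
  ultimately have comps: "j + 2 \<le> card (cls (E - M) ` V)" using cM a V by linarith
  have "j \<ge> 3"
  proof (rule ccontr)
    assume "\<not> j \<ge> 3"
    then have "card (cls (E - M) ` V) \<le> j + 1"
      using few_colours_few_components[OF sg V col ME] by (simp add: j_def)
    then show False using comps by simp
  qed
  moreover have "j \<le> a + 1" using j X(2) finX card_image_le by metis
  ultimately have a2: "a = 2" and j3: "j = 3" using a by auto
  have cX: "card X = 3" using X(2) a2 by simp
  \<comment> \<open>Giving one pair back leaves two colours in \<open>M\<close>, so at most three
    components are allowed. Two edges can remove only two components, so there were exactly
    five.\<close>
  have pair: "card (cls (E - (M - {x, rep x})) ` V) \<le> 3" if x: "x \<in> X" for x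
  proof -
    have "c ` (M - {x, rep x}) \<subseteq> c ` (X - {x})"
      using rep(2) XE x by (force simp: M_def)
    then have "card (c ` (M - {x, rep x})) \<le> card (c ` (X - {x}))" using finX
      by (intro card_mono) auto
    also have "\<dots> \<le> card (X - {x})" using finX by (intro card_image_le) simp
    finally have le2: "card (c ` (M - {x, rep x})) \<le> 2" using cX x finX by simp
    have "M - {x, rep x} \<subseteq> E" using ME by auto
    from few_colours_few_components[OF sg V col this le2] show ?thesis using le2 by simp
  qed
  have restore: "E - (M - {x, rep x}) = insert x (insert (rep x) (E - M))" if "x \<in> X" for x
    using that ME rep(1) XE by (auto simp: M_def)
  obtain x where x: "x \<in> X" using cX by fastforce
  have "card (cls (E - M) ` V) \<le> Suc (Suc (card (cls (E - (M - {x, rep x})) ` V)))"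
    using card_cls_insert[OF fin(1), of "E - M" "rep x"] card_cls_insert[OF fin(1), of
      "insert (rep x) (E - M)" x]
    by (simp add: restore[OF x])
  then have c5: "card (cls (E - M) ` V) = 5" using pair[OF x] comps j3 by simp
  \<comment> \<open>An edge of \<open>M\<close> inside a component would merge nothing, and
    restoring its pair could not bring five components down to three.\<close>
  have cross: "\<not> reach (E - M) u v" if uv: "{u, v} \<in> M" for u v
  proof
    assume r: "reach (E - M) u v"
    obtain y where y: "y \<in> X" "{u, v} = y \<or> {u, v} = rep y" using uv by (auto simp: M_def)
    then obtain e where e: "insert y (insert (rep y) (E - M)) = insert e (insert {u, v} (E - M))"
      by blast
    have "card (cls (insert {u, v} (E - M)) ` V) \<le> Suc (card (cls (insert e (insert {u, v} (E -
      M))) ` V))"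
      by (rule card_cls_insert[OF fin(1)])
    then have "card (cls (E - M) ` V) \<le> Suc (card (cls (E - (M - {y, rep y})) ` V))"
      by (simp only: cls_insert_same[OF r] restore[OF y(1)] e)
    then show False using c5 pair[OF y(1)] by simp
  qed
  \<comment> \<open>If \<open>K\<close> separated \<open>s\<close> from \<open>t\<close>, terminals
    in the four other components would do: their tree runs through \<open>K\<close> as well and
    meets all five components with only three colours.\<close>
  have conK: "conn_set E (V - cls (E - M) k)" if k: "k \<in> V" for k
  proof (rule ccontr)
    let ?f = "cls (E - M)"
    let ?K = "?f k"
    assume nc: "\<not> conn_set E (V - ?K)"
    have other: "?f z \<noteq> ?K \<longleftrightarrow> z \<notin> ?K" for z
      by (simp add: cls_eq_iff) (auto simp: cls_def reach_sym)
    have "\<not> ?f ` V \<subseteq> {?K}"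
    proof
      assume "?f ` V \<subseteq> {?K}"
      then have "card (?f ` V) \<le> card {?K}" by (intro card_mono) auto
      then show False using c5 by simp
    qed
    then have "V - ?K \<noteq> {}" using other by blast
    then obtain s t where st: "s \<in> V - ?K" "t \<in> V - ?K" "\<not> reach (induced E (V - ?K)) s t"
      using nc by (auto simp: conn_set_def)
    have nst: "?f s \<noteq> ?f t"
    proof
      assume "?f s = ?f t"
      then have "reach (E - M) s t" by (simp add: cls_eq_iff)
      then obtain l where "l \<in> ?K" "reach (E - M) s l"
        using reach_escape[OF sg Diff_subset _ st(1,3)] by metis
      then have "?f k = ?f l" "?f s = ?f l" by (simp_all only: cls_eq_iff) (simp add: cls_def)
      then have "s \<in> ?K" using other by metis
      then show False using st by simp
    qed
    have sub: "{?K, ?f s, ?f t} \<subseteq> ?f ` V" using k st by auto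
    have "?K \<noteq> ?f s" "?K \<noteq> ?f t" using other[of s] other[of t] st by blast+
    then have c3: "card {?K, ?f s, ?f t} = 3" using nst by simp
    have "card (?f ` V - {?K, ?f s, ?f t}) = 2"
      using card_Diff_subset[OF _ sub] c3 c5 by simp
    moreover obtain S0 where S0: "S0 \<subseteq> V" "inj_on ?f S0" "?f ` V - {?K, ?f s, ?f t} = ?f ` S0"
      using subset_image_inj[of "?f ` V - {?K, ?f s, ?f t}" ?f V] by auto
    ultimately have cS0: "card S0 = 2" by (simp add: card_image)
    have finS0: "finite S0" using S0(1) fin finite_subset by metis
    have "s \<notin> S0" "t \<notin> S0" using S0(3) by blast+
    moreover have "s \<noteq> t" using nst by auto
    ultimately have cS: "card (S0 \<union> {s, t}) = 4" using cS0 finS0 by simp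
    obtain F where F: "F \<subseteq> E" "inj_on c F" "\<And>x y. x \<in> S0 \<union> {s, t} \<Longrightarrow> y \<in> S0 \<union> {s, t} \<Longrightarrow> reach F x y"
      using rainbow_coloringD[OF col _ cS] S0(1) st by blast
    obtain l where l: "l \<in> ?K" "reach F s l"
      using reach_escape[OF sg F(1) F(3) st(1,3)] by auto
    have from_s: "reach F s x" if "x \<in> insert l (S0 \<union> {s, t})" for x
      using that F(3)[of s x] l(2) by blast
    have "reach F x y" if "x \<in> insert l (S0 \<union> {s, t})" "y \<in> insert l (S0 \<union> {s, t})" for x y
      using from_s[OF that(1), THEN reach_sym] from_s[OF that(2)] by (rule reach_trans)
    then have "card (?f ` insert l (S0 \<union> {s, t})) \<le> j + 1"
      unfolding j_def using finM finS0 F(1,2) by (intro rainbow_cls_bound[of _ _ F]) auto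
    moreover have "?f ` insert l (S0 \<union> {s, t}) = ?f ` V"
    proof -
      have "?f l = ?K" using l(1) other by blast
      then have "?f ` insert l (S0 \<union> {s, t}) = ?f ` S0 \<union> {?K, ?f s, ?f t}" by (simp add: image_Un)
      also have "\<dots> = (?f ` V - {?K, ?f s, ?f t}) \<union> {?K, ?f s, ?f t}" by (simp only: S0(3))
      also have "\<dots> = ?f ` V" using sub by (simp only: Diff_partition Un_commute)
      finally show ?thesis .
    qed
    ultimately show False using c5 j3 by simp
  qed
  show ?thesis
    by (rule that[OF ME _ c5]) (use cM a2 j3 a(1) cross conK in auto)
qed

section \<open>The lower bound for each class of graphs\<close>

lemma cls_conn_set: "simple_graph V E \<Longrightarrow> F \<subseteq> E \<Longrightarrow> x \<in> V \<Longrightarrow> conn_set E (cls F x) \<and> cls F x \<subseteq> V"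
proof -
  assume a: "simple_graph V E" "F \<subseteq> E" "x \<in> V"
  have "induced F UNIV = F" by (auto simp: induced_def)
  then have "conn_set F (cls F x)" using conn_set_cls_induced(1)[of x UNIV F]
    by (simp add: cls_def)
  moreover have "cls F x \<subseteq> V" using reach_in[OF simple_graph_subset[OF a(1,2)]] a(3)
    by (auto simp: cls_def)
  ultimately show ?thesis using conn_set_mono a(2) by blast
qed

text \<open>Were at most two edges of \<open>M\<close> to touch each of the five components, there
  would be at most ten incidences; six edges between components make twelve. A component touched by
  three edges gives a bond, since its complement is connected.\<close>

lemma not_saves_color_no_big_bond:
  assumes sg: "simple_graph V E" and con: "connected_graph V E" and V: "4 \<le> card V"
    and ce: "card E \<le> card V + 1" and nb: "card E = card V + 1 \<Longrightarrow> \<not> big_bond E V"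
  shows "\<not> saves_color V E"
proof
  assume "saves_color V E"
  then obtain c where col: "rainbow_coloring 4 V E (card V - 2) c" by (auto simp: saves_color_def)
  have fin: "finite V" "finite E" using sg simple_graph_finite by metis+
  have lower: "card V \<le> card E + 1"
    by (rule card_edges_ge) (use fin con in \<open>auto simp: connected_graph_reach\<close>)
  obtain M where M: "M \<subseteq> E" "card M = 6" "card (cls (E - M) ` V) = 5"
    "\<forall>u v. {u, v} \<in> M \<longrightarrow> \<not> reach (E - M) u v"
    "\<forall>k\<in>V. conn_set E (V - cls (E - M) k)" "card E = card V + 1"
    by (rule rainbow_few_colours_structure[OF sg V lower ce col])
  let ?f = "cls (E - M)"
  have finM: "finite M" using M(1) fin finite_subset by metis
  have few: "card {e \<in> M. e \<inter> K \<noteq> {}} \<le> 2" if K: "K \<in> ?f ` V" for K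
  proof (rule ccontr)
    assume "\<not> ?thesis"
    then have "3 \<le> card {e \<in> M. e \<inter> K \<noteq> {}}" by simp
    then obtain T where T: "T \<subseteq> {e \<in> M. e \<inter> K \<noteq> {}}" "card T = 3"
      by (rule obtain_subset_with_card_n)
    obtain e f g where efg: "T = {e, f, g}" "e \<noteq> f" "e \<noteq> g" "f \<noteq> g"
      using T(2) by (auto simp: card_3_iff)
    obtain k where k: "k \<in> V" "K = ?f k" using K by auto
    have cross: "crosses K (V - K) h" if h: "h \<in> T" for h
    proof -
      have hM: "h \<in> M" "h \<in> E" "h \<inter> K \<noteq> {}" using h T M(1) by auto
      obtain x y where "h = {x, y}" using simple_graph_edgeE[OF sg hM(2)] .
      then have "\<exists>u v. h = {u, v} \<and> u \<in> K" using hM(3) by (auto simp: insert_commute)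
      then obtain u v where uv: "h = {u, v}" "u \<in> K" by blast
      have "v \<in> V" using simple_graph_edge(2)[OF sg] hM uv by blast
      moreover have "v \<notin> K"
      proof
        assume "v \<in> K"
        then have "reach (E - M) u v" using uv(2) k
          by (auto simp: cls_def intro: reach_sym reach_trans)
        then show False using M(4) hM uv by blast
      qed
      ultimately show ?thesis using uv by (auto simp: crosses_def)
    qed
    have "conn_set E K" "K \<subseteq> V" using cls_conn_set[OF sg _ k(1)] k(2) by auto
    then have "big_bond E V"
      using cross efg T M(1) M(5)[rule_format, OF k(1)] k(2) by (intro big_bondI[of K
        "V - K" V E e f g]) auto
    then show False using nb M(6) by simp
  qed
  have "(\<Sum>K\<in>?f ` V. card {e \<in> M. e \<inter> K \<noteq> {}}) = (\<Sum>e\<in>M. card {K \<in> ?f ` V. e \<inter> K \<noteq> {}})"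
    by (rule sum_multicount_gen) (use fin finM in auto)
  moreover have "(\<Sum>K\<in>?f ` V. card {e \<in> M. e \<inter> K \<noteq> {}}) \<le> 5 * 2"
    using sum_bounded_above[of "?f ` V" "\<lambda>K. card {e \<in> M. e \<inter> K \<noteq> {}}" 2] few M(3) by simp
  moreover have "2 \<le> card {K \<in> ?f ` V. e \<inter> K \<noteq> {}}" if e: "e \<in> M" for e
  proof -
    have "e \<in> E" using e M(1) by auto
    then obtain u v where uv: "e = {u, v}" "u \<in> V" "v \<in> V" using simple_graph_edgeE[OF sg]
      by metis
    have "?f u \<noteq> ?f v" using M(4) e uv by (simp add: cls_eq_iff)
    then have "card {?f u, ?f v} = 2" by simp
    moreover have "{?f u, ?f v} \<subseteq> {K \<in> ?f ` V. e \<inter> K \<noteq> {}}"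
      using uv by (auto simp: cls_def)
    ultimately show ?thesis using card_mono[of "{K \<in> ?f ` V. e \<inter> K \<noteq> {}}" "{?f u, ?f v}"] fin
      by simp
  qed
  then have "6 * 2 \<le> (\<Sum>e\<in>M. card {K \<in> ?f ` V. e \<inter> K \<noteq> {}})"
    using sum_bounded_below[of M 2 "\<lambda>e. card {K \<in> ?f ` V. e \<inter> K \<noteq> {}}"] M(2) by simp
  ultimately show False by simp
qed

text \<open>Of six edges in \<open>M\<close> at most five belong to K4 - e, so one lies in an
  attached tree. Edges of \<open>M\<close> are not bridges here, whereas an edge of an attached tree
  is one.\<close>

lemma not_saves_color_diamond_trees:
  assumes sg: "simple_graph V E" and con: "connected_graph V E" and V: "4 \<le> card V"
    and G: "(V, E) \<in> K4_minus_edge_with_trees"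
  shows "\<not> saves_color V E"
proof
  assume "saves_color V E"
  then obtain c where col: "rainbow_coloring 4 V E (card V - 2) c" by (auto simp: saves_color_def)
  obtain W d A B where W: "card W = 4" "d \<in> all_pairs W" and tree: "\<And>w. w \<in> W \<Longrightarrow>
    tree_graph (A w) (B w)"
    and att: "attachment W (all_pairs W - {d}) A B V E"
    using G unfolding K4_minus_edge_with_trees_def by blast
  have wA: "\<And>w. w \<in> W \<Longrightarrow> w \<in> A w" and dis: "disjoint_family_on A W" and VA: "V = (\<Union>w\<in>W. A w)"
    and EB: "E = all_pairs W - {d} \<union> (\<Union>w\<in>W. B w)"
    using att by (auto simp: attachment_def)
  have uniq: "w = w'" if "w \<in> W" "w' \<in> W" "x \<in> A w" "x \<in> A w'" for w w' x
    using dis that unfolding disjoint_family_on_def by blast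
  have fin: "finite V" "finite E" using sg simple_graph_finite by metis+
  have finW: "finite W" using W(1) card.infinite by fastforce
  have sgB: "simple_graph (A w) (B w)" if "w \<in> W" for w using tree[OF that]
    by (simp add: tree_graph_def)
  have "card (all_pairs W) = 6" using n_subsets[OF finW, of 2] W(1)
    by (simp add: all_pairs_def choose_two)
  moreover have finp: "finite (all_pairs W)" using finW by (auto simp: all_pairs_def)
  ultimately have c5: "card (all_pairs W - {d}) = 5" using W(2) by simp
  \<comment> \<open>The four trees have n - 4 edges together, and the core has five.\<close>
  have ce: "card E \<le> card V + 1"
  proof -
    have "card (B w) + 1 = card (A w)" if "w \<in> W" for w
      using tree[OF that] tree_graph_iff_card[OF sgB[OF that]] by (simp add: tree_graph_def)
    then have "(\<Sum>w\<in>W. card (B w) + 1) = (\<Sum>w\<in>W. card (A w))" by (rule sum.cong[OF refl])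
    moreover have "card V = (\<Sum>w\<in>W. card (A w))"
      unfolding VA using dis finW simple_graph_finite(1)[OF sgB]
      by (intro card_UN_disjoint) (auto simp: disjoint_family_on_def)
    moreover have "(\<Sum>w\<in>W. card (B w) + 1) = (\<Sum>w\<in>W. card (B w)) + 4"
      using W(1) by (simp only: sum.distrib) simp
    ultimately have "(\<Sum>w\<in>W. card (B w)) + 4 = card V" by simp
    moreover have "card (\<Union>w\<in>W. B w) \<le> (\<Sum>w\<in>W. card (B w))" by (rule card_UN_le[OF finW])
    moreover have "card E \<le> card (all_pairs W - {d}) + card (\<Union>w\<in>W. B w)"
      unfolding EB by (rule card_Un_le)
    ultimately show ?thesis using c5 by linarith
  qed
  have lower: "card V \<le> card E + 1"
    by (rule card_edges_ge) (use fin con in \<open>auto simp: connected_graph_reach\<close>)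
  obtain M where M: "M \<subseteq> E" "card M = 6" "card (cls (E - M) ` V) = 5"
    "\<forall>u v. {u, v} \<in> M \<longrightarrow> \<not> reach (E - M) u v"
    "\<forall>k\<in>V. conn_set E (V - cls (E - M) k)" "card E = card V + 1"
    by (rule rainbow_few_colours_structure[OF sg V lower ce col])
  let ?f = "cls (E - M)"
  have "\<not> M \<subseteq> all_pairs W - {d}" using card_mono[of "all_pairs W - {d}" M] finp c5 M(2) by auto
  then obtain e w where e: "e \<in> M" "w \<in> W" "e \<in> B w" using M(1) EB by blast
  obtain p q where pq: "e = {p, q}" "p \<in> A w" "q \<in> A w" "p \<noteq> q"
    using simple_graph_edgeE[OF sgB[OF e(2)] e(3)] .
  have pqV: "p \<in> V" "q \<in> V" using pq e(2) VA by auto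
  have "?f p \<noteq> ?f q" using M(4) e pq by (simp add: cls_eq_iff)
  have "\<not> ?f ` V \<subseteq> {?f p, ?f q}"
  proof
    assume "?f ` V \<subseteq> {?f p, ?f q}"
    then have "card (?f ` V) \<le> card {?f p, ?f q}" by (intro card_mono) auto
    also have "\<dots> \<le> 2" by (simp add: card_insert_if)
    finally show False using M(3) by simp
  qed
  then obtain z where z: "z \<in> V" "?f z \<noteq> ?f p" "?f z \<noteq> ?f q" by auto
  \<comment> \<open>Removing the whole component of \<open>y\<close> leaves the graph connected, so
    \<open>x\<close> reaches \<open>z\<close> without \<open>y\<close> and thus without
    \<open>e\<close>. Used at both ends of \<open>e\<close>, this bypasses \<open>e\<close>.\<close>
  have avoid: "reach (E - {e}) x z"
    if xy: "{x, y} = e" "x \<in> V" "y \<in> V" "?f x \<noteq> ?f y" "?f z \<noteq> ?f y" for x y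
  proof -
    have "x \<notin> ?f y" "z \<notin> ?f y" using xy(4,5)
      by (simp_all add: cls_eq_iff) (auto simp: cls_def reach_sym)
    then have "reach (induced E (V - ?f y)) x z" using M(5)[rule_format, OF xy(3)] xy(2) z(1)
      by (auto simp: conn_set_def)
    moreover have "y \<in> ?f y" by (simp add: cls_def)
    then have "induced E (V - ?f y) \<subseteq> E - {e}" using xy(1) by (auto simp: induced_def)
    ultimately show ?thesis by (rule reach_mono)
  qed
  have "reach (E - {e}) p z" using avoid[of p q] pq pqV z \<open>?f p \<noteq> ?f q\<close> by simp
  moreover have "reach (E - {e}) q z"
    using avoid[of q p] pq pqV z \<open>?f p \<noteq> ?f q\<close> by (simp add: insert_commute)
  ultimately have r: "reach (E - {e}) p q" using reach_sym reach_trans by metis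
  \<comment> \<open>The retraction onto the tree at \<open>w\<close>: everything outside collapses
    to the root, so a detour around \<open>e\<close> becomes a detour inside the tree.\<close>
  define \<rho> where "\<rho> x = (if x \<in> A w then x else w)" for x
  have "reach (B w - {e}) (\<rho> x) (\<rho> y)" if xy: "{x, y} \<in> E - {e}" for x y
  proof -
    consider "{x, y} \<in> all_pairs W" | "{x, y} \<in> B w" | w' where "w' \<in> W" "w' \<noteq> w" "{x, y} \<in> B w'"
      using xy EB by blast
    then show ?thesis
    proof cases
      case 1
      then have "x \<in> W" "y \<in> W" by (auto simp: all_pairs_def)
      then have "\<rho> x = w" "\<rho> y = w" using uniq wA e(2) by (auto simp: \<rho>_def)
      then show ?thesis by simp
    next
      case 2
      then have "x \<in> A w" "y \<in> A w" using simple_graph_edge[OF sgB[OF e(2)]] by blast+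
      then show ?thesis using 2 xy by (intro reach_edge) (simp add: \<rho>_def)
    next
      case 3
      then have "x \<in> A w'" "y \<in> A w'" using simple_graph_edge[OF sgB[OF 3(1)]] by blast+
      then have "\<rho> x = w" "\<rho> y = w" using uniq[OF 3(1) e(2)] 3(2) by (auto simp: \<rho>_def)
      then show ?thesis by simp
    qed
  qed
  then have "reach (B w - {e}) (\<rho> p) (\<rho> q)" by (rule reach_lift[OF r])
  then have "reach (B w - {{p, q}}) p q" using pq by (simp add: \<rho>_def)
  then obtain C where "cycle_in (B w) C" using nonbridge_cycle[of p q "B w"] e pq by metis
  then show False using tree[OF e(2)] by (auto simp: tree_graph_def)
qed

text \<open>A connection between the four path ends has to run along all four paths and hence
  through all of \<open>V\<close>. It has at least n - 1 edges, too many for n - 2 colours.\<close>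

lemma not_saves_color_K4_paths:
  assumes sg: "simple_graph V E" and V: "4 \<le> card V" and G: "(V, E) \<in> K4_with_paths"
  shows "\<not> saves_color V E"
proof
  assume "saves_color V E"
  then obtain c where col: "rainbow_coloring 4 V E (card V - 2) c" by (auto simp: saves_color_def)
  obtain W A B where W: "card W = 4" and path: "\<forall>w\<in>W. path_graph_from w (A w) (B w)"
    and att: "attachment W (all_pairs W) A B V E"
    using G unfolding K4_with_paths_def by blast
  have wA: "\<And>w. w \<in> W \<Longrightarrow> w \<in> A w" and dis: "disjoint_family_on A W" and VA: "V = (\<Union>w\<in>W. A w)"
    and EB: "E = all_pairs W \<union> (\<Union>w\<in>W. B w)"
    using att by (auto simp: attachment_def)
  have uniq: "w = w'" if "w \<in> W" "w' \<in> W" "x \<in> A w" "x \<in> A w'" for w w' x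
    using dis that unfolding disjoint_family_on_def by blast
  obtain xs where xs: "\<And>w. w \<in> W \<Longrightarrow> xs w \<noteq> [] \<and> distinct (xs w) \<and> hd (xs w) = w \<and>
    A w = set (xs w) \<and> B w = path_edges (xs w)"
    using path unfolding path_graph_from_def by metis
  define t where "t w = last (xs w)" for w
  have tA: "t w \<in> A w" if "w \<in> W" for w using xs[OF that] by (simp add: t_def)
  have inj: "inj_on t W"
  proof (rule inj_onI)
    fix w w' assume "w \<in> W" "w' \<in> W" "t w = t w'"
    then show "w = w'" using uniq[of w w' "t w"] tA by metis
  qed
  have "t ` W \<subseteq> V" using tA VA by auto
  moreover have "card (t ` W) = 4" using inj W card_image by metis
  ultimately obtain F where F: "F \<subseteq> E" "inj_on c F" "\<And>x y. x \<in> t ` W \<Longrightarrow> y \<in> t ` W \<Longrightarrow> reach F x y"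
    using rainbow_coloringD[OF col] by metis
  have reach_path: "reach F (t w) x" if w: "w \<in> W" "x \<in> A w" for w x
  proof -
    obtain as bs where ab: "xs w = as @ x # bs" using xs[OF w(1)] w(2) by (metis split_list)
    show ?thesis
    proof (cases "bs = []")
      case True
      then show ?thesis using ab by (simp add: t_def)
    next
      case False
      have tb: "t w \<in> set bs" using ab False by (simp add: t_def)
      have "W \<noteq> {w}" using W by auto
      then obtain w' where w': "w' \<in> W" "w' \<noteq> w" using w(1) by auto
      have bsA: "set bs \<subseteq> A w" using xs[OF w(1)] ab by auto
      have nt: "t w' \<notin> set bs" using uniq[OF w'(1) w(1)] tA[OF w'(1)] bsA w'(2) by blast
      have wbs: "w \<notin> set bs" using xs[OF w(1)] ab by (cases as) auto
      \<comment> \<open>\<open>bs\<close> is the stretch of the path beyond \<open>x\<close> up to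
        its end \<open>t w\<close>. A walk to another path end leaves \<open>bs\<close>, and the
        only edge leading out runs from \<open>hd bs\<close> to \<open>x\<close>.\<close>
      let ?X = "{z \<in> set bs. reach F (t w) z}"
      have "reach F (t w) (t w')" using F(3) w w' by blast
      then obtain u v where uv: "{u, v} \<in> F" "u \<in> ?X" "v \<notin> ?X"
        using tb nt by (rule_tac reach_cross[of F "t w" "t w'" ?X]) auto
      then have rv: "reach F (t w) v" using reach_edge[OF uv(1)] reach_trans
        by (metis (mono_tags, lifting) mem_Collect_eq)
      then have vb: "v \<notin> set bs" and ub: "u \<in> set bs" using uv by auto
      have uA: "u \<in> A w" "u \<noteq> w" using ub bsA wbs by auto
      have "{u, v} \<in> E" using uv F by auto
      moreover have "{u, v} \<notin> all_pairs W"
      proof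
        assume "{u, v} \<in> all_pairs W"
        then have "u \<in> W" by (auto simp: all_pairs_def)
        then show False using uniq[of u w u] wA w uA by metis
      qed
      ultimately obtain w2 where w2: "w2 \<in> W" "{u, v} \<in> B w2" using EB by blast
      then have "u \<in> A w2" using xs[OF w2(1)] path_edges_sub[of "{u, v}" "xs w2"] by simp
      then have "w2 = w" using uniq[OF w2(1) w(1)] uA by metis
      then have "{u, v} \<in> path_edges ((as @ [x]) @ bs)" using w2 xs[OF w(1)] ab by simp
      then have "{u, v} = {x, hd bs} \<or> {u, v} \<in> path_edges (as @ [x]) \<or> {u, v} \<in> path_edges bs"
        using False path_edges_append[of "as @ [x]" bs] by auto
      moreover have "{u, v} \<notin> path_edges bs" using path_edges_sub[of "{u, v}" bs] vb by auto
      moreover have "{u, v} \<notin> path_edges (as @ [x])"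
        using path_edges_sub[of "{u, v}" "as @ [x]"] ub xs[OF w(1)] ab by auto
      moreover have "hd bs \<in> set bs" using False by simp
      ultimately have "v = x" using vb by (auto simp: doubleton_eq_iff)
      then show ?thesis using rv by simp
    qed
  qed
  have all: "reach F x y" if xy: "x \<in> V" "y \<in> V" for x y
  proof -
    obtain w w' where "w \<in> W" "x \<in> A w" "w' \<in> W" "y \<in> A w'" using xy VA by auto
    then have "reach F (t w) x" "reach F (t w') y" "reach F (t w) (t w')" using reach_path F(3)
      by blast+
    then show ?thesis using reach_sym reach_trans by metis
  qed
  have fin: "finite V" "finite F" using sg F(1) simple_graph_finite finite_subset by metis+
  have "card V \<le> card F + 1" by (rule card_edges_ge[OF fin all])
  moreover have "card F = card (c ` F)" using F(2) by (simp add: card_image)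
  moreover have "c ` E \<subseteq> {1..card V - 2}" using col by (simp add: rainbow_coloring_def)
  then have "c ` F \<subseteq> {1..card V - 2}" using image_mono[OF F(1), of c]
    by (rule order_trans[rotated])
  then have "card (c ` F) \<le> card V - 2" using card_mono[of "{1..card V - 2}" "c ` F"] by simp
  ultimately show False using V by simp
qed

theorem theorem3p7:
  fixes V :: "'a set" and E :: "'a set set" and n :: nat
  assumes "simple_graph V E" and "connected_graph V E"
    and "card V = n" and "n \<ge> 4"
  shows "rainbow_index 4 V E = n - 1 \<longleftrightarrow>
    tree_graph V E \<or> unicyclic V E \<or> (cactus V E \<and> cyclomatic V E = 2) \<or>
    (V, E) \<in> K4_with_paths \<union> K4_minus_edge_with_trees"
proof -
  have V: "4 \<le> card V" using assms(3,4) by simp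
  have "rainbow_index 4 V E = n - 1 \<longleftrightarrow> \<not> saves_color V E"
    using rainbow_index_eq_iff[OF assms(1,2), of 4] V assms(3) by (simp add: saves_color_def)
  \<comment> \<open>Trees and unicyclic graphs have at most n edges, so for them the condition on
    bonds asks nothing.\<close>
  moreover have "\<not> saves_color V E" if "tree_graph V E"
    using that tree_graph_iff_card[OF assms(1,2)] not_saves_color_no_big_bond[OF assms(1,2) V]
      by simp
  moreover have "\<not> saves_color V E" if "unicyclic V E"
    using that not_saves_color_no_big_bond[OF assms(1,2) V]
      by (simp add: unicyclic_def cyclomatic_def)
  moreover have "\<not> saves_color V E" if "cactus V E \<and> cyclomatic V E = 2"
    using that not_saves_color_no_big_bond[OF assms(1,2) V] big_bond_not_cactus[OF assms(1)]
    by (auto simp: cyclomatic_def)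
  moreover note not_saves_color_classes[OF assms(1,2)] not_saves_color_K4_paths[OF assms(1) V]
    not_saves_color_diamond_trees[OF assms(1,2) V]
  ultimately show ?thesis by blast
qed

end
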